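(* With notation as in the context, if $\overline{\mathbb M}=\mathbb G$, then the cut locus of $o$ is exactly $\mathbb M^c=\partial\mathbb M$, i.e. $\mathrm{Cut}_o=\mathbb G\setminus\mathbb M$.
   Context: Let $q,m\ge1$, $U^{(1)},\dots,U^{(m)}$ linearly independent real skew-symmetric $q\times q$ matrices; $\mathbb G=\mathbb R^q\times\mathbb R^m$ with law $(x,t)\cdot(x',t')=(x+x',t+t'+\frac12\langle\mathbb Ux,x'\rangle)$, $\langle\mathbb Ux,x'\rangle=(\langle U^{(j)}x,x'\rangle)_j$, identity $o$; $d(g)$ is the Carnot–Carathéodory distance from $o$ (infimum of $\int_0^1|x'|$ over absolutely continuous curves from $o$ to $g$ with $t'=\frac12\langle\mathbb Ux,x'\rangle$). $U(\tau)=i\sum_j\tau_jU^{(j)}$, $\Omega_*=\{\tau:\|U(\tau)\|<\pi\}$, $\phi((x,t);\tau)=\langle U(\tau)\cot U(\tau)x,x\rangle+4t\cdot\tau$. $\mathbb M$ is the set of $g$ such that $\phi(g;\cdot)$ has a nondegenerate critical point in $\Omega_*$ (an open set). $\mathrm{Cut}_o$ is the complement of $\{g:\ d^2$ is $C^\infty$ in a neighborhood of $g\}$. *)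

theory Defs
  imports "HOL-Analysis.Analysis"
begin

text \<open>Points of the group G = R^q x R^m are pairs (x,t) :: (real^'q) \<times> (real^'m).
  The structure is given by a family U :: 'm \<Rightarrow> real^'q^'q of real matrices.\<close>

text \<open>Horizontal curves from o: x(s) = int_0^s h, h in L^1([0,1]) (i.e. x absolutely
  continuous with x' = h a.e., x(0)=0), and t(s) = int_0^s 1/2 <U x, x'>.\<close>

definition hx :: "(real \<Rightarrow> real^'q) \<Rightarrow> real \<Rightarrow> real^'q" where
  "hx h s = integral {0..s} h"

definition ht :: "('m \<Rightarrow> real^'q^'q) \<Rightarrow> (real \<Rightarrow> real^'q) \<Rightarrow> real \<Rightarrow> real^'m" where
  "ht U h s = integral {0..s} (\<lambda>r. (1/2) *\<^sub>R (\<chi> j. (U j *v hx h r) \<bullet> h r))"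

text \<open>Carnot--Caratheodory distance from the identity o = (0,0).\<close>
definition cc_dist :: "('m::finite \<Rightarrow> real^'q^'q) \<Rightarrow> (real^'q::finite) \<times> (real^'m) \<Rightarrow> real" where
  "cc_dist U g = Inf {integral {0..1} (\<lambda>r. norm (h r)) | h.
      h absolutely_integrable_on {0..1} \<and> (hx h 1, ht U h 1) = g}"

text \<open>C-infinity on a set S: all iterated partial derivatives exist (as Frechet
  derivatives) and are continuous on S. D vs is the iterated partial derivative
  along the list vs of basis directions.\<close>
definition Cinf_on :: "'a::euclidean_space set \<Rightarrow> ('a \<Rightarrow> real) \<Rightarrow> bool" where
  "Cinf_on S f \<longleftrightarrow> (\<exists>D :: 'a list \<Rightarrow> 'a \<Rightarrow> real. D [] = f \<and>
      (\<forall>vs. continuous_on S (D vs)) \<and>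
      (\<forall>vs. \<forall>x\<in>S. (D vs has_derivative (\<lambda>v. \<Sum>b\<in>Basis. (v \<bullet> b) * D (b # vs) x)) (at x)))"

definition cut_locus :: "('m::finite \<Rightarrow> real^'q^'q) \<Rightarrow> ((real^'q::finite) \<times> (real^'m)) set" where
  "cut_locus U = - {g. \<exists>S. open S \<and> g \<in> S \<and> Cinf_on S (\<lambda>p. (cc_dist U p)\<^sup>2)}"

text \<open>U(tau) = i sum_j tau_j U^(j), a complex (Hermitian) matrix.\<close>
definition Utau :: "('m::finite \<Rightarrow> real^'q^'q) \<Rightarrow> real^'m \<Rightarrow> complex^'q::finite^'q" where
  "Utau U \<tau> = (\<chi> a b. \<i> * complex_of_real (\<Sum>j\<in>UNIV. \<tau>$j * (U j)$a$b))"

text \<open>Operator norm of a complex matrix acting on C^q.\<close>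
definition opnorm :: "complex^'q::finite^'q \<Rightarrow> real" where
  "opnorm A = onorm (\<lambda>v::complex^'q. A *v v)"

definition Omega_star :: "('m::finite \<Rightarrow> real^'q::finite^'q) \<Rightarrow> (real^'m) set" where
  "Omega_star U = {\<tau>. opnorm (Utau U \<tau>) < pi}"

text \<open>z cot z (extended by 1 at 0) and its Taylor coefficients at 0; z cot z as a
  matrix function is defined by its power series (radius pi).\<close>
definition zcot :: "complex \<Rightarrow> complex" where
  "zcot z = (if z = 0 then 1 else z * cot z)"

definition zcot_coeff :: "nat \<Rightarrow> complex" where
  "zcot_coeff n = (deriv ^^ n) zcot 0 / fact n"

definition cmatpow :: "complex^'q::finite^'q \<Rightarrow> nat \<Rightarrow> complex^'q^'q" where
  "cmatpow A n = (((**) A) ^^ n) (mat 1)"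

definition cmat_scale :: "complex \<Rightarrow> complex^'q::finite^'q \<Rightarrow> complex^'q^'q" where
  "cmat_scale c A = (\<chi> a b. c * A$a$b)"

definition mat_zcot :: "complex^'q::finite^'q \<Rightarrow> complex^'q^'q" where
  "mat_zcot A = (\<Sum>n. cmat_scale (zcot_coeff n) (cmatpow A n))"

text \<open>phi((x,t);tau) = <U(tau) cot U(tau) x, x> + 4 t.tau  (the quadratic form is real
  since U(tau)cot U(tau) is real symmetric; we take its real part).\<close>
definition phi :: "('m::finite \<Rightarrow> real^'q::finite^'q) \<Rightarrow> (real^'q) \<times> (real^'m) \<Rightarrow> real^'m \<Rightarrow> real" where
  "phi U g \<tau> = (let x = fst g; t = snd g; M = mat_zcot (Utau U \<tau>) in
     Re (\<Sum>a\<in>UNIV. \<Sum>b\<in>UNIV. M$a$b * complex_of_real (x$b) * complex_of_real (x$a))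
     + 4 * (t \<bullet> \<tau>))"

text \<open>Nondegenerate critical point: gradient vanishes and Hessian (derivative of the
  gradient) is injective, i.e. nonsingular.\<close>
definition nondeg_crit :: "(real^'m::finite \<Rightarrow> real) \<Rightarrow> real^'m \<Rightarrow> bool" where
  "nondeg_crit f \<tau> \<longleftrightarrow> (\<exists>G H. eventually (\<lambda>\<sigma>. (f has_derivative (\<lambda>h. G \<sigma> \<bullet> h)) (at \<sigma>)) (nhds \<tau>)
      \<and> G \<tau> = 0 \<and> (G has_derivative H) (at \<tau>) \<and> inj H)"

definition MM :: "('m::finite \<Rightarrow> real^'q::finite^'q) \<Rightarrow> ((real^'q) \<times> (real^'m)) set" where
  "MM U = {g. \<exists>\<tau>\<in>Omega_star U. nondeg_crit (phi U g) \<tau>}"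

end

theory Submission
  imports Defs "HOL-Complex_Analysis.Complex_Analysis"
begin

text \<open>
  Put \<open>J(\<tau>) = \<Sum>\<^sub>j \<tau>\<^sub>j U\<^sub>j\<close>, a real skew matrix, so that \<open>U(\<tau>) cot U(\<tau>) = J coth J\<close>. The operators
  \<open>K\<^sub>s = J coth (s J)\<close> satisfy the Riccati equation \<open>K\<^sub>s' = J\<^sup>2 - K\<^sub>s\<^sup>2\<close>, and integrating it along a
  horizontal curve gives \<open>\<phi>(g; \<tau>) \<le> L\<^sup>2\<close> for every \<open>\<tau> \<in> \<Omega>\<^sub>*\<close> and every curve of length \<open>L\<close> from
  \<open>o\<close> to \<open>g\<close>. The curve with velocity \<open>exp (2 r J(\<tau>)) \<zeta>\<close> attains this bound, hence \<open>\<tau>\<close> is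
  critical for its endpoint, and conversely a critical point \<open>\<theta>\<close> of \<open>\<phi>(g; \<cdot>)\<close> gives
  \<open>d(g)\<^sup>2 = \<phi>(g; \<theta>)\<close>. Nondegeneracy makes \<open>\<theta>\<close> a smooth function of \<open>g\<close>, so \<open>d\<^sup>2\<close> is smooth
  on \<open>MM\<close>.

  Conversely, let \<open>d\<^sup>2\<close> be smooth near \<open>g\<^sub>0\<close>. On the dense set \<open>MM\<close> the gradient of \<open>d\<^sup>2\<close>
  determines the geodesic parameters \<open>(\<zeta>, \<tau>)\<close> of a point, so by continuity the geodesic endpoint
  map is a left inverse of \<open>g \<mapsto> (\<zeta>(g), \<tau>(g))\<close> near \<open>g\<^sub>0\<close>. By invariance of domain the latter map
  is open; as \<open>\<tau>\<close> takes values in the closure of \<open>\<Omega>\<^sub>*\<close>, this forces \<open>\<tau>(g\<^sub>0) \<in> \<Omega>\<^sub>*\<close>.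
  Differentiating the critical point equation in \<open>t\<close> shows that the Hessian at \<open>\<tau>(g\<^sub>0)\<close> is
  invertible.
\<close>

unbundle no fps_syntax

subsection \<open>The Banach algebra of endomorphisms\<close>

text \<open>A copy of the bounded operators, since \<open>'a \<Rightarrow>\<^sub>L 'a\<close> cannot itself be made an instance of the
  algebra classes.\<close>
typedef (overloaded) 'a endo = "UNIV :: ('a::euclidean_space \<Rightarrow>\<^sub>L 'a) set"
  morphisms endo_blinfun Endo
  by simp

setup_lifting type_definition_endo

instantiation endo :: (euclidean_space) real_normed_vector
begin

lift_definition zero_endo :: "'a endo" is 0 .
lift_definition plus_endo :: "'a endo \<Rightarrow> 'a endo \<Rightarrow> 'a endo" is "(+)" .
lift_definition minus_endo :: "'a endo \<Rightarrow> 'a endo \<Rightarrow> 'a endo" is "(-)" .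
lift_definition uminus_endo :: "'a endo \<Rightarrow> 'a endo" is uminus .
lift_definition scaleR_endo :: "real \<Rightarrow> 'a endo \<Rightarrow> 'a endo" is scaleR .
lift_definition norm_endo :: "'a endo \<Rightarrow> real" is norm .
definition sgn_endo :: "'a endo \<Rightarrow> 'a endo" where "sgn_endo A = scaleR (inverse (norm A)) A"
definition dist_endo :: "'a endo \<Rightarrow> 'a endo \<Rightarrow> real" where "dist_endo A B = norm (A - B)"
definition uniformity_endo :: "('a endo \<times> 'a endo) filter" where
  "uniformity_endo = (INF e\<in>{0<..}. principal {(x, y). dist x y < e})"
definition open_endo :: "'a endo set \<Rightarrow> bool" where
  "open_endo S = (\<forall>x\<in>S. \<forall>\<^sub>F (x', y) in uniformity. x' = x \<longrightarrow> y \<in> S)"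

instance
proof
  show "dist A B = norm (A - B)" for A B :: "'a endo" by (rule dist_endo_def)
  show "sgn A = scaleR (inverse (norm A)) A" for A :: "'a endo" by (rule sgn_endo_def)
  show "norm (A + B) \<le> norm A + norm B" for A B :: "'a endo"
    by transfer (rule norm_triangle_ineq)
qed (rule uniformity_endo_def open_endo_def | transfer, simp add: algebra_simps)+

end

instantiation endo :: (euclidean_space) real_normed_algebra_1
begin

lift_definition one_endo :: "'a endo" is id_blinfun .
lift_definition times_endo :: "'a endo \<Rightarrow> 'a endo \<Rightarrow> 'a endo" is blinfun_compose .

instance
proof
  have nz: "\<exists>x::'a. x \<noteq> 0"
    using nonzero_Basis nonempty_Basis by blast
  show "norm (1::'a endo) = 1"
    using nz by transfer (metis norm_blinfun_id)
  show "(0::'a endo) \<noteq> 1"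
    using nz by transfer (metis blinfun_apply_id_blinfun zero_blinfun.rep_eq)
  show "norm (A * B) \<le> norm A * norm B" for A B :: "'a endo"
    by transfer (rule norm_blinfun_compose)
qed (transfer; rule blinfun_eqI; simp add: blinfun.bilinear_simps)+

end

lemma dist_endo_blinfun: "dist (endo_blinfun A) (endo_blinfun B) = dist A B"
  by (simp add: dist_norm norm_endo.rep_eq minus_endo.rep_eq)

instance endo :: (euclidean_space) banach
proof
  fix X :: "nat \<Rightarrow> 'a endo"
  assume "Cauchy X"
  then have "Cauchy (\<lambda>n. endo_blinfun (X n))"
    unfolding Cauchy_def dist_endo_blinfun .
  then obtain L where "(\<lambda>n. endo_blinfun (X n)) \<longlonglongrightarrow> L"
    using Cauchy_convergent convergent_def by blast
  then have "(\<lambda>n. endo_blinfun (X n)) \<longlonglongrightarrow> endo_blinfun (Endo L)"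
    by (simp add: Endo_inverse)
  then have "X \<longlonglongrightarrow> Endo L"
    unfolding lim_sequentially dist_endo_blinfun .
  then show "convergent X"
    by (auto simp: convergent_def)
qed

lift_definition app :: "'a::euclidean_space endo \<Rightarrow> 'a \<Rightarrow> 'a" (infixr "\<bullet>\<^sub>v" 75) is blinfun_apply .

lemma bounded_bilinear_app: "bounded_bilinear (app :: 'a::euclidean_space endo \<Rightarrow> _)"
proof
  show "\<exists>K. \<forall>(A::'a endo) x. norm (A \<bullet>\<^sub>v x) \<le> norm A * norm x * K"
    by (rule exI[of _ 1]) (auto, transfer, rule norm_blinfun)
qed (transfer; simp add: blinfun.bilinear_simps)+

interpretation app: bounded_bilinear "app :: 'a::euclidean_space endo \<Rightarrow> _"
  by (rule bounded_bilinear_app)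

lemma norm_app_le: "norm (A \<bullet>\<^sub>v x) \<le> norm A * norm x"
  by transfer (rule norm_blinfun)

lemma app_mult [simp]: "(A * B) \<bullet>\<^sub>v x = A \<bullet>\<^sub>v B \<bullet>\<^sub>v x"
  by transfer simp

lemma app_one [simp]: "1 \<bullet>\<^sub>v x = x"
  by transfer simp

lemma endo_eqI: "(\<And>x. A \<bullet>\<^sub>v x = B \<bullet>\<^sub>v x) \<Longrightarrow> A = B"
  by transfer (rule blinfun_eqI)

lemma norm_endo_le: "0 \<le> b \<Longrightarrow> (\<And>x. norm (A \<bullet>\<^sub>v x) \<le> b * norm x) \<Longrightarrow> norm A \<le> b"
  by transfer (rule norm_blinfun_bound)

definition endo_of :: "('a::euclidean_space \<Rightarrow> 'a) \<Rightarrow> 'a endo" where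
  "endo_of f = Endo (Blinfun f)"

lemma app_endo_of: "linear f \<Longrightarrow> endo_of f \<bullet>\<^sub>v x = f x"
  unfolding endo_of_def
  by (simp add: app.rep_eq Endo_inverse bounded_linear_Blinfun_apply linear_conv_bounded_linear)

subsection \<open>Functions of class \<open>C\<^sup>k\<close>\<close>

primrec Ck_on :: "nat \<Rightarrow> 'a::euclidean_space set \<Rightarrow> ('a \<Rightarrow> 'b::real_normed_vector) \<Rightarrow> bool" where
  "Ck_on 0 S f \<longleftrightarrow> continuous_on S f"
| "Ck_on (Suc k) S f \<longleftrightarrow>
    (\<exists>f'. (\<forall>x\<in>S. (f has_derivative f' x) (at x)) \<and> (\<forall>v. Ck_on k S (\<lambda>x. f' x v)))"

lemma Ck_on_SucI:
  assumes "\<And>x. x \<in> S \<Longrightarrow> (f has_derivative f' x) (at x)" and "\<And>v. Ck_on k S (\<lambda>x. f' x v)"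
  shows "Ck_on (Suc k) S f"
  using assms by auto

lemma Ck_on_imp_continuous_on: "Ck_on k S f \<Longrightarrow> continuous_on S f"
proof (cases k)
  case (Suc l)
  assume "Ck_on k S f"
  then obtain f' where "\<And>x. x \<in> S \<Longrightarrow> (f has_derivative f' x) (at x)"
    unfolding Suc by auto
  then show ?thesis
    by (blast intro: has_derivative_continuous_on has_derivative_at_withinI)
qed simp

lemma Ck_on_Suc_imp: "Ck_on (Suc k) S f \<Longrightarrow> Ck_on k S f"
proof (induction k arbitrary: f)
  case 0
  then show ?case using Ck_on_imp_continuous_on Ck_on.simps(1) by blast
next
  case (Suc k)
  then show ?case by (metis Ck_on.simps(2))
qed

lemma Ck_on_cong:
  assumes "open S" "Ck_on k S f" "\<And>x. x \<in> S \<Longrightarrow> f x = g x"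
  shows "Ck_on k S g"
proof (cases k)
  case 0
  then show ?thesis using assms by (auto cong: continuous_on_cong)
next
  case (Suc l)
  then obtain f' where f': "\<And>x. x \<in> S \<Longrightarrow> (f has_derivative f' x) (at x)" "\<And>v. Ck_on l S (\<lambda>x. f' x v)"
    using assms by auto
  have "(g has_derivative f' x) (at x)" if "x \<in> S" for x
    by (rule has_derivative_transform_within_open[OF f'(1)[OF that] assms(1) that])
       (use assms in auto)
  then show ?thesis using f'(2) Suc by auto
qed

lemma Ck_on_subset: "Ck_on k S f \<Longrightarrow> T \<subseteq> S \<Longrightarrow> Ck_on k T f"
proof (induction k arbitrary: f)
  case 0
  then show ?case by (auto intro: continuous_on_subset)
next
  case (Suc k)
  obtain f' where "\<And>x. x \<in> S \<Longrightarrow> (f has_derivative f' x) (at x)" "\<And>v. Ck_on k S (\<lambda>x. f' x v)"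
    using Suc.prems(1) by auto
  then show ?case
    using Suc by (intro Ck_on_SucI[of _ _ f']) auto
qed

lemma Ck_on_frechet_derivative:
  assumes "open S" "Ck_on (Suc k) S f"
  shows "x \<in> S \<Longrightarrow> (f has_derivative frechet_derivative f (at x)) (at x)"
    and "Ck_on k S (\<lambda>x. frechet_derivative f (at x) v)"
proof -
  obtain f' where f': "\<And>x. x \<in> S \<Longrightarrow> (f has_derivative f' x) (at x)" "\<And>v. Ck_on k S (\<lambda>x. f' x v)"
    using assms(2) by auto
  have eq: "frechet_derivative f (at x) = f' x" if "x \<in> S" for x
    using frechet_derivative_at[OF f'(1)[OF that]] by simp
  show "(f has_derivative frechet_derivative f (at x)) (at x)" if "x \<in> S"
    using f'(1) that by (simp add: eq)
  show "Ck_on k S (\<lambda>x. frechet_derivative f (at x) v)"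
    by (rule Ck_on_cong[OF assms(1) f'(2)[of v]]) (simp add: eq)
qed

lemma Ck_on_local:
  assumes "\<And>x. x \<in> S \<Longrightarrow> \<exists>T. open T \<and> x \<in> T \<and> Ck_on k T f"
  shows "Ck_on k S f"
  using assms
proof (induction k arbitrary: f)
  case 0
  then have "continuous (at x) f" if "x \<in> S" for x
    using that by (metis Ck_on.simps(1) continuous_on_eq_continuous_at)
  then show ?case by (simp add: continuous_at_imp_continuous_on)
next
  case (Suc k)
  show ?case
  proof (rule Ck_on_SucI[of _ _ "\<lambda>x. frechet_derivative f (at x)"])
    show "(f has_derivative frechet_derivative f (at x)) (at x)" if "x \<in> S" for x
    proof -
      obtain T where T: "open T" "x \<in> T" "Ck_on (Suc k) T f" using Suc.prems[OF \<open>x \<in> S\<close>] by meson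
      show ?thesis by (rule Ck_on_frechet_derivative(1)[OF T(1,3,2)])
    qed
    show "Ck_on k S (\<lambda>x. frechet_derivative f (at x) v)" for v
    proof (rule Suc.IH)
      fix x assume "x \<in> S"
      then obtain T where T: "open T" "x \<in> T" "Ck_on (Suc k) T f" using Suc.prems by meson
      show "\<exists>T. open T \<and> x \<in> T \<and> Ck_on k T (\<lambda>x. frechet_derivative f (at x) v)"
        by (intro exI[of _ T] conjI T Ck_on_frechet_derivative(2)[OF T(1,3)])
    qed
  qed
qed

lemma Ck_on_const: "Ck_on k S (\<lambda>x. c)"
proof (induction k arbitrary: c)
  case (Suc k)
  show ?case by (rule Ck_on_SucI[of _ _ "\<lambda>x v. 0"]) (use Suc in auto)
qed simp

lemma Ck_on_bounded_linear:
  assumes "bounded_linear L" shows "Ck_on k S L"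
proof (cases k)
  case 0
  then show ?thesis using assms by (simp add: linear_continuous_on)
next
  case (Suc l)
  show ?thesis unfolding Suc
    using assms
    by (intro Ck_on_SucI[of _ _ "\<lambda>x. L"])
      (auto intro: bounded_linear_imp_has_derivative Ck_on_const)
qed

lemma Ck_on_bounded_linear_compose:
  assumes "bounded_linear L" "Ck_on k S f" shows "Ck_on k S (\<lambda>x. L (f x))"
  using assms(2)
proof (induction k arbitrary: f)
  case 0
  then show ?case using assms(1) by (simp add: bounded_linear.continuous_on)
next
  case (Suc k)
  obtain f' where "\<And>x. x \<in> S \<Longrightarrow> (f has_derivative f' x) (at x)" "\<And>v. Ck_on k S (\<lambda>x. f' x v)"
    using Suc.prems by auto
  then show ?case
    using Suc.IH
    by (intro Ck_on_SucI[of _ _ "\<lambda>x v. L (f' x v)"])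
       (auto intro: bounded_linear.has_derivative[OF assms(1)])
qed

lemma Ck_on_add:
  assumes "Ck_on k S f" "Ck_on k S g" shows "Ck_on k S (\<lambda>x. f x + g x)"
  using assms
proof (induction k arbitrary: f g)
  case 0
  then show ?case by (auto intro: continuous_on_add)
next
  case (Suc k)
  obtain f' where f': "\<And>x. x \<in> S \<Longrightarrow> (f has_derivative f' x) (at x)" "\<And>v. Ck_on k S (\<lambda>x. f' x v)"
    using Suc.prems(1) by auto
  obtain g' where g': "\<And>x. x \<in> S \<Longrightarrow> (g has_derivative g' x) (at x)" "\<And>v. Ck_on k S (\<lambda>x. g' x v)"
    using Suc.prems(2) by auto
  show ?case
    by (rule Ck_on_SucI[OF has_derivative_add[OF f'(1) g'(1)] Suc.IH[OF f'(2) g'(2)]])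
qed

lemma Ck_on_sum:
  assumes "finite A" "\<And>i. i \<in> A \<Longrightarrow> Ck_on k S (f i)" shows "Ck_on k S (\<lambda>x. \<Sum>i\<in>A. f i x)"
  using assms by (induction A rule: finite_induct) (auto intro: Ck_on_const Ck_on_add)

lemma Ck_on_bounded_bilinear:
  assumes "bounded_bilinear pr" "Ck_on k S f" "Ck_on k S g"
  shows "Ck_on k S (\<lambda>x. pr (f x) (g x))"
  using assms(2,3)
proof (induction k arbitrary: f g)
  case 0
  then show ?case using assms(1) by (auto intro: bounded_bilinear.continuous_on)
next
  case (Suc k)
  obtain f' where f': "\<And>x. x \<in> S \<Longrightarrow> (f has_derivative f' x) (at x)" "\<And>v. Ck_on k S (\<lambda>x. f' x v)"
    using Suc.prems(1) by auto
  obtain g' where g': "\<And>x. x \<in> S \<Longrightarrow> (g has_derivative g' x) (at x)" "\<And>v. Ck_on k S (\<lambda>x. g' x v)"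
    using Suc.prems(2) by auto
  have fg: "Ck_on k S f" "Ck_on k S g"
    using Suc.prems Ck_on_Suc_imp by blast+
  show ?case
    by (rule Ck_on_SucI[OF bounded_bilinear.FDERIV[OF assms(1) f'(1) g'(1)]])
       (assumption, assumption, intro Ck_on_add Suc.IH fg f'(2) g'(2))
qed

lemma Ck_on_Pair:
  assumes "Ck_on k S f" "Ck_on k S g" shows "Ck_on k S (\<lambda>x. (f x, g x))"
proof -
  have "Ck_on k S (\<lambda>x. (f x, 0) + (0, g x))"
    by (intro Ck_on_add assms Ck_on_bounded_linear_compose[where L = "\<lambda>u. (u, 0)"]
        Ck_on_bounded_linear_compose[where L = "\<lambda>u. (0, u)"])
       (auto intro!: bounded_linear_Pair bounded_linear_ident bounded_linear_zero)
  then show ?thesis by simp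
qed

lemma linear_eq_sum_Basis:
  fixes f :: "'a::euclidean_space \<Rightarrow> 'b::real_vector"
  assumes "linear f" shows "f v = (\<Sum>b\<in>Basis. (v \<bullet> b) *\<^sub>R f b)"
  by (subst euclidean_representation[of v, symmetric])
     (simp only: linear_sum[OF assms] linear_cmul[OF assms])

lemma Ck_on_compose:
  fixes g :: "'a::euclidean_space \<Rightarrow> 'b::euclidean_space" and f :: "'b \<Rightarrow> 'c::real_normed_vector"
  assumes "Ck_on k T f" "Ck_on k S g" "g ` S \<subseteq> T"
  shows "Ck_on k S (\<lambda>x. f (g x))"
  using assms(1,2)
proof (induction k arbitrary: f)
  case 0
  then show ?case using assms(3) by (auto intro: continuous_on_compose2)
next
  case (Suc k)
  obtain f' where f': "\<And>x. x \<in> T \<Longrightarrow> (f has_derivative f' x) (at x)" "\<And>v. Ck_on k T (\<lambda>x. f' x v)"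
    using Suc.prems(1) by auto
  obtain g' where g': "\<And>x. x \<in> S \<Longrightarrow> (g has_derivative g' x) (at x)" "\<And>v. Ck_on k S (\<lambda>x. g' x v)"
    using Suc.prems(2) by auto
  have derivative: "((\<lambda>x. f (g x)) has_derivative
      (\<lambda>v. \<Sum>b\<in>Basis. (g' x v \<bullet> b) *\<^sub>R f' (g x) b)) (at x)"
    if "x \<in> S" for x
  proof -
    have f'_gx: "(f has_derivative f' (g x)) (at (g x))"
      using f'(1) assms(3) that by blast
    have "f' (g x) (g' x v) = (\<Sum>b\<in>Basis. (g' x v \<bullet> b) *\<^sub>R f' (g x) b)" for v
      by (rule linear_eq_sum_Basis[OF has_derivative_linear[OF f'_gx]])
    then show ?thesis
      using has_derivative_compose[OF g'(1)[OF that] f'_gx] by (simp only:)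
  qed
  show ?case
  proof (rule Ck_on_SucI[OF derivative])
    have "Ck_on k S (\<lambda>x. f' (g x) b)" for b
      using Suc.IH[OF f'(2)[of b]] Suc.prems(2) Ck_on_Suc_imp by blast
    then show "Ck_on k S (\<lambda>x. \<Sum>b\<in>Basis. (g' x v \<bullet> b) *\<^sub>R f' (g x) b)" for v
      by (intro Ck_on_sum Ck_on_bounded_bilinear[OF bounded_bilinear_scaleR]
          Ck_on_bounded_linear_compose[OF bounded_linear_inner_left] g'(2)) auto
  qed
qed

lemma Cinf_on_imp_Ck_on:
  fixes f :: "'a::euclidean_space \<Rightarrow> real"
  assumes "Cinf_on S f" shows "Ck_on k S f"
proof -
  obtain D where D_Nil: "D [] = f" and continuous: "\<And>vs. continuous_on S (D vs)"
    and derivative: "\<And>vs x. x \<in> S \<Longrightarrow>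
      (D vs has_derivative (\<lambda>v. \<Sum>b\<in>Basis. (v \<bullet> b) * D (b # vs) x)) (at x)"
    using assms unfolding Cinf_on_def by blast
  have "Ck_on k S (D vs)" for k vs
  proof (induction k arbitrary: vs)
    case 0
    show ?case by (simp add: continuous)
  next
    case (Suc k)
    show ?case
      by (intro Ck_on_SucI[OF derivative] Ck_on_sum finite_Basis
          Ck_on_bounded_linear_compose[OF bounded_linear_mult_right] Suc)
  qed
  from this[of k "[]"] show ?thesis by (simp add: D_Nil)
qed

lemma Ck_on_imp_Cinf_on:
  fixes f :: "'a::euclidean_space \<Rightarrow> real"
  assumes "open S" "\<And>k. Ck_on k S f" shows "Cinf_on S f"
proof -
  define D where "D = rec_list f (\<lambda>b (vs::'a list) g x. frechet_derivative g (at x) b)"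
  have D: "D [] = f" "D (b # vs) = (\<lambda>x. frechet_derivative (D vs) (at x) b)" for b vs
    by (simp_all add: D_def)
  have Ck_D: "Ck_on k S (D vs)" for k vs
  proof (induction vs arbitrary: k)
    case Nil
    then show ?case by (simp add: D assms(2))
  next
    case (Cons b vs)
    show ?case unfolding D by (rule Ck_on_frechet_derivative(2)[OF assms(1) Cons])
  qed
  have "(D vs has_derivative (\<lambda>v. \<Sum>b\<in>Basis. (v \<bullet> b) * D (b # vs) x)) (at x)" if "x \<in> S" for vs x
  proof -
    have derivative: "(D vs has_derivative frechet_derivative (D vs) (at x)) (at x)"
      by (rule Ck_on_frechet_derivative(1)[OF assms(1) Ck_D that])
    have "frechet_derivative (D vs) (at x) = (\<lambda>v. \<Sum>b\<in>Basis. (v \<bullet> b) * D (b # vs) x)"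
      unfolding D(2) real_scaleR_def[symmetric]
      by (rule ext) (rule linear_eq_sum_Basis[OF has_derivative_linear[OF derivative]])
    then show ?thesis using derivative by (simp only:)
  qed
  then show ?thesis
    unfolding Cinf_on_def
    by (intro exI[of _ D] conjI allI ballI D(1) Ck_on_imp_continuous_on[OF Ck_D])
qed

definition grad :: "('a::euclidean_space \<Rightarrow> real) \<Rightarrow> 'a \<Rightarrow> 'a" where
  "grad f x = (\<Sum>b\<in>Basis. frechet_derivative f (at x) b *\<^sub>R b)"

lemma has_derivative_imp_eq_grad:
  fixes f :: "'a::euclidean_space \<Rightarrow> real"
  assumes "(f has_derivative f') (at x)" shows "f' = (\<lambda>v. grad f x \<bullet> v)"
proof
  fix v
  have "f' v = (\<Sum>b\<in>Basis. (v \<bullet> b) *\<^sub>R f' b)"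
    by (rule linear_eq_sum_Basis[OF has_derivative_linear[OF assms]])
  also have "\<dots> = (\<Sum>b\<in>Basis. f' b *\<^sub>R b) \<bullet> v"
    unfolding inner_sum_left by (simp add: inner_commute mult.commute)
  finally show "f' v = grad f x \<bullet> v"
    by (simp add: grad_def frechet_derivative_at[OF assms, symmetric])
qed

lemma grad_eqI:
  fixes f :: "'a::euclidean_space \<Rightarrow> real"
  assumes "(f has_derivative (\<lambda>v. a \<bullet> v)) (at x)" shows "grad f x = a"
  using fun_cong[OF has_derivative_imp_eq_grad[OF assms]] vector_eq_rdot[of "grad f x" a] by metis

lemma Ck_on_has_derivative_grad:
  fixes f :: "'a::euclidean_space \<Rightarrow> real"
  assumes "open S" "Ck_on (Suc k) S f" "x \<in> S"
  shows "(f has_derivative (\<lambda>v. grad f x \<bullet> v)) (at x)"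
  using Ck_on_frechet_derivative(1)[OF assms]
  unfolding has_derivative_imp_eq_grad[OF Ck_on_frechet_derivative(1)[OF assms]] .

lemma Ck_on_grad: "open S \<Longrightarrow> Ck_on (Suc k) S f \<Longrightarrow> Ck_on k S (grad f)"
  unfolding grad_def[abs_def]
  by (intro Ck_on_sum finite_Basis Ck_on_bounded_linear_compose[OF bounded_linear_scaleR_left]
      Ck_on_frechet_derivative(2))

subsection \<open>Smoothness of series\<close>

lemma norm_sum_minus_suminf_le:
  fixes f :: "nat \<Rightarrow> 'a::banach"
  assumes B: "summable B" and f: "\<And>n. norm (f n) \<le> B n"
  shows "norm ((\<Sum>i<n. f i) - (\<Sum>n. f n)) \<le> (\<Sum>k. B (k + n))"
proof -
  have "(\<Sum>i<n. f i) - (\<Sum>n. f n) = - (\<Sum>k. f (k + n))"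
    using suminf_minus_initial_segment[OF summable_comparison_test'[OF B f], of n] by simp
  also have "norm \<dots> \<le> (\<Sum>k. B (k + n))"
    unfolding norm_minus_cancel by (rule norm_suminf_le[OF f summable_ignore_initial_segment[OF B]])
  finally show ?thesis .
qed

lemma has_derivative_suminf:
  fixes f :: "nat \<Rightarrow> 'a::real_normed_vector \<Rightarrow> 'b::banach"
  assumes S: "open S" "convex S" "x \<in> S" and B: "summable B"
    and f': "\<And>n y. y \<in> S \<Longrightarrow> (f n has_derivative f' n y) (at y)"
    and f'_le: "\<And>n y h. y \<in> S \<Longrightarrow> norm (f' n y h) \<le> B n * norm h"
    and f: "summable (\<lambda>n. f n x)"
  shows "((\<lambda>y. \<Sum>n. f n y) has_derivative (\<lambda>h. \<Sum>n. f' n x h)) (at x)"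
proof -
  have tail_le: "norm ((\<Sum>i<n. f' i y h) - (\<Sum>n. f' n y h)) \<le> (\<Sum>k. B (k + n)) * norm h"
    if y: "y \<in> S" for n y h
    using norm_sum_minus_suminf_le[OF summable_mult2[OF B] f'_le[OF y], where n = n]
    by (simp add: suminf_mult2[OF summable_ignore_initial_segment[OF B]])
  have "\<exists>g. \<forall>y\<in>S. (\<lambda>n. f n y) sums g y \<and> (g has_derivative (\<lambda>h. \<Sum>n. f' n y h)) (at y within S)"
  proof (rule has_derivative_series[OF S(2) has_derivative_at_withinI[OF f'] _ S(3) summable_sums])
    show "summable (\<lambda>n. f n x)" by (rule f)
    fix e :: real assume "e > 0"
    from tendstoD[OF suminf_exist_split2[OF B] this]
    have "\<forall>\<^sub>F n in sequentially. \<bar>\<Sum>k. B (k + n)\<bar> < e" by simp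
    then show "\<forall>\<^sub>F n in sequentially. \<forall>y\<in>S. \<forall>h. norm ((\<Sum>i<n. f' i y h) - (\<Sum>n. f' n y h))
        \<le> e * norm h"
    proof eventually_elim
      case (elim n)
      then have "(\<Sum>k. B (k + n)) * norm h \<le> e * norm h" for h :: 'a
        by (intro mult_right_mono) auto
      then show ?case using tail_le order_trans by blast
    qed
  qed
  then obtain g where g: "\<And>y. y \<in> S \<Longrightarrow> (\<lambda>n. f n y) sums g y"
    and dg: "(g has_derivative (\<lambda>h. \<Sum>n. f' n x h)) (at x within S)"
    using S(3) by meson
  have "((\<lambda>y. \<Sum>n. f n y) has_derivative (\<lambda>h. \<Sum>n. f' n x h)) (at x within S)"
    by (rule has_derivative_transform[OF S(3) _ dg]) (rule sums_unique[OF g, symmetric])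
  then show ?thesis
    by (simp add: at_within_open[OF S(3,1)])
qed

primrec Ck_bounded_on ::
    "nat \<Rightarrow> real \<Rightarrow> 'a::euclidean_space set \<Rightarrow> ('a \<Rightarrow> 'b::real_normed_vector) \<Rightarrow> bool" where
  "Ck_bounded_on 0 B S f \<longleftrightarrow> (\<forall>x\<in>S. norm (f x) \<le> B)"
| "Ck_bounded_on (Suc k) B S f \<longleftrightarrow> (\<forall>x\<in>S. norm (f x) \<le> B) \<and>
    (\<exists>f'. (\<forall>x\<in>S. (f has_derivative f' x) (at x)) \<and>
      (\<forall>v. Ck_bounded_on k (B * norm v) S (\<lambda>x. f' x v)))"

lemma Ck_bounded_on_SucI:
  assumes "\<And>x. x \<in> S \<Longrightarrow> norm (f x) \<le> B" and "\<And>x. x \<in> S \<Longrightarrow> (f has_derivative f' x) (at x)"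
    and "\<And>v. Ck_bounded_on k (B * norm v) S (\<lambda>x. f' x v)"
  shows "Ck_bounded_on (Suc k) B S f"
  using assms by auto

lemma Ck_bounded_on_norm_le: "Ck_bounded_on k B S f \<Longrightarrow> x \<in> S \<Longrightarrow> norm (f x) \<le> B"
  by (cases k) auto

lemma Ck_bounded_on_Suc_imp: "Ck_bounded_on (Suc k) B S f \<Longrightarrow> Ck_bounded_on k B S f"
proof (induction k arbitrary: B f)
  case 0
  then show ?case by auto
next
  case (Suc k)
  obtain f' where f': "\<And>x. x \<in> S \<Longrightarrow> (f has_derivative f' x) (at x)"
    "\<And>v. Ck_bounded_on (Suc k) (B * norm v) S (\<lambda>x. f' x v)"
    using Suc.prems by (subst (asm) Ck_bounded_on.simps(2)) blast
  show ?case
    by (rule Ck_bounded_on_SucI[OF Ck_bounded_on_norm_le[OF Suc.prems] f'(1) Suc.IH[OF f'(2)]])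
qed

lemma Ck_bounded_on_imp_Ck_on: "Ck_bounded_on (Suc k) B S f \<Longrightarrow> Ck_on k S f"
proof (induction k arbitrary: B f)
  case 0
  then obtain f' where f': "\<And>x. x \<in> S \<Longrightarrow> (f has_derivative f' x) (at x)" by auto
  have "continuous_on S f"
    by (rule has_derivative_continuous_on[OF has_derivative_at_withinI[OF f']])
  then show ?case by simp
next
  case (Suc k)
  obtain f' where f': "\<And>x. x \<in> S \<Longrightarrow> (f has_derivative f' x) (at x)"
    "\<And>v. Ck_bounded_on (Suc k) (B * norm v) S (\<lambda>x. f' x v)"
    using Suc.prems by (subst (asm) Ck_bounded_on.simps(2)) blast
  show ?case by (rule Ck_on_SucI[OF f'(1) Suc.IH[OF f'(2)]])
qed

lemma Ck_bounded_on_const: "norm c \<le> B \<Longrightarrow> Ck_bounded_on k B S (\<lambda>x. c)"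
proof (induction k arbitrary: B c)
  case (Suc k)
  have "0 \<le> B" using Suc.prems norm_ge_zero order_trans by blast
  then show ?case
    by (intro Ck_bounded_on_SucI[of _ _ _ "\<lambda>x v. 0"]) (use Suc in auto)
qed simp

lemma Ck_bounded_on_bounded_linear:
  assumes L: "bounded_linear L" and K: "\<And>x. norm (L x) \<le> K * norm x" and B: "K \<le> B"
    and S: "\<And>x. x \<in> S \<Longrightarrow> norm (L x) \<le> B"
  shows "Ck_bounded_on k B S L"
proof (cases k)
  case 0
  then show ?thesis by (simp add: S)
next
  case (Suc l)
  have "norm (L v) \<le> B * norm v" for v
    using K[of v] mult_right_mono[OF B norm_ge_zero[of v]] by linarith
  then show ?thesis
    unfolding Suc using S L
    by (intro Ck_bounded_on_SucI[of _ _ _ "\<lambda>x. L"] Ck_bounded_on_const)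
       (auto intro: bounded_linear_imp_has_derivative)
qed

lemma Ck_bounded_on_add:
  assumes "Ck_bounded_on k B S f" "Ck_bounded_on k C S g"
  shows "Ck_bounded_on k (B + C) S (\<lambda>x. f x + g x)"
  using assms
proof (induction k arbitrary: B C f g)
  case 0
  then show ?case by (auto intro: norm_triangle_mono)
next
  case (Suc k)
  obtain f' where f': "\<And>x. x \<in> S \<Longrightarrow> (f has_derivative f' x) (at x)"
    "\<And>v. Ck_bounded_on k (B * norm v) S (\<lambda>x. f' x v)" using Suc.prems(1) by auto
  obtain g' where g': "\<And>x. x \<in> S \<Longrightarrow> (g has_derivative g' x) (at x)"
    "\<And>v. Ck_bounded_on k (C * norm v) S (\<lambda>x. g' x v)" using Suc.prems(2) by auto
  show ?case
  proof (rule Ck_bounded_on_SucI[OF _ has_derivative_add[OF f'(1) g'(1)]])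
    show "norm (f x + g x) \<le> B + C" if "x \<in> S" for x
      using Suc.prems that by (intro norm_triangle_mono Ck_bounded_on_norm_le)
    show "Ck_bounded_on k ((B + C) * norm v) S (\<lambda>x. f' x v + g' x v)" for v
      unfolding distrib_right by (rule Suc.IH[OF f'(2) g'(2)])
  qed
qed

text \<open>The factor \<open>2 ^ k\<close> is harmless for power series of infinite radius
  of convergence.\<close>
lemma Ck_bounded_on_mult:
  fixes f g :: "'a::euclidean_space \<Rightarrow> 'b::real_normed_algebra"
  assumes "Ck_bounded_on k B S f" "Ck_bounded_on k C S g" "0 \<le> B" "0 \<le> C"
  shows "Ck_bounded_on k (2 ^ k * B * C) S (\<lambda>x. f x * g x)"
  using assms
proof (induction k arbitrary: B C f g)
  case 0
  then show ?case
    by (auto intro!: order_trans[OF norm_mult_ineq] mult_mono)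
next
  case (Suc k)
  obtain f' where f': "\<And>x. x \<in> S \<Longrightarrow> (f has_derivative f' x) (at x)"
    "\<And>v. Ck_bounded_on k (B * norm v) S (\<lambda>x. f' x v)" using Suc.prems(1) by auto
  obtain g' where g': "\<And>x. x \<in> S \<Longrightarrow> (g has_derivative g' x) (at x)"
    "\<And>v. Ck_bounded_on k (C * norm v) S (\<lambda>x. g' x v)" using Suc.prems(2) by auto
  show ?case
  proof (rule Ck_bounded_on_SucI[OF _ has_derivative_mult[OF f'(1) g'(1)]])
    fix x assume x: "x \<in> S"
    have "norm (f x * g x) \<le> 1 * (B * C)"
      using Suc.prems(3) Ck_bounded_on_norm_le[OF Suc.prems(1) x]
          Ck_bounded_on_norm_le[OF Suc.prems(2) x]
      by (auto intro!: order_trans[OF norm_mult_ineq] mult_mono)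
    also have "\<dots> \<le> 2 ^ Suc k * (B * C)"
      using Suc.prems(3,4) by (intro mult_right_mono one_le_power mult_nonneg_nonneg) auto
    finally show "norm (f x * g x) \<le> 2 ^ Suc k * B * C" by (simp add: mult.assoc)
  next
    fix v :: 'a
    have "Ck_bounded_on k (2 ^ k * B * (C * norm v) + 2 ^ k * (B * norm v) * C) S
        (\<lambda>x. f x * g' x v + f' x v * g x)"
      by (intro Ck_bounded_on_add Suc.IH f'(2) g'(2) Ck_bounded_on_Suc_imp[OF Suc.prems(1)]
          Ck_bounded_on_Suc_imp[OF Suc.prems(2)] Suc.prems(3,4) mult_nonneg_nonneg norm_ge_zero)
    then show "Ck_bounded_on k (2 ^ Suc k * B * C * norm v) S (\<lambda>x. f x * g' x v + f' x v * g x)"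
      by (simp add: mult_ac)
  qed
qed

lemma Ck_bounded_on_power:
  fixes f :: "'a::euclidean_space \<Rightarrow> 'b::real_normed_algebra_1"
  assumes "Ck_bounded_on k B S f" "0 \<le> B"
  shows "Ck_bounded_on k ((2 ^ k * B) ^ n) S (\<lambda>x. f x ^ n)"
proof (induction n)
  case 0
  show ?case by (simp add: Ck_bounded_on_const)
next
  case (Suc n)
  show ?case
    using Ck_bounded_on_mult[OF assms(1) Suc] assms(2) by (simp add: mult_ac)
qed

lemma Ck_bounded_on_scaleR:
  assumes "Ck_bounded_on k B S f"
  shows "Ck_bounded_on k (\<bar>c\<bar> * B) S (\<lambda>x. c *\<^sub>R f x)"
  using assms
proof (induction k arbitrary: B f)
  case 0
  then show ?case by (auto intro: mult_left_mono)
next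
  case (Suc k)
  obtain f' where f': "\<And>x. x \<in> S \<Longrightarrow> (f has_derivative f' x) (at x)"
    "\<And>v. Ck_bounded_on k (B * norm v) S (\<lambda>x. f' x v)" using Suc.prems(1) by auto
  show ?case
    by (rule Ck_bounded_on_SucI[OF _ has_derivative_scaleR_right[OF f'(1)]])
       (use Ck_bounded_on_norm_le[OF Suc.prems] Suc.IH[OF f'(2)]
         in \<open>auto intro: mult_left_mono simp: mult.assoc\<close>)
qed

lemma Ck_bounded_on_suminf:
  fixes f :: "nat \<Rightarrow> 'a::euclidean_space \<Rightarrow> 'b::banach"
  assumes S: "open S" "convex S" and B: "summable B" and f: "\<And>n. Ck_bounded_on k (B n) S (f n)"
  shows "Ck_bounded_on k (\<Sum>n. B n) S (\<lambda>x. \<Sum>n. f n x)"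
  using B f
proof (induction k arbitrary: B f)
  case 0
  then show ?case by (auto intro: norm_suminf_le)
next
  case (Suc k)
  note norm_f_le = Ck_bounded_on_norm_le[OF Suc.prems(2)]
  have "\<exists>f'. (\<forall>x\<in>S. (f n has_derivative f' x) (at x))
      \<and> (\<forall>v. Ck_bounded_on k (B n * norm v) S (\<lambda>x. f' x v))" for n
    using Suc.prems(2)[of n] by simp
  then obtain f' where f': "\<And>n x. x \<in> S \<Longrightarrow> (f n has_derivative f' n x) (at x)"
    "\<And>n v. Ck_bounded_on k (B n * norm v) S (\<lambda>x. f' n x v)"
    by metis
  show ?case
  proof (rule Ck_bounded_on_SucI)
    show "norm (\<Sum>n. f n x) \<le> (\<Sum>n. B n)" if "x \<in> S" for x
      by (rule norm_suminf_le[OF norm_f_le[OF that] Suc.prems(1)])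
    show "((\<lambda>x. \<Sum>n. f n x) has_derivative (\<lambda>h. \<Sum>n. f' n x h)) (at x)" if "x \<in> S" for x
      by (rule has_derivative_suminf[OF S that Suc.prems(1) f'(1) Ck_bounded_on_norm_le[OF f'(2)]
            summable_comparison_test'[OF Suc.prems(1) norm_f_le[OF that]]])
    show "Ck_bounded_on k ((\<Sum>n. B n) * norm v) S (\<lambda>x. \<Sum>n. f' n x v)" for v
      unfolding suminf_mult2[OF Suc.prems(1)]
      by (rule Suc.IH[OF summable_mult2[OF Suc.prems(1)] f'(2)])
  qed
qed

subsection \<open>Power series in Banach algebras\<close>

definition fps_calc :: "real fps \<Rightarrow> 'b \<Rightarrow> 'b::{real_normed_algebra_1,banach}" where
  "fps_calc F A = (\<Sum>n. fps_nth F n *\<^sub>R A ^ n)"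

lemma summable_norm_fps_calc:
  fixes A :: "'b::{real_normed_algebra_1,banach}"
  assumes "ereal (norm A) < fps_conv_radius F"
  shows "summable (\<lambda>n. norm (fps_nth F n *\<^sub>R A ^ n))"
proof (rule summable_comparison_test')
  show "summable (\<lambda>n. norm (fps_nth F n * norm A ^ n))"
    using assms by (intro abs_summable_in_conv_radius) (simp add: fps_conv_radius_def)
  show "norm (norm (fps_nth F n *\<^sub>R A ^ n)) \<le> norm (fps_nth F n * norm A ^ n)" for n
    by (auto simp: abs_mult intro!: mult_left_mono norm_power_ineq)
qed

lemma fps_calc_sums:
  fixes A :: "'b::{real_normed_algebra_1,banach}"
  assumes "ereal (norm A) < fps_conv_radius F"
  shows "(\<lambda>n. fps_nth F n *\<^sub>R A ^ n) sums fps_calc F A"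
  unfolding fps_calc_def
  by (rule summable_sums[OF summable_norm_cancel[OF summable_norm_fps_calc[OF assms]]])

lemma fps_calc_0: "fps_calc F 0 = fps_nth F 0 *\<^sub>R 1"
  unfolding fps_calc_def by (subst suminf_finite[of "{0}"]) (auto simp: power_0_left)

lemma fps_calc_const [simp]: "fps_calc (fps_const c) A = c *\<^sub>R 1"
  unfolding fps_calc_def by (subst suminf_finite[of "{0}"]) auto

lemma fps_calc_1 [simp]: "fps_calc 1 A = 1"
  using fps_calc_const[of 1 A] by simp

lemma fps_calc_X [simp]: "fps_calc fps_X A = A"
  unfolding fps_calc_def by (subst suminf_finite[of "{1}"]) auto

lemma fps_calc_exp [simp]: "fps_calc (fps_exp c) A = exp (c *\<^sub>R A)"
  by (simp add: fps_calc_def exp_def power_mult_distrib scaleR_power divide_inverse mult.commute)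

lemma fps_calc_diff:
  fixes A :: "'b::{real_normed_algebra_1,banach}"
  assumes "ereal (norm A) < fps_conv_radius F" "ereal (norm A) < fps_conv_radius G"
  shows "fps_calc (F - G) A = fps_calc F A - fps_calc G A"
  using sums_unique[OF sums_diff[OF fps_calc_sums[OF assms(1)] fps_calc_sums[OF assms(2)]]]
  by (simp add: fps_calc_def scaleR_diff_left)

lemma fps_calc_mult:
  fixes A :: "'b::{real_normed_algebra_1,banach}"
  assumes "ereal (norm A) < fps_conv_radius F" "ereal (norm A) < fps_conv_radius G"
  shows "fps_calc (F * G) A = fps_calc F A * fps_calc G A"
proof -
  have "(\<Sum>i\<le>n. (fps_nth F i *\<^sub>R A ^ i) * (fps_nth G (n - i) *\<^sub>R A ^ (n - i)))
      = fps_nth (F * G) n *\<^sub>R A ^ n" for n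
    by (auto simp: fps_mult_nth atLeast0AtMost scaleR_sum_left
        simp flip: power_add intro!: sum.cong)
  then show ?thesis
    unfolding fps_calc_def
    using Cauchy_product[OF summable_norm_fps_calc[OF assms(1)] summable_norm_fps_calc[OF assms(2)]]
    by simp
qed

lemma fps_conv_radius_compose_uminus:
  fixes F :: "real fps"
  shows "fps_conv_radius (F oo (- fps_X)) = fps_conv_radius F"
  unfolding fps_conv_radius_def fps_compose_uminus'
  by (rule conv_radius_cong) (simp add: abs_mult power_abs)

lemma fps_calc_compose_uminus: "fps_calc (F oo (- fps_X)) A = fps_calc F (- A)"
proof -
  have "((- 1) ^ n * c) *\<^sub>R A ^ n = c *\<^sub>R (- A) ^ n" for n c
    by (cases "even n") simp_all
  then show ?thesis
    by (simp add: fps_calc_def fps_compose_uminus')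
qed

lemma Ck_on_fps_calc:
  fixes J :: "'a::euclidean_space \<Rightarrow> 'b::{real_normed_algebra_1,banach}"
  assumes J: "bounded_linear J" and F: "fps_conv_radius F = \<infinity>"
  shows "Ck_on k UNIV (\<lambda>x. fps_calc F (J x))"
proof (rule Ck_on_local)
  fix x0 :: 'a
  obtain K where K: "\<And>x. norm (J x) \<le> norm x * K" "0 \<le> K"
    using bounded_linear.nonneg_bounded[OF J] by blast
  define S B where "S = ball (0::'a) (norm x0 + 1)" and "B = (norm x0 + 1) * K"
  have "K \<le> B" "0 \<le> B" using K(2) mult_right_mono[of 1 "norm x0 + 1" K] by (auto simp: B_def)
  have "norm (J x) \<le> B" if "x \<in> S" for x
    using that K(2) unfolding S_def B_def by (intro order_trans[OF K(1)] mult_right_mono) auto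
  then have "Ck_bounded_on (Suc k) B S J"
    using K(1) \<open>K \<le> B\<close> by (intro Ck_bounded_on_bounded_linear[OF J, of K]) (auto simp: mult.commute)
  then have "Ck_bounded_on (Suc k) (\<bar>fps_nth F n\<bar> * (2 ^ Suc k * B) ^ n) S
      (\<lambda>x. fps_nth F n *\<^sub>R J x ^ n)" for n
    using \<open>0 \<le> B\<close> by (intro Ck_bounded_on_scaleR Ck_bounded_on_power)
  moreover have "summable (\<lambda>n. \<bar>fps_nth F n\<bar> * (2 ^ Suc k * B) ^ n)"
    using summable_norm_fps_calc[of "2 ^ Suc k * B" F] F \<open>0 \<le> B\<close>
    by (simp add: abs_mult power_abs del: power_Suc)
  ultimately have "Ck_bounded_on (Suc k) (\<Sum>n. \<bar>fps_nth F n\<bar> * (2 ^ Suc k * B) ^ n) S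
      (\<lambda>x. fps_calc F (J x))"
    unfolding fps_calc_def by (intro Ck_bounded_on_suminf) (simp_all add: S_def)
  then have "Ck_on k S (\<lambda>x. fps_calc F (J x))"
    by (rule Ck_bounded_on_imp_Ck_on)
  then show "\<exists>T. open T \<and> x0 \<in> T \<and> Ck_on k T (\<lambda>x. fps_calc F (J x))"
    by (intro exI[of _ S]) (simp add: S_def)
qed

lemma norm_scaleR_power_le:
  fixes A :: "'b::real_normed_algebra_1"
  assumes "\<bar>u\<bar> \<le> R" shows "norm (c *\<^sub>R (u *\<^sub>R A) ^ n) \<le> \<bar>c\<bar> * (R * norm A) ^ n"
proof -
  have "norm ((u *\<^sub>R A) ^ n) \<le> (\<bar>u\<bar> * norm A) ^ n"
    using norm_power_ineq[of "u *\<^sub>R A" n] by simp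
  also have "\<dots> \<le> (R * norm A) ^ n"
    using assms by (intro power_mono mult_right_mono) auto
  finally have "\<bar>c\<bar> * norm ((u *\<^sub>R A) ^ n) \<le> \<bar>c\<bar> * (R * norm A) ^ n"
    by (rule mult_left_mono) simp
  then show ?thesis unfolding norm_scaleR .
qed

lemma scaleR_fps_calc_sums:
  fixes A :: "'b::{real_normed_algebra_1,banach}"
  assumes "ereal (norm (s *\<^sub>R A)) < fps_conv_radius F"
  shows "(\<lambda>n. (fps_nth F n * s ^ Suc n) *\<^sub>R A ^ n) sums (s *\<^sub>R fps_calc F (s *\<^sub>R A))"
  using sums_scaleR_right[OF fps_calc_sums[OF assms], of s] by (simp add: scaleR_power mult_ac)

lemma scaleR_power_has_derivative:
  fixes A :: "'b::real_normed_algebra_1"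
  shows "((\<lambda>u. (c * u ^ Suc n) *\<^sub>R A ^ n) has_derivative
    (\<lambda>h. h *\<^sub>R ((real (Suc n) * c) *\<^sub>R (u *\<^sub>R A) ^ n))) (at u)"
proof -
  have "((\<lambda>u. c * u ^ Suc n) has_field_derivative real (Suc n) * c * u ^ n) (at u)"
    by (rule DERIV_cong[OF DERIV_cmult[OF DERIV_pow]]) simp
  then show ?thesis
    unfolding has_field_derivative_def
    by (rule has_derivative_eq_rhs[OF has_derivative_scaleR_left]) (simp add: scaleR_power mult_ac)
qed

lemma scaleR_fps_calc_has_derivative:
  fixes A :: "'b::{real_normed_algebra_1,banach}"
  assumes F: "fps_conv_radius F = \<infinity>"
  shows "((\<lambda>s. s *\<^sub>R fps_calc F (s *\<^sub>R A)) has_vector_derivative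
    fps_calc (fps_deriv (fps_X * F)) (s *\<^sub>R A)) (at s)"
proof -
  define R where "R = \<bar>s\<bar> + 1"
  define G where "G = fps_deriv (fps_X * F)"
  have G_nth: "fps_nth G n = real (Suc n) * fps_nth F n" for n
    by (cases n) (simp_all add: G_def algebra_simps)
  have "fps_conv_radius G = \<infinity>"
    using fps_conv_radius_deriv[of "fps_X * F"] fps_conv_radius_mult[of fps_X F] F
    by (simp add: G_def)
  then have "summable (\<lambda>n. norm (fps_nth G n *\<^sub>R (R * norm A) ^ n))"
    by (intro summable_norm_fps_calc) simp
  then have summable: "summable (\<lambda>n. \<bar>fps_nth G n\<bar> * (R * norm A) ^ n)"
    by (simp add: R_def abs_mult)
  have "((\<lambda>u. \<Sum>n. (fps_nth F n * u ^ Suc n) *\<^sub>R A ^ n) has_derivative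
      (\<lambda>h. \<Sum>n. h *\<^sub>R (fps_nth G n *\<^sub>R (s *\<^sub>R A) ^ n))) (at s)"
  proof (rule has_derivative_suminf[OF open_ball convex_ball _ summable])
    show "s \<in> ball 0 R" by (simp add: R_def)
    fix n and u h :: real assume u: "u \<in> ball 0 R"
    show "((\<lambda>u. (fps_nth F n * u ^ Suc n) *\<^sub>R A ^ n) has_derivative
        (\<lambda>h. h *\<^sub>R (fps_nth G n *\<^sub>R (u *\<^sub>R A) ^ n))) (at u)"
      unfolding G_nth by (rule scaleR_power_has_derivative)
    have "norm (fps_nth G n *\<^sub>R (u *\<^sub>R A) ^ n) * norm h \<le> \<bar>fps_nth G n\<bar> * (R * norm A) ^ n * norm h"
      using u by (intro mult_right_mono norm_scaleR_power_le) auto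
    then show "norm (h *\<^sub>R (fps_nth G n *\<^sub>R (u *\<^sub>R A) ^ n))
        \<le> \<bar>fps_nth G n\<bar> * (R * norm A) ^ n * norm h"
      by (simp only: norm_scaleR real_norm_def mult.commute)
  next
    show "summable (\<lambda>n. (fps_nth F n * s ^ Suc n) *\<^sub>R A ^ n)"
      by (rule sums_summable[OF scaleR_fps_calc_sums]) (simp add: F)
  qed
  moreover have "(\<Sum>n. (fps_nth F n * u ^ Suc n) *\<^sub>R A ^ n) = u *\<^sub>R fps_calc F (u *\<^sub>R A)" for u
    by (rule sums_unique[OF scaleR_fps_calc_sums, symmetric]) (simp add: F)
  moreover have "(\<Sum>n. h *\<^sub>R (fps_nth G n *\<^sub>R (s *\<^sub>R A) ^ n)) = h *\<^sub>R fps_calc G (s *\<^sub>R A)" for h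
    by (rule sums_unique[OF sums_scaleR_right[OF fps_calc_sums], symmetric])
       (simp add: \<open>fps_conv_radius G = \<infinity>\<close>)
  ultimately show ?thesis by (simp add: has_vector_derivative_def G_def)
qed

subsection \<open>Inverses in normed algebras\<close>

lemma has_derivative_bilinear_zero_right:
  fixes F :: "'a::real_normed_vector \<Rightarrow> 'c::real_normed_vector"
  assumes "bounded_bilinear pr" and g: "isCont g x" and "F x = 0"
    and F: "(F has_derivative F') (at x)"
  shows "((\<lambda>y. pr (g y) (F y)) has_derivative (\<lambda>h. pr (g x) (F' h))) (at x)"
proof -
  interpret pr: bounded_bilinear pr by fact
  interpret F': bounded_linear F' using F by (rule has_derivative_bounded_linear)
  obtain K where K: "0 \<le> K" "\<And>a b. norm (pr a b) \<le> norm a * norm b * K"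
    using pr.nonneg_bounded by blast
  obtain L where L: "\<And>h. norm (F' h) \<le> norm h * L" "0 \<le> L" using F'.nonneg_bounded by blast
  define e where "e y = (F y - F' (y - x)) /\<^sub>R norm (y - x)" for y
  have e: "(e \<longlongrightarrow> 0) (at x)"
    using F \<open>F x = 0\<close> by (simp add: has_derivative_at_within e_def[abs_def])
  have quotient_le: "norm ((pr (g y) (F y) - pr (g x) (F' (y - x))) /\<^sub>R norm (y - x))
      \<le> norm (pr (g y) (e y)) + norm (g y - g x) * L * K" for y
  proof -
    have "(pr (g y) (F y) - pr (g x) (F' (y - x))) /\<^sub>R norm (y - x)
        = pr (g y) (e y) + pr (g y - g x) (F' ((y - x) /\<^sub>R norm (y - x)))"
      unfolding F'.scaleR
      by (simp add: e_def pr.diff_left pr.diff_right pr.scaleR_right algebra_simps)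
    moreover have "norm (F' ((y - x) /\<^sub>R norm (y - x))) \<le> 1 * L"
      using L(2) by (intro order_trans[OF L(1)] mult_right_mono) (cases "y = x", auto)
    then have "norm (pr (g y - g x) (F' ((y - x) /\<^sub>R norm (y - x)))) \<le> norm (g y - g x) * L * K"
      using K(1) by (intro order_trans[OF K(2)] mult_right_mono mult_left_mono) auto
    ultimately show ?thesis using norm_triangle_mono by fastforce
  qed
  have "((\<lambda>y. norm (pr (g y) (e y)) + norm (g y - g x) * L * K) \<longlongrightarrow>
      norm (pr (g x) 0) + norm (g x - g x) * L * K) (at x)"
    using g by (intro tendsto_intros pr.tendsto e) (auto simp: isCont_def)
  then have "((\<lambda>y. (pr (g y) (F y) - pr (g x) (F' (y - x))) /\<^sub>R norm (y - x)) \<longlongrightarrow> 0) (at x)"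
    by (intro Lim_null_comparison[OF always_eventually[OF allI[OF quotient_le]]])
       (simp add: pr.zero_right)
  moreover have "bounded_linear (\<lambda>h. pr (g x) (F' h))"
    by (rule bounded_linear_compose[OF pr.bounded_linear_right F'.bounded_linear_axioms])
  ultimately show ?thesis
    by (simp add: has_derivative_at_within \<open>F x = 0\<close> pr.zero_right)
qed

locale inverse_functions =
  fixes f g :: "'a::real_normed_vector \<Rightarrow> 'b::real_normed_algebra_1" and S :: "'a set"
  assumes open_S: "open S" and right_inverse: "\<And>y. y \<in> S \<Longrightarrow> f y * g y = 1"
    and left_inverse: "\<And>y. y \<in> S \<Longrightarrow> g y * f y = 1"
begin

lemma inverse_diff:
  assumes "x \<in> S" "y \<in> S" shows "g y - g x = - (g y * ((f y - f x) * g x))"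
proof -
  have "g y * ((f y - f x) * g x) = (g y * f y) * g x - g y * (f x * g x)"
    by (simp only: left_diff_distrib right_diff_distrib mult.assoc)
  then show ?thesis using assms by (simp add: left_inverse right_inverse)
qed

lemma isCont_inverse:
  assumes x: "x \<in> S" and f: "isCont f x"
  shows "isCont g x"
proof -
  define r where "r y = norm (f y - f x) * norm (g x)" for y
  have r: "(r \<longlongrightarrow> 0) (at x)"
    unfolding r_def[abs_def] using f
    by (auto intro!: tendsto_eq_intros simp: isCont_def LIM_zero_iff)
  have "\<forall>\<^sub>F y in at x. y \<in> S"
    using open_S x by (simp add: eventually_at_topological) blast
  then have "\<forall>\<^sub>F y in at x. norm (g y - g x) \<le> 2 * norm (g x) * r y"
    using order_tendstoD(2)[OF r, of "1/2", simplified]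
  proof eventually_elim
    case (elim y)
    have diff_le: "norm (g y - g x) \<le> norm (g y) * r y"
      unfolding inverse_diff[OF x elim(1)] norm_minus_cancel r_def
      by (intro order_trans[OF norm_mult_ineq] mult_left_mono norm_mult_ineq norm_ge_zero)
    also have "\<dots> \<le> norm (g y) * (1/2)"
      using elim(2) by (intro mult_left_mono) auto
    finally have "norm (g y) \<le> 2 * norm (g x)"
      using norm_triangle_sub[of "g y" "g x"] by simp
    then have "norm (g y) * r y \<le> 2 * norm (g x) * r y"
      by (intro mult_right_mono) (simp_all add: r_def)
    then show ?case using diff_le by simp
  qed
  moreover have "((\<lambda>y. 2 * norm (g x) * r y) \<longlongrightarrow> 0) (at x)"
    using tendsto_mult_left[OF r, of "2 * norm (g x)"] by simp
  ultimately have "((\<lambda>y. g y - g x) \<longlongrightarrow> 0) (at x)"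
    by (rule Lim_null_comparison)
  then show ?thesis by (simp add: isCont_def LIM_zero_iff)
qed

lemma has_derivative_inverse:
  assumes x: "x \<in> S" and f: "(f has_derivative f') (at x)"
  shows "(g has_derivative (\<lambda>h. - (g x * (f' h * g x)))) (at x)"
proof -
  have "((\<lambda>y. g y * ((f y - f x) * g x)) has_derivative (\<lambda>h. g x * (f' h * g x))) (at x)"
    using has_derivative_mult_left[OF has_derivative_diff[OF f has_derivative_const[of "f x"]],
        of "g x"]
    by (intro has_derivative_bilinear_zero_right[OF bounded_bilinear_mult]
        isCont_inverse[OF x has_derivative_continuous[OF f]]) simp_all
  then have "((\<lambda>y. g x - g y * ((f y - f x) * g x))
      has_derivative (\<lambda>h. 0 - g x * (f' h * g x))) (at x)"
    by (rule has_derivative_diff[OF has_derivative_const])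
  then show ?thesis
    by (simp, elim has_derivative_transform_within_open[OF _ open_S x])
       (use inverse_diff[OF x] in \<open>simp add: algebra_simps\<close>)
qed

end

text \<open>Since \<open>g' = - g f' g\<close>, smoothness of an inverse bootstraps from its continuity.\<close>
lemma Ck_on_algebra_inverse:
  fixes f g :: "'a::euclidean_space \<Rightarrow> 'b::real_normed_algebra_1"
  assumes "inverse_functions f g S" and f: "\<And>k. Ck_on k S f"
  shows "Ck_on k S g"
proof (induction k)
  interpret inverse_functions f g S by fact
  case 0
  have "isCont g x" if "x \<in> S" for x
    using Ck_on_imp_continuous_on[OF f[of 0]] open_S that isCont_inverse
    by (simp add: continuous_on_eq_continuous_at)
  then show ?case by (simp add: continuous_at_imp_continuous_on)
next
  interpret inverse_functions f g S by fact
  case (Suc k)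
  obtain f' where f': "\<And>x. x \<in> S \<Longrightarrow> (f has_derivative f' x) (at x)" "\<And>v. Ck_on k S (\<lambda>x. f' x v)"
    using f[of "Suc k"] by auto
  have "Ck_on k S (\<lambda>x. - (g x * (f' x v * g x)))" for v
    by (intro Ck_on_bounded_linear_compose[OF bounded_linear_minus[OF bounded_linear_ident]]
        Ck_on_bounded_bilinear[OF bounded_bilinear_mult] Suc f')
  then show ?case
    using has_derivative_inverse[OF _ f'(1)] by (intro Ck_on_SucI) auto
qed

subsection \<open>The function \<open>w coth w - w\<close>\<close>

definition exp_mean_fps :: "real fps" where
  "exp_mean_fps = fps_const (1/2) * fps_shift 1 (fps_exp 2)"

text \<open>\<open>exp_mean A = \<integral>\<^sub>0\<^sup>1 exp (2 r A) dr\<close>, that is \<open>(exp (2 A) - 1) / (2 A)\<close>.\<close>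
definition exp_mean :: "'b \<Rightarrow> 'b::{real_normed_algebra_1,banach}" where
  "exp_mean A = fps_calc exp_mean_fps A"

lemma fps_conv_radius_exp_mean [simp]: "fps_conv_radius exp_mean_fps = \<infinity>"
  by (simp add: exp_mean_fps_def fps_conv_radius_cmult_left)

lemma fps_X_mult_exp_mean: "fps_X * exp_mean_fps = fps_const (1/2) * (fps_exp 2 - 1)"
proof (rule fps_ext)
  show "fps_nth (fps_X * exp_mean_fps) n = fps_nth (fps_const (1/2) * (fps_exp 2 - 1)) n" for n
    by (cases n) (simp_all add: exp_mean_fps_def)
qed

lemma mult_exp_mean:
  "A * exp_mean A = (1/2) *\<^sub>R (exp (2 *\<^sub>R A) - 1)"
  "exp_mean A * A = (1/2) *\<^sub>R (exp (2 *\<^sub>R A) - 1)"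
proof -
  have radius: "fps_conv_radius (fps_exp 2 - 1 :: real fps) = \<infinity>"
    using fps_conv_radius_diff[of "fps_exp (2::real)" 1] by simp
  have "fps_calc (fps_X * exp_mean_fps) A = (1/2) *\<^sub>R (exp (2 *\<^sub>R A) - 1)"
    unfolding fps_X_mult_exp_mean by (simp add: fps_calc_mult fps_calc_diff radius)
  moreover from this have "fps_calc (exp_mean_fps * fps_X) A = (1/2) *\<^sub>R (exp (2 *\<^sub>R A) - 1)"
    by (simp add: mult.commute)
  ultimately show "A * exp_mean A = (1/2) *\<^sub>R (exp (2 *\<^sub>R A) - 1)"
    "exp_mean A * A = (1/2) *\<^sub>R (exp (2 *\<^sub>R A) - 1)"
    by (simp_all add: fps_calc_mult exp_mean_def)
qed

lemma exp_mean_0 [simp]: "exp_mean 0 = 1"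
  by (simp add: exp_mean_def fps_calc_0 exp_mean_fps_def)

lemma exp_mean_uminus: "exp (2 *\<^sub>R A) * exp_mean (- A) = exp_mean A"
proof -
  have "(fps_X * exp_mean_fps) oo (- fps_X) = (fps_const (1/2) * (fps_exp 2 - 1)) oo (- fps_X)"
    by (simp only: fps_X_mult_exp_mean)
  then have compose: "- fps_X * (exp_mean_fps oo (- fps_X)) = fps_const (1/2) * (fps_exp (- 2) - 1)"
    by (simp add: fps_compose_mult_distrib fps_compose_sub_distrib)
  have "fps_X * (fps_exp 2 * (exp_mean_fps oo (- fps_X)))
      = - (fps_exp 2 * (- fps_X * (exp_mean_fps oo (- fps_X))))"
    by (simp add: mult.left_commute)
  also have "\<dots> = - (fps_exp 2 * (fps_const (1/2) * (fps_exp (- 2) - 1)))"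
    by (simp only: compose)
  also have "\<dots> = fps_X * exp_mean_fps"
    unfolding fps_X_mult_exp_mean using fps_exp_add_mult[of "2::real" "- 2"]
    by (simp add: algebra_simps)
  finally have "fps_exp 2 * (exp_mean_fps oo (- fps_X)) = exp_mean_fps" by simp
  then have "fps_calc (fps_exp 2 * (exp_mean_fps oo (- fps_X))) A = exp_mean A"
    by (simp add: exp_mean_def)
  then show ?thesis
    by (simp add: fps_calc_mult fps_conv_radius_compose_uminus fps_calc_compose_uminus exp_mean_def)
qed

lemma scaleR_exp_mean_has_derivative:
  "((\<lambda>s. s *\<^sub>R exp_mean (s *\<^sub>R A)) has_vector_derivative exp ((2 * s) *\<^sub>R A)) (at s)"
proof -
  have "fps_deriv (fps_X * exp_mean_fps) = fps_exp 2"
    unfolding fps_X_mult_exp_mean by (simp flip: mult.assoc)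
  then show ?thesis
    using scaleR_fps_calc_has_derivative[of exp_mean_fps A s] by (simp add: exp_mean_def)
qed

lemma sin_nonzero_ball: "0 < norm z \<Longrightarrow> norm z < pi \<Longrightarrow> sin z \<noteq> (0::complex)"
proof
  assume z: "0 < norm z" "norm z < pi" and "sin z = 0"
  then obtain n :: int where n: "z = of_real (of_int n * pi)"
    by (auto simp: sin_eq_0)
  then have "norm z = \<bar>of_int n\<bar> * pi" by (simp add: norm_mult)
  moreover have "n \<noteq> 0" using n z by auto
  then have "1 * pi \<le> \<bar>of_int n\<bar> * pi" by (intro mult_right_mono) auto
  ultimately show False using z by simp
qed

lemma sin_mult_zcot: "norm z < pi \<Longrightarrow> sin z * zcot z = z * cos z"
  using sin_nonzero_ball[of z] by (simp add: zcot_def cot_def)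

lemma zcot_holomorphic: "zcot holomorphic_on ball 0 pi"
proof (rule no_isolated_singularity)
  have "(\<lambda>z. z * (cos z / sin z)) holomorphic_on ball 0 pi - {0}"
    by (intro holomorphic_intros) (use sin_nonzero_ball in auto)
  then show holomorphic: "zcot holomorphic_on ball 0 pi - {0}"
    by (rule holomorphic_transform) (simp add: zcot_def cot_def)
  have "((\<lambda>z::complex. sin z / z) \<longlongrightarrow> 1) (at 0)"
    using DERIV_sin[of "0::complex"] by (simp add: has_field_derivative_iff)
  then have "((\<lambda>z::complex. cos z / (sin z / z)) \<longlongrightarrow> 1) (at 0)"
    using tendsto_divide[of cos 1 "at (0::complex)" "\<lambda>z. sin z / z" 1] isCont_cos[of "0::complex"]
    by (simp add: isCont_def)
  then have "(zcot \<longlongrightarrow> 1) (at 0)"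
    by (rule Lim_transform_eventually)
       (auto simp: eventually_at_filter zcot_def cot_def intro!: always_eventually)
  then have "continuous (at 0) zcot"
    by (simp add: continuous_at zcot_def)
  moreover have "continuous (at z) zcot" if "z \<in> ball 0 pi - {0}" for z
    using holomorphic_on_imp_continuous_on[OF holomorphic] that
    by (simp add: continuous_on_eq_continuous_at open_Diff)
  ultimately have "continuous (at z) zcot" if "z \<in> ball 0 pi" for z
    using that by (cases "z = 0") auto
  then show "continuous_on (ball 0 pi) zcot"
    by (simp add: continuous_at_imp_continuous_on)
qed auto

text \<open>The Taylor series of \<open>w coth w\<close>, which is \<open>z cot z\<close> at \<open>z = \<i> w\<close>.\<close>
definition complex_coth_fps :: "complex fps" where
  "complex_coth_fps = Abs_fps (\<lambda>n. zcot_coeff n * \<i> ^ n)"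

definition coth_fps :: "real fps" where
  "coth_fps = Abs_fps (\<lambda>n. Re (fps_nth complex_coth_fps n))"

lemma fps_conv_radius_zcot: "fps_conv_radius (Abs_fps zcot_coeff) \<ge> pi"
  using conv_radius_fps_expansion[of zcot 0 pi] zcot_holomorphic
  by (simp add: fps_expansion_def zcot_coeff_def[abs_def])

lemma fps_conv_radius_complex_coth: "fps_conv_radius complex_coth_fps \<ge> pi"
proof -
  have "fps_conv_radius complex_coth_fps = fps_conv_radius (Abs_fps zcot_coeff)"
    unfolding fps_conv_radius_def complex_coth_fps_def
    by (rule conv_radius_cong) (simp add: norm_mult norm_power)
  then show ?thesis using fps_conv_radius_zcot by simp
qed

lemma fps_conv_radius_coth: "fps_conv_radius coth_fps \<ge> pi"
  unfolding fps_conv_radius_def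
proof (rule conv_radius_geI_ex')
  fix r :: real assume r: "0 < r" "ereal r < pi"
  then have "ereal (norm (of_real r :: complex)) < fps_conv_radius complex_coth_fps"
    using less_le_trans[OF _ fps_conv_radius_complex_coth] by simp
  then have "summable (\<lambda>n. norm (fps_nth complex_coth_fps n * of_real r ^ n))"
    by (rule norm_summable_fps)
  then show "summable (\<lambda>n. fps_nth coth_fps n * of_real r ^ n)"
  proof (rule summable_comparison_test')
    show "norm (fps_nth coth_fps n * of_real r ^ n)
        \<le> norm (fps_nth complex_coth_fps n * of_real r ^ n)" for n
      using r by (simp add: coth_fps_def norm_mult norm_power abs_mult mult_right_mono
          abs_Re_le_cmod)
  qed
qed

lemma eval_complex_coth_fps:
  assumes "norm z < pi" shows "eval_fps complex_coth_fps z = zcot (\<i> * z)"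
proof -
  have "eval_fps complex_coth_fps z = eval_fps (fps_expansion zcot 0) (\<i> * z)"
    by (simp add: eval_fps_def complex_coth_fps_def fps_expansion_def zcot_coeff_def
        power_mult_distrib mult.assoc)
  also have "\<dots> = zcot (\<i> * z)"
    using eval_fps_expansion'[of zcot 0 pi "\<i> * z"] zcot_holomorphic assms by (simp add: norm_mult)
  finally show ?thesis .
qed

lemma exp_minus_one_mult_zcot:
  assumes "norm z < pi" shows "(exp (2 * z) - 1) * (zcot (\<i> * z) - z) = 2 * z"
proof -
  have sin: "exp (2 * z) - 1 = - 2 * \<i> * exp z * sin (\<i> * z)"
    unfolding exp_double by (simp add: sin_exp_eq exp_minus field_simps power2_eq_square)
  have "(exp (2 * z) - 1) * (zcot (\<i> * z) - z)
      = - 2 * \<i> * exp z * (sin (\<i> * z) * zcot (\<i> * z) - z * sin (\<i> * z))"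
    unfolding sin by (simp add: algebra_simps)
  also have "\<dots> = 2 * z * exp z * (cos (\<i> * z) + \<i> * sin (\<i> * z))"
    using sin_mult_zcot[of "\<i> * z"] assms by (simp add: norm_mult algebra_simps)
  also have "\<dots> = 2 * z"
    by (simp add: exp_Euler[symmetric] exp_minus mult.assoc)
  finally show ?thesis .
qed

lemma exp_minus_one_mult_complex_coth_fps:
  "(fps_exp 2 - 1) * (complex_coth_fps - fps_X) = fps_const 2 * fps_X"
proof (rule eval_fps_eqD)
  have radius: "fps_conv_radius (fps_exp 2 - 1 :: complex fps) = \<infinity>"
    "fps_conv_radius (complex_coth_fps - fps_X) \<ge> pi"
    using fps_conv_radius_diff[of "fps_exp (2::complex)" 1]
        fps_conv_radius_diff[of complex_coth_fps fps_X]
      fps_conv_radius_complex_coth by simp_all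
  then have product_radius: "fps_conv_radius ((fps_exp 2 - 1) * (complex_coth_fps - fps_X)) \<ge> pi"
    using fps_conv_radius_mult[of "fps_exp 2 - 1" "complex_coth_fps - fps_X"] by simp
  show "fps_conv_radius ((fps_exp 2 - 1) * (complex_coth_fps - fps_X)) > 0"
    by (rule less_le_trans[OF _ product_radius]) simp
  show "fps_conv_radius (fps_const 2 * fps_X :: complex fps) > 0"
    by (simp add: fps_conv_radius_cmult_left)
  have "eval_fps ((fps_exp 2 - 1) * (complex_coth_fps - fps_X)) z
      = eval_fps (fps_const 2 * fps_X) z"
    if z: "norm z < pi" for z
  proof -
    have less: "ereal (norm z) < fps_conv_radius complex_coth_fps"
      "ereal (norm z) < fps_conv_radius (complex_coth_fps - fps_X)"
      using z radius(2) fps_conv_radius_complex_coth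
      by (auto intro: less_le_trans[of "ereal (norm z)" pi])
    show ?thesis
      using exp_minus_one_mult_zcot[OF z] less
      by (simp add: eval_fps_mult eval_fps_diff radius(1) eval_complex_coth_fps[OF z])
  qed
  then show "\<forall>\<^sub>F z in nhds 0. eval_fps ((fps_exp 2 - 1) * (complex_coth_fps - fps_X)) z
      = eval_fps (fps_const 2 * fps_X) z"
    by (intro eventually_mono[OF eventually_nhds_in_open[of "ball (0::complex) pi" 0]]) simp_all
qed

lemma exp_minus_one_mult_coth_fps: "(fps_exp 2 - 1) * (coth_fps - fps_X) = fps_const 2 * fps_X"
proof (rule fps_ext)
  fix n
  define a :: "nat \<Rightarrow> real" where "a = fps_nth (fps_exp 2 - 1)"
  have "fps_nth (fps_exp 2 - 1 :: complex fps) i = of_real (a i)" for i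
    by (simp add: a_def)
  moreover have "fps_nth (coth_fps - fps_X) i = Re (fps_nth (complex_coth_fps - fps_X) i)" for i
    by (simp add: coth_fps_def)
  ultimately have "Re (fps_nth ((fps_exp 2 - 1) * (complex_coth_fps - fps_X)) n)
      = fps_nth ((fps_exp 2 - 1) * (coth_fps - fps_X)) n"
    by (simp add: fps_mult_nth Re_sum del: fps_sub_nth flip: a_def)
  moreover have "Re (fps_nth (fps_const 2 * fps_X :: complex fps) n)
      = fps_nth (fps_const 2 * fps_X) n"
    by (auto simp: fps_const_def)
  ultimately show "fps_nth ((fps_exp 2 - 1) * (coth_fps - fps_X)) n
      = fps_nth (fps_const 2 * fps_X) n"
    unfolding exp_minus_one_mult_complex_coth_fps by simp
qed

lemma exp_mean_mult_coth_fps: "exp_mean_fps * (coth_fps - fps_X) = 1"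
proof -
  have "fps_X * (exp_mean_fps * (coth_fps - fps_X)) = fps_const (1/2) * (fps_const 2 * fps_X)"
    by (simp only: mult.assoc[symmetric, of fps_X] fps_X_mult_exp_mean
        mult.assoc[of "fps_const (1/2)"] exp_minus_one_mult_coth_fps)
  then have "fps_X * (exp_mean_fps * (coth_fps - fps_X)) = fps_X * 1"
    by (simp flip: mult.assoc)
  then show ?thesis by (simp del: mult_1_right)
qed

text \<open>\<open>exp_mean_inv A = A coth A - A\<close>.\<close>
definition exp_mean_inv :: "'b \<Rightarrow> 'b::{real_normed_algebra_1,banach}" where
  "exp_mean_inv A = fps_calc (coth_fps - fps_X) A"

lemma
  fixes A :: "'b::{real_normed_algebra_1,banach}"
  assumes A: "norm A < pi"
  shows exp_mean_inv_eq: "exp_mean_inv A = fps_calc coth_fps A - A"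
    and exp_mean_right_inverse: "exp_mean A * exp_mean_inv A = 1"
    and exp_mean_left_inverse: "exp_mean_inv A * exp_mean A = 1"
proof -
  have "fps_conv_radius (coth_fps - fps_X) \<ge> pi"
    using fps_conv_radius_diff[of coth_fps fps_X] fps_conv_radius_coth by simp
  then have less: "ereal (norm A) < fps_conv_radius coth_fps"
    "ereal (norm A) < fps_conv_radius (coth_fps - fps_X)"
    using A fps_conv_radius_coth by (auto intro: less_le_trans[of "ereal (norm A)" pi])
  show "exp_mean_inv A = fps_calc coth_fps A - A"
    using less(1) by (simp add: exp_mean_inv_def fps_calc_diff)
  show "exp_mean A * exp_mean_inv A = 1" "exp_mean_inv A * exp_mean A = 1"
    using exp_mean_mult_coth_fps fps_calc_mult[of A exp_mean_fps "coth_fps - fps_X"]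
      fps_calc_mult[of A "coth_fps - fps_X" exp_mean_fps] less(2)
    by (simp_all add: exp_mean_def exp_mean_inv_def mult.commute[of _ exp_mean_fps])
qed

lemma exp_mean_inv_mult_exp:
  fixes A :: "'b::{real_normed_algebra_1,banach}"
  assumes "norm A < pi"
  shows "exp_mean_inv A * exp (2 *\<^sub>R A) = exp_mean_inv A + 2 *\<^sub>R A"
    and "exp (2 *\<^sub>R A) * exp_mean_inv A = exp_mean_inv A + 2 *\<^sub>R A"
proof -
  have exp: "exp (2 *\<^sub>R A) = 1 + 2 *\<^sub>R (exp_mean A * A)" "exp (2 *\<^sub>R A) = 1 + 2 *\<^sub>R (A * exp_mean A)"
    by (simp_all add: mult_exp_mean)
  show "exp_mean_inv A * exp (2 *\<^sub>R A) = exp_mean_inv A + 2 *\<^sub>R A"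
    unfolding exp(1)
    by (simp add: distrib_left mult.assoc[symmetric] exp_mean_left_inverse[OF assms])
  show "exp (2 *\<^sub>R A) * exp_mean_inv A = exp_mean_inv A + 2 *\<^sub>R A"
    unfolding exp(2) by (simp add: distrib_right mult.assoc exp_mean_right_inverse[OF assms])
qed

subsection \<open>The operators attached to a family of matrices\<close>

definition pencil :: "('m::finite \<Rightarrow> real^'q::finite^'q) \<Rightarrow> real^'m \<Rightarrow> (real^'q) endo" where
  "pencil U \<tau> = endo_of (\<lambda>x. \<Sum>j\<in>UNIV. \<tau>$j *\<^sub>R (U j *v x))"

lemma app_pencil: "pencil U \<tau> \<bullet>\<^sub>v x = (\<Sum>j\<in>UNIV. \<tau>$j *\<^sub>R (U j *v x))"
  unfolding pencil_def
  by (rule app_endo_of)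
     (intro linear_compose_sum linear_compose_scale_right ballI matrix_vector_mul_linear)

lemma bounded_linear_pencil: "bounded_linear (pencil U)"
proof -
  have "linear (pencil U)"
    by (rule linearI; rule endo_eqI)
       (simp_all add: app_pencil app.add_left app.scaleR_left scaleR_add_left sum.distrib
         scaleR_sum_right)
  then show ?thesis by (simp add: linear_conv_bounded_linear)
qed

lemma pencil_scaleR: "pencil U (s *\<^sub>R \<tau>) = s *\<^sub>R pencil U \<tau>"
  by (rule linear_cmul[OF bounded_linear.linear[OF bounded_linear_pencil]])

lemma inner_skew_matrix:
  assumes "transpose A = - (A :: real^'q::finite^'q)" shows "(A *v x) \<bullet> y = - (x \<bullet> (A *v y))"
proof -
  have "(A *v x) \<bullet> y = x \<bullet> (transpose A *v y)"
    by (metis dot_lmul_matrix inner_commute transpose_matrix_vector)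
  also have "transpose A *v y = - (A *v y)"
    by (simp add: assms vec_eq_iff matrix_vector_mult_def sum_negf)
  finally show ?thesis by simp
qed

lemma pencil_skew:
  assumes "\<And>j. transpose (U j) = - U j"
  shows "(pencil U \<tau> \<bullet>\<^sub>v x) \<bullet> y = - (x \<bullet> (pencil U \<tau> \<bullet>\<^sub>v y))"
  by (simp add: app_pencil inner_sum_left inner_sum_right inner_skew_matrix[OF assms] sum_negf)

lemma pencil_nth: "(pencil U \<tau> \<bullet>\<^sub>v x) $ a = (\<Sum>b\<in>UNIV. (\<Sum>j\<in>UNIV. \<tau>$j * U j $ a $ b) * x $ b)"
  unfolding app_pencil
  by (simp add: matrix_vector_mult_def sum_distrib_left sum_distrib_right mult.assoc)
     (rule sum.swap)

lemma Utau_mult_nth: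
  "(Utau U \<tau> *v v) $ a
    = \<i> * Complex ((pencil U \<tau> \<bullet>\<^sub>v (\<chi> b. Re (v $ b))) $ a) ((pencil U \<tau> \<bullet>\<^sub>v (\<chi> b. Im (v $ b))) $ a)"
  by (simp add: matrix_vector_mult_def Utau_def pencil_nth complex_eq_iff Re_sum Im_sum sum_negf
      flip: sum_distrib_left)

lemma norm_complex_vec_sq:
  "(norm (v::complex^'q::finite))\<^sup>2 = (norm (\<chi> b. Re (v $ b)))\<^sup>2 + (norm (\<chi> b. Im (v $ b)))\<^sup>2"
  by (simp add: norm_vec_def L2_set_def sum_nonneg real_sqrt_pow2 cmod_power2 sum.distrib)

lemma norm_Utau_mult_sq:
  "(norm (Utau U \<tau> *v v))\<^sup>2
    = (norm (pencil U \<tau> \<bullet>\<^sub>v (\<chi> b. Re (v $ b))))\<^sup>2 + (norm (pencil U \<tau> \<bullet>\<^sub>v (\<chi> b. Im (v $ b))))\<^sup>2"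
  unfolding norm_complex_vec_sq[of "Utau U \<tau> *v v"] Utau_mult_nth
  by (simp add: vec_lambda_eta norm_vec_def L2_set_def)

lemma bounded_linear_complex_matrix_mult:
  "bounded_linear (\<lambda>v. (A :: complex^'n::finite^'k::finite) *v v)"
proof -
  have "linear (\<lambda>v. A *v v)"
    by (rule linearI)
       (simp_all add: matrix_vector_right_distrib vec_eq_iff matrix_vector_mult_def
         scaleR_sum_right distrib_left sum.distrib)
  then show ?thesis by (simp add: linear_conv_bounded_linear)
qed

lemma opnorm_Utau:
  fixes U :: "'m::finite \<Rightarrow> real^'q::finite^'q"
  shows "opnorm (Utau U \<tau>) = norm (pencil U \<tau>)"
proof (rule antisym)
  let ?J = "pencil U \<tau>"
  show "opnorm (Utau U \<tau>) \<le> norm ?J"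
    unfolding opnorm_def
  proof (rule onorm_le)
    fix v :: "complex^'q"
    have "(norm (Utau U \<tau> *v v))\<^sup>2 \<le> (norm ?J * norm (\<chi> b. Re (v $ b)))\<^sup>2
        + (norm ?J * norm (\<chi> b. Im (v $ b)))\<^sup>2"
      unfolding norm_Utau_mult_sq by (intro add_mono power_mono norm_app_le) auto
    also have "\<dots> = (norm ?J * norm v)\<^sup>2"
      by (simp add: power_mult_distrib norm_complex_vec_sq[of v] distrib_left)
    finally show "norm (Utau U \<tau> *v v) \<le> norm ?J * norm v"
      by (rule power2_le_imp_le) simp
  qed
  show "norm ?J \<le> opnorm (Utau U \<tau>)"
  proof (rule norm_endo_le)
    show "0 \<le> opnorm (Utau U \<tau>)"
      unfolding opnorm_def by (rule onorm_pos_le[OF bounded_linear_complex_matrix_mult])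
    fix x :: "real^'q"
    define v :: "complex^'q" where "v = (\<chi> b. of_real (x $ b))"
    have "(norm (Utau U \<tau> *v v))\<^sup>2 = (norm (?J \<bullet>\<^sub>v x))\<^sup>2"
      unfolding norm_Utau_mult_sq
      by (simp add: v_def app.zero_right vec_lambda_eta flip: zero_vec_def)
    moreover have "(norm v)\<^sup>2 = (norm x)\<^sup>2"
      unfolding norm_complex_vec_sq by (simp add: v_def vec_lambda_eta flip: zero_vec_def)
    ultimately have "norm (?J \<bullet>\<^sub>v x) = norm (Utau U \<tau> *v v)" "norm v = norm x"
      by (simp_all add: power2_eq_iff_nonneg)
    then show "norm (?J \<bullet>\<^sub>v x) \<le> opnorm (Utau U \<tau>) * norm x"
      using onorm[OF bounded_linear_complex_matrix_mult, of "Utau U \<tau>" v]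
      unfolding opnorm_def by simp
  qed
qed

lemma mem_Omega_star_iff: "\<tau> \<in> Omega_star U \<longleftrightarrow> norm (pencil U \<tau>) < pi"
  by (simp add: Omega_star_def opnorm_Utau)

lemma cmatpow_Utau:
  "cmatpow (Utau U \<tau>) n $ a $ b = \<i> ^ n * of_real ((pencil U \<tau> ^ n \<bullet>\<^sub>v axis b 1) $ a)"
proof (induction n arbitrary: a)
  case 0
  show ?case by (simp add: cmatpow_def mat_def axis_def)
next
  case (Suc n)
  have entry: "Utau U \<tau> $ a $ c * (\<i> ^ n * of_real y)
      = \<i> ^ Suc n * of_real ((\<Sum>j\<in>UNIV. \<tau>$j * U j $ a $ c) * y)" for c y
    by (simp add: Utau_def mult_ac)
  have "cmatpow (Utau U \<tau>) (Suc n) $ a $ b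
      = (\<Sum>c\<in>UNIV. Utau U \<tau> $ a $ c * cmatpow (Utau U \<tau>) n $ c $ b)"
    by (simp add: cmatpow_def matrix_matrix_mult_def)
  also have "\<dots> = \<i> ^ Suc n * of_real
      (\<Sum>c\<in>UNIV. (\<Sum>j\<in>UNIV. \<tau>$j * U j $ a $ c) * (pencil U \<tau> ^ n \<bullet>\<^sub>v axis b 1) $ c)"
    unfolding Suc entry of_real_sum sum_distrib_left ..
  finally show ?case by (simp add: pencil_nth)
qed

lemma mat_zcot_nth_sums:
  fixes U :: "'m::finite \<Rightarrow> real^'q::finite^'q"
  assumes "norm (pencil U \<tau>) < pi"
  shows "(\<lambda>n. zcot_coeff n * cmatpow (Utau U \<tau>) n $ a $ b) sums mat_zcot (Utau U \<tau>) $ a $ b"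
proof -
  define e where "e n = cmat_scale (zcot_coeff n) (cmatpow (Utau U \<tau>) n)" for n
  have e_nth: "e n $ a $ b = zcot_coeff n * cmatpow (Utau U \<tau>) n $ a $ b" for n a b
    by (simp add: e_def cmat_scale_def)
  have norm_le: "norm (e n $ a $ b) \<le> norm (zcot_coeff n * of_real (norm (pencil U \<tau>)) ^ n)"
    for n a b
  proof -
    have "\<bar>(pencil U \<tau> ^ n \<bullet>\<^sub>v axis b 1) $ a\<bar> \<le> norm (pencil U \<tau> ^ n \<bullet>\<^sub>v axis b 1)"
      by (rule component_le_norm_cart)
    also have "\<dots> \<le> norm (pencil U \<tau> ^ n)"
      using norm_app_le[of "pencil U \<tau> ^ n" "axis b 1"] by simp
    also have "\<dots> \<le> norm (pencil U \<tau>) ^ n" by (rule norm_power_ineq)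
    finally show ?thesis
      by (simp add: e_nth cmatpow_Utau norm_mult norm_power mult_left_mono)
  qed
  have "ereal (norm (of_real (norm (pencil U \<tau>)) :: complex))
      < fps_conv_radius (Abs_fps zcot_coeff)"
    using less_le_trans[OF _ fps_conv_radius_zcot] assms by simp
  then have "summable (\<lambda>n. norm (zcot_coeff n * of_real (norm (pencil U \<tau>)) ^ n))"
    using norm_summable_fps by fastforce
  then have entry_sums: "(\<lambda>n. e n $ a $ b) sums (\<Sum>n. e n $ a $ b)" for a b
    by (intro summable_sums summable_comparison_test'[OF _ norm_le])
  have "e sums (\<chi> a b. \<Sum>n. e n $ a $ b)"
    using entry_sums unfolding sums_def by (intro vec_tendstoI) simp
  then have "mat_zcot (Utau U \<tau>) = (\<chi> a b. \<Sum>n. e n $ a $ b)"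
    unfolding mat_zcot_def e_def by (simp add: sums_iff)
  then show ?thesis using entry_sums by (simp add: e_nth)
qed

lemma Re_mat_zcot:
  assumes "norm (pencil U \<tau>) < pi"
  shows "Re (mat_zcot (Utau U \<tau>) $ a $ b) = (fps_calc coth_fps (pencil U \<tau>) \<bullet>\<^sub>v axis b 1) $ a"
proof -
  have "ereal (norm (pencil U \<tau>)) < fps_conv_radius coth_fps"
    using less_le_trans[OF _ fps_conv_radius_coth] assms by simp
  then have "(\<lambda>n. ((fps_nth coth_fps n *\<^sub>R pencil U \<tau> ^ n) \<bullet>\<^sub>v axis b 1) $ a)
      sums ((fps_calc coth_fps (pencil U \<tau>) \<bullet>\<^sub>v axis b 1) $ a)"
    by (intro fps_calc_sums
        bounded_linear.sums[OF bounded_linear_compose[OF bounded_linear_vec_nth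
            app.bounded_linear_left]])
  moreover have "Re (zcot_coeff n * cmatpow (Utau U \<tau>) n $ a $ b)
      = ((fps_nth coth_fps n *\<^sub>R pencil U \<tau> ^ n) \<bullet>\<^sub>v axis b 1) $ a" for n
    by (simp add: cmatpow_Utau coth_fps_def complex_coth_fps_def app.scaleR_left flip: mult.assoc)
  ultimately show ?thesis
    using sums_Re[OF mat_zcot_nth_sums[OF assms, of a b]] by (simp add: sums_unique2)
qed

lemma phi_eq:
  assumes skew: "\<And>j. transpose (U j) = - U j" and \<tau>: "\<tau> \<in> Omega_star U"
  shows "phi U g \<tau> = (exp_mean_inv (pencil U \<tau>) \<bullet>\<^sub>v fst g) \<bullet> fst g + 4 * (snd g \<bullet> \<tau>)"
proof -
  define K x where "K = fps_calc coth_fps (pencil U \<tau>)" and "x = fst g"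
  have "norm (pencil U \<tau>) < pi" using \<tau> by (simp add: mem_Omega_star_iff)
  note Re_entry = Re_mat_zcot[OF this] and inv_eq = exp_mean_inv_eq[OF this]
  have "x = (\<Sum>b\<in>UNIV. x $ b *\<^sub>R axis b 1)"
    by (simp add: vec_eq_iff axis_def if_distrib cong: if_cong)
  then have "K \<bullet>\<^sub>v x = (\<Sum>b\<in>UNIV. x $ b *\<^sub>R (K \<bullet>\<^sub>v axis b 1))"
    by (metis (no_types, lifting) app.scaleR_right app.sum_right sum.cong)
  then have K_nth: "(K \<bullet>\<^sub>v x) $ a = (\<Sum>b\<in>UNIV. x $ b * (K \<bullet>\<^sub>v axis b 1) $ a)" for a
    by simp
  have "Re (\<Sum>a\<in>UNIV. \<Sum>b\<in>UNIV. mat_zcot (Utau U \<tau>) $ a $ b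
        * complex_of_real (x $ b) * complex_of_real (x $ a))
      = (K \<bullet>\<^sub>v x) \<bullet> x"
    by (simp add: Re_sum Re_entry inner_vec_def K_nth sum_distrib_right sum_distrib_left mult_ac
        flip: K_def)
  moreover have "(pencil U \<tau> \<bullet>\<^sub>v x) \<bullet> x = 0"
    using pencil_skew[where U=U and \<tau>=\<tau> and x=x and y=x, OF skew] by (simp add: inner_commute)
  ultimately show ?thesis
    by (simp add: phi_def Let_def inv_eq app.diff_left inner_diff_left flip: x_def K_def)
qed

subsection \<open>Adjoints and the Riccati equation\<close>

definition is_adjoint :: "'a::euclidean_space endo \<Rightarrow> 'a endo \<Rightarrow> bool" where
  "is_adjoint A B \<longleftrightarrow> (\<forall>x y. (A \<bullet>\<^sub>v x) \<bullet> y = x \<bullet> (B \<bullet>\<^sub>v y))"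

lemma is_adjointD: "is_adjoint A B \<Longrightarrow> (A \<bullet>\<^sub>v x) \<bullet> y = x \<bullet> (B \<bullet>\<^sub>v y)"
  by (simp add: is_adjoint_def)

lemma is_adjoint_power: "is_adjoint A B \<Longrightarrow> is_adjoint (A ^ n) (B ^ n)"
proof (induction n)
  case (Suc n)
  then show ?case
    unfolding is_adjoint_def power_Suc by (metis app_mult power_commutes)
qed (simp add: is_adjoint_def)

lemma is_adjoint_scaleR: "is_adjoint A B \<Longrightarrow> is_adjoint (c *\<^sub>R A) (c *\<^sub>R B)"
  by (simp add: is_adjoint_def app.scaleR_left)

lemma is_adjoint_fps_calc:
  assumes "ereal (norm A) < fps_conv_radius F" "ereal (norm B) < fps_conv_radius F" "is_adjoint A B"
  shows "is_adjoint (fps_calc F A) (fps_calc F B)"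
  unfolding is_adjoint_def
proof (intro allI)
  fix x y
  have "(\<lambda>n. ((fps_nth F n *\<^sub>R A ^ n) \<bullet>\<^sub>v x) \<bullet> y) sums ((fps_calc F A \<bullet>\<^sub>v x) \<bullet> y)"
    by (intro fps_calc_sums assms
        bounded_linear.sums[OF bounded_linear_compose[OF bounded_linear_inner_left
            app.bounded_linear_left]])
  moreover have "(\<lambda>n. x \<bullet> ((fps_nth F n *\<^sub>R B ^ n) \<bullet>\<^sub>v y)) sums (x \<bullet> (fps_calc F B \<bullet>\<^sub>v y))"
    by (intro fps_calc_sums assms
        bounded_linear.sums[OF bounded_linear_compose[OF bounded_linear_inner_right
            app.bounded_linear_left]])
  ultimately show "(fps_calc F A \<bullet>\<^sub>v x) \<bullet> y = x \<bullet> (fps_calc F B \<bullet>\<^sub>v y)"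
    using is_adjointD[OF is_adjoint_scaleR[OF is_adjoint_power[OF assms(3)]]]
    by (simp add: sums_unique2)
qed

lemma is_adjoint_exp:
  assumes "is_adjoint A (- A)" shows "is_adjoint (exp (c *\<^sub>R A)) (exp (- (c *\<^sub>R A)))"
  using is_adjoint_fps_calc[OF _ _ assms, of "fps_exp c"] by simp

lemma norm_exp_skew:
  assumes "is_adjoint A (- A)" shows "norm (exp (c *\<^sub>R A) \<bullet>\<^sub>v x) = norm x"
proof -
  have "(exp (c *\<^sub>R A) \<bullet>\<^sub>v x) \<bullet> (exp (c *\<^sub>R A) \<bullet>\<^sub>v x) = x \<bullet> ((exp (- (c *\<^sub>R A)) * exp (c *\<^sub>R A)) \<bullet>\<^sub>v x)"
    by (simp add: is_adjointD[OF is_adjoint_exp[OF assms]])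
  also have "exp (- (c *\<^sub>R A)) * exp (c *\<^sub>R A) = 1"
    using exp_minus_inverse[of "- (c *\<^sub>R A)"] by simp
  finally show ?thesis by (simp add: norm_eq_sqrt_inner)
qed

lemma is_adjoint_exp_mean_inv:
  assumes skew: "is_adjoint A (- A)" and A: "norm A < pi"
  shows "is_adjoint (exp_mean_inv A) (exp_mean_inv A + 2 *\<^sub>R A)"
  unfolding is_adjoint_def
proof (intro allI)
  fix x y
  define u v where "u = exp_mean_inv A \<bullet>\<^sub>v x" and "v = exp_mean_inv A \<bullet>\<^sub>v y"
  have x: "x = exp_mean A \<bullet>\<^sub>v u" and y: "y = exp_mean A \<bullet>\<^sub>v v"
    unfolding u_def v_def by (metis app_mult app_one exp_mean_right_inverse[OF A])+
  have adjoint_exp_mean: "is_adjoint (exp_mean (- A)) (exp_mean A)"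
    unfolding exp_mean_def
    by (rule is_adjoint_fps_calc) (use skew in \<open>auto simp: is_adjoint_def app.minus_left\<close>)
  have exp_mean_uminus_A: "exp_mean (- A) = exp (- (2 *\<^sub>R A)) * exp_mean A"
    using exp_mean_uminus[of "- A"] by simp
  have "u \<bullet> y = (exp_mean (- A) \<bullet>\<^sub>v u) \<bullet> v"
    unfolding y by (rule is_adjointD[OF adjoint_exp_mean, symmetric])
  also have "\<dots> = (exp (- (2 *\<^sub>R A)) \<bullet>\<^sub>v x) \<bullet> v"
    unfolding exp_mean_uminus_A app_mult x[symmetric] ..
  also have "\<dots> = x \<bullet> (exp (2 *\<^sub>R A) \<bullet>\<^sub>v v)"
    using is_adjointD[OF is_adjoint_exp[OF skew, of "-2"]] by simp
  also have "\<dots> = x \<bullet> ((exp_mean_inv A + 2 *\<^sub>R A) \<bullet>\<^sub>v y)"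
    unfolding v_def by (simp flip: app_mult add: exp_mean_inv_mult_exp[OF A])
  finally show "(exp_mean_inv A \<bullet>\<^sub>v x) \<bullet> y = x \<bullet> ((exp_mean_inv A + 2 *\<^sub>R A) \<bullet>\<^sub>v y)"
    unfolding u_def .
qed

text \<open>\<open>riccati A s = A coth (s A) - A\<close>.\<close>
definition riccati :: "'b \<Rightarrow> real \<Rightarrow> 'b::{real_normed_algebra_1,banach}" where
  "riccati A s = (1 / s) *\<^sub>R exp_mean_inv (s *\<^sub>R A)"

lemma exp_mult_riccati:
  assumes "0 < s" "s * norm A < pi"
  shows "exp ((2 * s) *\<^sub>R A) * riccati A s = riccati A s + 2 *\<^sub>R A"
  using exp_mean_inv_mult_exp(2)[of "s *\<^sub>R A"] assms by (simp add: riccati_def scaleR_add_right)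

lemma is_adjoint_riccati:
  assumes skew: "is_adjoint A (- A)" and s: "0 < s" "s * norm A < pi"
  shows "is_adjoint (riccati A s) (riccati A s + 2 *\<^sub>R A)"
proof -
  have "is_adjoint (exp_mean_inv (s *\<^sub>R A)) (exp_mean_inv (s *\<^sub>R A) + 2 *\<^sub>R (s *\<^sub>R A))"
    by (rule is_adjoint_exp_mean_inv) (use is_adjoint_scaleR[OF skew, of s] s in simp_all)
  from is_adjoint_scaleR[OF this, of "1 / s"] show ?thesis
    using s by (simp add: riccati_def scaleR_add_right)
qed

lemma riccati_has_derivative:
  fixes A :: "'b::{real_normed_algebra_1,banach}"
  assumes s: "0 < s" "s * norm A < pi"
  shows "(riccati A has_vector_derivative - (riccati A s * (riccati A s + 2 *\<^sub>R A))) (at s)"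
proof -
  define S where "S = {s. 0 < s \<and> s * norm A < pi}"
  have "s \<in> S" using s by (simp add: S_def)
  interpret inverse_functions "\<lambda>u. u *\<^sub>R exp_mean (u *\<^sub>R A)" "riccati A" S
  proof
    show "open S"
      unfolding S_def by (intro open_Collect_conj open_Collect_less continuous_intros)
    show "u *\<^sub>R exp_mean (u *\<^sub>R A) * riccati A u = 1"
      "riccati A u * u *\<^sub>R exp_mean (u *\<^sub>R A) = 1" if "u \<in> S" for u
      using that exp_mean_right_inverse[of "u *\<^sub>R A"] exp_mean_left_inverse[of "u *\<^sub>R A"]
      by (simp_all add: S_def riccati_def)
  qed
  have "(riccati A has_derivative
      (\<lambda>h. - (riccati A s * (h *\<^sub>R exp ((2 * s) *\<^sub>R A) * riccati A s)))) (at s)"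
    using has_derivative_inverse[OF \<open>s \<in> S\<close>
        scaleR_exp_mean_has_derivative[unfolded has_vector_derivative_def]] .
  then show ?thesis
    by (simp add: has_vector_derivative_def exp_mult_riccati[OF s])
qed

lemma riccati_form_has_derivative:
  fixes x :: "real \<Rightarrow> 'a::euclidean_space"
  assumes skew: "is_adjoint A (- A)"
    and \<sigma>: "(\<sigma> has_vector_derivative \<sigma>') (at r within S)" "0 < \<sigma> r" "\<sigma> r * norm A < pi"
    and x: "(x has_vector_derivative h) (at r within S)"
  defines "y \<equiv> (riccati A (\<sigma> r) + 2 *\<^sub>R A) \<bullet>\<^sub>v x r"
  shows "((\<lambda>r. (riccati A (\<sigma> r) \<bullet>\<^sub>v x r) \<bullet> x r) has_vector_derivative
    2 * (h \<bullet> y) - \<sigma>' * (y \<bullet> y) - 2 * ((A \<bullet>\<^sub>v x r) \<bullet> h)) (at r within S)"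
proof -
  let ?I = "riccati A (\<sigma> r)"
  note adjoint = is_adjointD[OF is_adjoint_riccati[OF skew \<sigma>(2,3)]]
  have "((\<lambda>r. riccati A (\<sigma> r)) has_vector_derivative
      \<sigma>' *\<^sub>R (- (?I * (?I + 2 *\<^sub>R A)))) (at r within S)"
    using vector_diff_chain_within[OF \<sigma>(1)
        has_vector_derivative_at_within[OF riccati_has_derivative[OF \<sigma>(2,3)]]]
    by (simp add: o_def)
  from bounded_bilinear.has_vector_derivative[OF bounded_bilinear_inner
      bounded_bilinear.has_vector_derivative[OF bounded_bilinear_app this x] x]
  have "((\<lambda>r. (riccati A (\<sigma> r) \<bullet>\<^sub>v x r) \<bullet> x r) has_vector_derivative
      (?I \<bullet>\<^sub>v x r) \<bullet> h + (?I \<bullet>\<^sub>v h + (\<sigma>' *\<^sub>R (- (?I * (?I + 2 *\<^sub>R A)))) \<bullet>\<^sub>v x r) \<bullet> x r)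
      (at r within S)" .
  moreover have "(?I \<bullet>\<^sub>v x r) \<bullet> h = h \<bullet> y - 2 * ((A \<bullet>\<^sub>v x r) \<bullet> h)"
    by (simp add: y_def app.add_left app.scaleR_left inner_add_right inner_commute)
  moreover have "(?I \<bullet>\<^sub>v h) \<bullet> x r = h \<bullet> y"
    unfolding y_def by (rule adjoint)
  moreover have "((\<sigma>' *\<^sub>R (- (?I * (?I + 2 *\<^sub>R A)))) \<bullet>\<^sub>v x r) \<bullet> x r = - (\<sigma>' * (y \<bullet> y))"
    using adjoint[of y "x r"] by (simp add: y_def app.scaleR_left app.minus_left)
  ultimately show ?thesis by (simp add: inner_add_left add_diff_eq)
qed

definition arc_length :: "(real \<Rightarrow> 'a::euclidean_space) \<Rightarrow> real" where
  "arc_length h = integral {0..1} (\<lambda>r. norm (h r))"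

lemma integral_norm_le_arc_length:
  fixes h :: "real \<Rightarrow> 'a::euclidean_space"
  assumes "(\<lambda>r. norm (h r)) integrable_on {0..1}" "r \<in> {0..1}"
  shows "0 \<le> integral {0..r} (\<lambda>r. norm (h r))" "integral {0..r} (\<lambda>r. norm (h r)) \<le> arc_length h"
proof -
  have integrable: "(\<lambda>r. norm (h r)) integrable_on {0..r}"
    by (rule integrable_subinterval_real[OF assms(1)]) (use assms(2) in auto)
  show "0 \<le> integral {0..r} (\<lambda>r. norm (h r))"
    by (rule integral_nonneg[OF integrable]) simp
  show "integral {0..r} (\<lambda>r. norm (h r)) \<le> arc_length h"
    unfolding arc_length_def
    by (rule integral_subset_le[OF _ integrable assms(1)]) (use assms(2) in auto)
qed

text \<open>For \<open>A = pencil U \<tau>\<close> and a horizontal curve \<open>(x, t)\<close> with velocity \<open>h = x'\<close>, the value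
  \<open>swept A h h\<close> is \<open>4 \<langle>t(1), \<tau>\<rangle>\<close>.\<close>
definition swept :: "'a::euclidean_space endo \<Rightarrow> (real \<Rightarrow> 'a) \<Rightarrow> (real \<Rightarrow> 'a) \<Rightarrow> real" where
  "swept A h k = integral {0..1} (\<lambda>r. 2 * ((A \<bullet>\<^sub>v integral {0..r} h) \<bullet> k r))"

text \<open>The value \<open>\<phi>(g; \<tau>)\<close> at the endpoint \<open>g\<close> of that curve.\<close>
definition phi_along :: "'a::euclidean_space endo \<Rightarrow> (real \<Rightarrow> 'a) \<Rightarrow> real" where
  "phi_along A h = (exp_mean_inv A \<bullet>\<^sub>v integral {0..1} h) \<bullet> integral {0..1} h + swept A h h"

lemma two_inner_le_weighted: "0 < c \<Longrightarrow> 2 * (u \<bullet> v) - c * (v \<bullet> v) \<le> (norm u)\<^sup>2 / c"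
  for u v :: "'a::real_inner"
proof -
  assume c: "0 < c"
  have "0 \<le> (u - c *\<^sub>R v) \<bullet> (u - c *\<^sub>R v)" by simp
  then have "2 * c * (u \<bullet> v) - c * (c * (v \<bullet> v)) \<le> (norm u)\<^sup>2"
    by (simp add: inner_diff_left inner_diff_right inner_commute power2_norm_eq_inner)
  then show ?thesis using c by (simp add: field_simps)
qed

text \<open>The clock \<open>\<sigma>\<close> runs the Riccati equation along the curve; completing the square in it leaves
  at most \<open>\<bar>h\<bar>\<^sup>2 / \<sigma>'\<close>.\<close>
lemma phi_along_le_weighted_energy:
  fixes h :: "real \<Rightarrow> 'a::euclidean_space"
  assumes skew: "is_adjoint A (- A)" and A: "norm A < pi" and h: "continuous_on {0..1} h"
    and \<sigma>: "\<And>r. r \<in> {0..1} \<Longrightarrow> (\<sigma> has_vector_derivative \<sigma>' r) (at r within {0..1})"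
      "\<And>r. r \<in> {0..1} \<Longrightarrow> 0 < \<sigma> r" "\<And>r. r \<in> {0..1} \<Longrightarrow> \<sigma> r \<le> 1" "\<sigma> 1 = 1"
    and \<sigma>': "continuous_on {0..1} \<sigma>'" "\<And>r. r \<in> {0..1} \<Longrightarrow> 0 < \<sigma>' r"
  shows "phi_along A h \<le> integral {0..1} (\<lambda>r. (norm (h r))\<^sup>2 / \<sigma>' r)"
proof -
  define x where "x s = integral {0..s} h" for s
  define q where "q r = (riccati A (\<sigma> r) \<bullet>\<^sub>v x r) \<bullet> x r" for r
  define y where "y r = (riccati A (\<sigma> r) + 2 *\<^sub>R A) \<bullet>\<^sub>v x r" for r
  define q' where "q' r = 2 * (h r \<bullet> y r) - \<sigma>' r * (y r \<bullet> y r) - 2 * ((A \<bullet>\<^sub>v x r) \<bullet> h r)" for r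
  have x: "(x has_vector_derivative h r) (at r within {0..1})" if "r \<in> {0..1}" for r
    unfolding x_def[abs_def] by (rule integral_has_vector_derivative[OF h that])
  have "\<sigma> r * norm A < pi" if "r \<in> {0..1}" for r
    using A mult_right_mono[OF \<sigma>(3)[OF that] norm_ge_zero[of A]] by simp
  then have "(q has_vector_derivative q' r) (at r within {0..1})" if "r \<in> {0..1}" for r
    using riccati_form_has_derivative[OF skew \<sigma>(1,2)[OF that] _ x[OF that]] that
    unfolding q_def[abs_def] q'_def y_def by simp
  then have q': "(q' has_integral q 1 - q 0) {0..1}"
    by (intro fundamental_theorem_of_calculus) auto
  have "continuous_on {0..1} x" by (rule continuous_on_vector_derivative[OF x])
  then have "continuous_on {0..1} (\<lambda>r. 2 * ((A \<bullet>\<^sub>v x r) \<bullet> h r))"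
    by (intro continuous_intros h app.continuous_on)
  then have "((\<lambda>r. 2 * ((A \<bullet>\<^sub>v x r) \<bullet> h r)) has_integral swept A h h) {0..1}"
    unfolding swept_def x_def by (intro integrable_integral integrable_continuous_real)
  then have "((\<lambda>r. q' r + 2 * ((A \<bullet>\<^sub>v x r) \<bullet> h r)) has_integral q 1 - q 0 + swept A h h) {0..1}"
    by (rule has_integral_add[OF q'])
  moreover have "((\<lambda>r. (norm (h r))\<^sup>2 / \<sigma>' r) has_integral
      integral {0..1} (\<lambda>r. (norm (h r))\<^sup>2 / \<sigma>' r)) {0..1}"
    using \<sigma>' by (intro integrable_integral integrable_continuous_real continuous_intros h) force+
  moreover have "q' r + 2 * ((A \<bullet>\<^sub>v x r) \<bullet> h r) \<le> (norm (h r))\<^sup>2 / \<sigma>' r" if "r \<in> {0..1}" for r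
    using two_inner_le_weighted[OF \<sigma>'(2)[OF that], of "h r" "y r"] by (simp add: q'_def)
  ultimately have "q 1 - q 0 + swept A h h \<le> integral {0..1} (\<lambda>r. (norm (h r))\<^sup>2 / \<sigma>' r)"
    by (rule has_integral_le)
  then show ?thesis by (simp add: phi_along_def q_def x_def \<sigma>(4) riccati_def app.zero_right)
qed

lemma square_divide_le:
  fixes a e m :: real
  assumes "0 \<le> a" "0 < e" "0 < m" shows "a\<^sup>2 / ((a + e) / m) \<le> m * a"
proof -
  have "m * a * a \<le> m * a * (a + e)" using assms by (intro mult_left_mono) auto
  then show ?thesis using assms by (simp add: power2_eq_square pos_divide_le_eq mult_ac)
qed

lemma integral_square_divide_le:
  fixes h :: "real \<Rightarrow> 'a::euclidean_space"
  assumes h: "continuous_on {0..1} h" and "0 < e" "0 < m"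
  shows "integral {0..1} (\<lambda>r. (norm (h r))\<^sup>2 / ((norm (h r) + e) / m)) \<le> m * arc_length h"
proof -
  have "norm (h r) + e \<noteq> 0" for r using norm_ge_zero[of "h r"] \<open>0 < e\<close> by linarith
  then have "(\<lambda>r. (norm (h r))\<^sup>2 / ((norm (h r) + e) / m)) integrable_on {0..1}"
    using \<open>0 < m\<close> by (intro integrable_continuous_real continuous_intros h) auto
  moreover have "(\<lambda>r. m * norm (h r)) integrable_on {0..1}"
    by (intro integrable_continuous_real continuous_intros h)
  ultimately have "integral {0..1} (\<lambda>r. (norm (h r))\<^sup>2 / ((norm (h r) + e) / m))
      \<le> integral {0..1} (\<lambda>r. m * norm (h r))"
    by (rule integral_le) (rule square_divide_le[OF norm_ge_zero assms(2,3)])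
  then show ?thesis by (simp add: arc_length_def)
qed

text \<open>The best clock is normalised arc length; \<open>e\<close> keeps the clock and its speed positive.\<close>
lemma phi_along_le_length_sq_regularised:
  fixes h :: "real \<Rightarrow> 'a::euclidean_space"
  assumes skew: "is_adjoint A (- A)" and A: "norm A < pi" and h: "continuous_on {0..1} h"
    and e: "0 < e"
  shows "phi_along A h \<le> (arc_length h + 2 * e) * arc_length h"
proof -
  define N where "N s = integral {0..s} (\<lambda>r. norm (h r))" for s
  define m where "m = arc_length h + 2 * e"
  define \<sigma> \<sigma>' where "\<sigma> s = (e + N s + e * s) / m" and "\<sigma>' s = (norm (h s) + e) / m" for s
  have norm_h: "continuous_on {0..1} (\<lambda>r. norm (h r))" using h by (rule continuous_on_norm)
  then have integrable: "(\<lambda>r. norm (h r)) integrable_on {0..1}" by (rule integrable_continuous_real)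
  then have N: "0 \<le> N r" "N r \<le> arc_length h" if "r \<in> {0..1}" for r
    using integral_norm_le_arc_length[OF _ that] by (simp_all add: N_def)
  have m: "0 < m" using N[of 1] e by (simp add: m_def)
  have "phi_along A h \<le> integral {0..1} (\<lambda>r. (norm (h r))\<^sup>2 / \<sigma>' r)"
  proof (rule phi_along_le_weighted_energy[OF skew A h, of \<sigma> \<sigma>'])
    fix r :: real assume r: "r \<in> {0..1}"
    have "(N has_vector_derivative norm (h r)) (at r within {0..1})"
      unfolding N_def[abs_def] by (rule integral_has_vector_derivative[OF norm_h r])
    then show "(\<sigma> has_vector_derivative \<sigma>' r) (at r within {0..1})"
      unfolding \<sigma>_def[abs_def] \<sigma>'_def has_real_derivative_iff_has_vector_derivative[symmetric]
      using m by (auto intro!: derivative_eq_intros)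
    show "0 < \<sigma> r"
      using N(1)[OF r] r e m by (auto simp: \<sigma>_def intro!: divide_pos_pos add_pos_nonneg)
    have "e * r \<le> e * 1" using r e by (intro mult_left_mono) auto
    then show "\<sigma> r \<le> 1" using N(2)[OF r] m by (simp add: \<sigma>_def m_def)
    show "0 < \<sigma>' r" using m e by (simp add: \<sigma>'_def add_nonneg_pos)
  next
    show "\<sigma> 1 = 1" using m by (simp add: \<sigma>_def N_def m_def arc_length_def)
    show "continuous_on {0..1} \<sigma>'"
      unfolding \<sigma>'_def[abs_def] using m by (intro continuous_intros h) simp
  qed
  also have "\<dots> \<le> m * arc_length h"
    unfolding \<sigma>'_def by (rule integral_square_divide_le[OF h e m])
  finally show ?thesis by (simp add: m_def)
qed

lemma phi_along_le_length_sq_continuous: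
  fixes h :: "real \<Rightarrow> 'a::euclidean_space"
  assumes "is_adjoint A (- A)" "norm A < pi" "continuous_on {0..1} h"
  shows "phi_along A h \<le> (arc_length h)\<^sup>2"
proof -
  have "((\<lambda>e. (arc_length h + 2 * e) * arc_length h)
      \<longlongrightarrow> (arc_length h + 2 * 0) * arc_length h) (at_right 0)"
    by (intro tendsto_intros)
  then have "phi_along A h \<le> (arc_length h + 2 * 0) * arc_length h"
    by (rule tendsto_lowerbound)
       (use phi_along_le_length_sq_regularised[OF assms] in \<open>auto simp: eventually_at_filter\<close>)
  then show ?thesis by (simp add: power2_eq_square)
qed

subsection \<open>Curves with integrable velocity\<close>

lemma absolutely_integrable_norm_diff:
  fixes h k :: "real \<Rightarrow> 'a::euclidean_space"
  assumes "h absolutely_integrable_on {a..b}" "k absolutely_integrable_on {a..b}"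
  shows "(\<lambda>r. norm (h r - k r)) integrable_on {a..b}"
  using set_integral_diff(1)[OF assms] by (simp add: absolutely_integrable_on_def)

text \<open>The projection onto the ball of radius \<open>M\<close> is used as a continuous truncation.\<close>
lemma closest_point_cball:
  fixes v :: "'a::euclidean_space"
  assumes "0 \<le> M"
  shows "norm (closest_point (cball 0 M) v) \<le> M" "norm (closest_point (cball 0 M) v) \<le> norm v"
    "norm v \<le> M \<Longrightarrow> closest_point (cball 0 M) v = v"
    "continuous_on S (closest_point (cball 0 M :: 'a set))"
proof -
  have "cball (0::'a) M \<noteq> {}" using assms by simp
  then show "norm (closest_point (cball 0 M) v) \<le> M" "norm (closest_point (cball 0 M) v) \<le> norm v"
    "continuous_on S (closest_point (cball 0 M :: 'a set))"
    using closest_point_in_set[of "cball 0 M" v] closest_point_lipschitz[of "cball 0 M" v 0] assms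
    by (auto simp: closest_point_self continuous_on_closest_point)
  show "closest_point (cball 0 M) v = v" if "norm v \<le> M"
    using that by (simp add: closest_point_self)
qed

lemma absolutely_integrable_closest_point_cball:
  fixes h :: "real \<Rightarrow> 'a::euclidean_space"
  assumes h: "h absolutely_integrable_on {a..b}" and M: "0 \<le> M"
  shows "(\<lambda>r. closest_point (cball 0 M) (h r)) absolutely_integrable_on {a..b}"
proof (rule measurable_bounded_by_integrable_imp_absolutely_integrable)
  show "{a..b} \<in> sets lebesgue" by simp
  have "closest_point (cball (0::'a) M) \<in> borel_measurable borel"
    by (rule borel_measurable_continuous_onI[OF closest_point_cball(4)[OF M]])
  then show "(\<lambda>r. closest_point (cball 0 M) (h r)) \<in> borel_measurable (lebesgue_on {a..b})"
    using measurable_compose[OF absolutely_integrable_imp_borel_measurable[OF h]] by simp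
  show "(\<lambda>r. norm (h r)) integrable_on {a..b}"
    using h by (simp add: absolutely_integrable_on_def)
qed (rule closest_point_cball(2)[OF M])

lemma bounded_dense_L1:
  fixes h :: "real \<Rightarrow> 'a::euclidean_space"
  assumes h: "h absolutely_integrable_on {a..b}" and e: "0 < e"
  obtains M where "0 \<le> M" "integral {a..b} (\<lambda>r. norm (h r - closest_point (cball 0 M) (h r))) < e"
proof -
  have norm_h: "(\<lambda>r. norm (h r)) integrable_on {a..b}"
    using h by (simp add: absolutely_integrable_on_def)
  have "(\<lambda>n. integral {a..b} (\<lambda>r. norm (h r - closest_point (cball 0 (real n)) (h r))))
      \<longlonglongrightarrow> integral {a..b} (\<lambda>r. 0::real)"
  proof (rule dominated_convergence(2)[where h = "\<lambda>r. 2 * norm (h r)"])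
    show "(\<lambda>r. norm (h r - closest_point (cball 0 (real n)) (h r))) integrable_on {a..b}" for n
      by (intro absolutely_integrable_norm_diff absolutely_integrable_closest_point_cball h) simp
    show "(\<lambda>r. 2 * norm (h r)) integrable_on {a..b}"
      using integrable_on_mult_right[OF norm_h, of 2] by simp
    show "norm (norm (h r - closest_point (cball 0 (real n)) (h r))) \<le> 2 * norm (h r)" for n r
      using norm_triangle_ineq4[of "h r" "closest_point (cball 0 (real n)) (h r)"]
        closest_point_cball(2)[of "real n" "h r"] by simp
    show "(\<lambda>n. norm (h r - closest_point (cball 0 (real n)) (h r))) \<longlonglongrightarrow> 0" for r
    proof (rule tendsto_eventually)
      obtain N :: nat where "norm (h r) \<le> real N" using real_arch_simple by blast
      then have "closest_point (cball 0 (real n)) (h r) = h r" if "N \<le> n" for n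
        using that by (intro closest_point_cball(3)) auto
      then show "\<forall>\<^sub>F n in sequentially. norm (h r - closest_point (cball 0 (real n)) (h r)) = 0"
        by (intro eventually_mono[OF eventually_ge_at_top[of N]]) simp
    qed
  qed
  from tendstoD[OF this e] obtain n
    where "\<bar>integral {a..b} (\<lambda>r. norm (h r - closest_point (cball 0 (real n)) (h r)))\<bar> < e"
    by (auto simp: dist_real_def dest: eventually_happens)
  then show ?thesis by (intro that[of "real n"]) auto
qed

lemma bounded_convergence_negligible:
  fixes f :: "nat \<Rightarrow> real \<Rightarrow> real"
  assumes N: "negligible N" and f: "\<And>n. f n integrable_on {a..b}" "\<And>n r. \<bar>f n r\<bar> \<le> C"
    and lim: "\<And>r. r \<in> {a..b} - N \<Longrightarrow> (\<lambda>n. f n r) \<longlonglongrightarrow> 0"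
  shows "(\<lambda>n. integral {a..b} (f n)) \<longlonglongrightarrow> 0"
proof -
  have "0 \<le> C" using f(2)[of 0 0] by simp
  have "(\<lambda>n. integral {a..b} (\<lambda>r. if r \<in> N then 0 else f n r)) \<longlonglongrightarrow> integral {a..b} (\<lambda>r. 0::real)"
  proof (rule dominated_convergence(2)[where h = "\<lambda>r. C"])
    show "(\<lambda>r. if r \<in> N then 0 else f n r) integrable_on {a..b}" for n
      by (rule integrable_spike[OF f(1) N]) auto
    show "norm (if r \<in> N then 0 else f n r) \<le> C" for n r
      using f(2) \<open>0 \<le> C\<close> by simp
    show "(\<lambda>n. if r \<in> N then 0 else f n r) \<longlonglongrightarrow> 0" if "r \<in> {a..b}" for r
      using lim that by (cases "r \<in> N") simp_all
  qed auto
  moreover have "integral {a..b} (\<lambda>r. if r \<in> N then 0 else f n r) = integral {a..b} (f n)" for n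
    by (rule integral_spike[OF N]) auto
  ultimately show ?thesis by simp
qed

lemma continuous_dense_L1_bounded:
  fixes h :: "real \<Rightarrow> 'a::euclidean_space"
  assumes h: "h absolutely_integrable_on {a..b}" and M: "0 \<le> M" "\<And>r. norm (h r) \<le> M" and e: "0 < e"
  obtains k where "continuous_on {a..b} k" "integral {a..b} (\<lambda>r. norm (h r - k r)) < e"
proof -
  have "h measurable_on {a..b}"
    using absolutely_integrable_imp_borel_measurable[OF h]
        measurable_on_iff_borel_measurable[of "{a..b}" h] by simp
  then obtain N g where N: "negligible N" and g: "\<And>n. continuous_on UNIV (g n)"
    and lim: "\<And>r. r \<notin> N \<Longrightarrow> (\<lambda>n. g n r) \<longlonglongrightarrow> (if r \<in> {a..b} then h r else 0)"
    unfolding measurable_on_def by blast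
  define k where "k n r = closest_point (cball 0 M) (g n r)" for n r
  have k: "continuous_on {a..b} (k n)" for n
    unfolding k_def[abs_def]
    by (rule continuous_on_compose2[OF closest_point_cball(4)[OF M(1)]
        continuous_on_subset[OF g]]) auto
  have integrable: "(\<lambda>r. norm (h r - k n r)) integrable_on {a..b}" for n
    by (rule absolutely_integrable_norm_diff[OF h absolutely_integrable_continuous_real[OF k]])
  have "(\<lambda>n. integral {a..b} (\<lambda>r. norm (h r - k n r))) \<longlonglongrightarrow> 0"
  proof (rule bounded_convergence_negligible[OF N integrable])
    show "\<bar>norm (h r - k n r)\<bar> \<le> 2 * M" for n r
      using norm_triangle_ineq4[of "h r" "k n r"] M(2)[of r]
          closest_point_cball(1)[OF M(1), of "g n r"]
      by (simp add: k_def)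
    fix r assume r: "r \<in> {a..b} - N"
    have "(\<lambda>n. k n r) \<longlonglongrightarrow> closest_point (cball 0 M) (h r)"
      unfolding k_def using lim[of r] r closest_point_cball(4)[OF M(1), of UNIV]
      by (auto simp: continuous_on_eq_continuous_at intro: isCont_tendsto_compose)
    then have "(\<lambda>n. norm (h r - k n r)) \<longlonglongrightarrow> norm (h r - h r)"
      unfolding closest_point_cball(3)[OF M] by (intro tendsto_intros)
    then show "(\<lambda>n. norm (h r - k n r)) \<longlonglongrightarrow> 0" by simp
  qed
  from tendstoD[OF this e] obtain n where "\<bar>integral {a..b} (\<lambda>r. norm (h r - k n r))\<bar> < e"
    by (auto simp: dist_real_def dest: eventually_happens)
  then show ?thesis by (intro that[OF k, of n]) auto
qed

lemma continuous_dense_L1: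
  fixes h :: "real \<Rightarrow> 'a::euclidean_space"
  assumes h: "h absolutely_integrable_on {a..b}" and e: "0 < e"
  obtains k where "continuous_on {a..b} k" "integral {a..b} (\<lambda>r. norm (h r - k r)) < e"
proof -
  obtain M where M: "0 \<le> M"
    "integral {a..b} (\<lambda>r. norm (h r - closest_point (cball 0 M) (h r))) < e / 2"
    using bounded_dense_L1[OF h, of "e / 2"] e by auto
  define h_M where "h_M r = closest_point (cball 0 M) (h r)" for r
  have h_M: "h_M absolutely_integrable_on {a..b}"
    unfolding h_M_def[abs_def] by (rule absolutely_integrable_closest_point_cball[OF h M(1)])
  obtain k where k: "continuous_on {a..b} k" "integral {a..b} (\<lambda>r. norm (h_M r - k r)) < e / 2"
    using continuous_dense_L1_bounded[OF h_M M(1), of "e / 2"] closest_point_cball(1)[OF M(1)] e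
    by (auto simp: h_M_def)
  note k_integrable = absolutely_integrable_continuous_real[OF k(1)]
  have "integral {a..b} (\<lambda>r. norm (h r - k r))
      \<le> integral {a..b} (\<lambda>r. norm (h r - h_M r) + norm (h_M r - k r))"
  proof (rule integral_le)
    show "norm (h r - k r) \<le> norm (h r - h_M r) + norm (h_M r - k r)" for r
      using norm_triangle_ineq[of "h r - h_M r" "h_M r - k r"] by simp
  qed (intro integrable_add absolutely_integrable_norm_diff h h_M k_integrable)+
  also have "\<dots> = integral {a..b} (\<lambda>r. norm (h r - h_M r))
      + integral {a..b} (\<lambda>r. norm (h_M r - k r))"
    by (intro integral_add absolutely_integrable_norm_diff h h_M k_integrable)
  also have "\<dots> < e" using M(2) k(2) by (simp add: h_M_def)
  finally show ?thesis using k(1) that by blast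
qed

lemma absolutely_integrable_inner_continuous:
  fixes x h :: "real \<Rightarrow> 'a::euclidean_space"
  assumes x: "continuous_on {a..b} x" and h: "h absolutely_integrable_on {a..b}"
  shows "(\<lambda>r. x r \<bullet> h r) absolutely_integrable_on {a..b}"
proof (rule absolutely_integrable_bounded_measurable_product[where h = "(\<bullet>)", OF _ _ _ _ h])
  show "bilinear ((\<bullet>) :: 'a \<Rightarrow> 'a \<Rightarrow> real)"
    by (rule bilinear_conv_bounded_bilinear[THEN iffD2, OF bounded_bilinear_inner])
  show "x \<in> borel_measurable (lebesgue_on {a..b})"
    by (rule continuous_imp_measurable_on_sets_lebesgue[OF x]) simp
  show "bounded (x ` {a..b})"
    by (intro compact_imp_bounded compact_continuous_image x compact_Icc)
qed simp

lemma continuous_on_primitive: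
  fixes h :: "real \<Rightarrow> 'a::euclidean_space"
  assumes "h absolutely_integrable_on {a..b}" shows "continuous_on {a..b} (\<lambda>r. integral {a..r} h)"
  using assms unfolding absolutely_integrable_on_def
  by (auto intro: indefinite_integral_continuous_1)

lemma arc_length_nonneg: "h absolutely_integrable_on {0..1} \<Longrightarrow> 0 \<le> arc_length h"
  unfolding arc_length_def absolutely_integrable_on_def by (auto intro: integral_nonneg)

lemma norm_primitive_le_arc_length:
  fixes h :: "real \<Rightarrow> 'a::euclidean_space"
  assumes h: "h absolutely_integrable_on {0..1}" and r: "r \<in> {0..1}"
  shows "norm (integral {0..r} h) \<le> arc_length h"
proof -
  have integrable: "h integrable_on {0..1}" "(\<lambda>r. norm (h r)) integrable_on {0..1}"
    using h by (auto simp: absolutely_integrable_on_def)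
  have "norm (integral {0..r} h) \<le> integral {0..r} (\<lambda>r. norm (h r))"
    by (intro integral_norm_bound_integral integrable[THEN integrable_subinterval_real])
       (use r in auto)
  also have "\<dots> \<le> arc_length h"
    by (rule integral_norm_le_arc_length(2)[OF integrable(2) r])
  finally show ?thesis .
qed

lemma primitive_diff:
  fixes h k :: "real \<Rightarrow> 'a::euclidean_space"
  assumes "h absolutely_integrable_on {0..1}" "k absolutely_integrable_on {0..1}" "r \<in> {0..1}"
  shows "integral {0..r} (\<lambda>s. h s - k s) = integral {0..r} h - integral {0..r} k"
  using assms
  by (intro integral_diff)
     (auto simp: absolutely_integrable_on_def intro: integrable_subinterval_real)

lemma arc_length_triangle:
  fixes h k :: "real \<Rightarrow> 'a::euclidean_space"
  assumes h: "h absolutely_integrable_on {0..1}" and k: "k absolutely_integrable_on {0..1}"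
  shows "arc_length k \<le> arc_length h + arc_length (\<lambda>r. h r - k r)"
proof -
  have integrable: "(\<lambda>r. norm (h r)) integrable_on {0..1}" "(\<lambda>r. norm (k r)) integrable_on {0..1}"
    using h k by (auto simp: absolutely_integrable_on_def)
  note diff_integrable = absolutely_integrable_norm_diff[OF h k]
  have "arc_length k \<le> integral {0..1} (\<lambda>r. norm (h r) + norm (h r - k r))"
    unfolding arc_length_def
  proof (rule integral_le[OF integrable(2) integrable_add[OF integrable(1) diff_integrable]])
    show "norm (k r) \<le> norm (h r) + norm (h r - k r)" for r
      using norm_triangle_ineq4[of "h r" "h r - k r"] by simp
  qed
  also have "\<dots> = arc_length h + arc_length (\<lambda>r. h r - k r)"
    unfolding arc_length_def by (rule integral_add[OF integrable(1) diff_integrable])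
  finally show ?thesis .
qed

lemma swept_integrable:
  fixes h k :: "real \<Rightarrow> 'a::euclidean_space"
  assumes "h absolutely_integrable_on {0..1}" "k absolutely_integrable_on {0..1}"
  shows "(\<lambda>r. 2 * ((A \<bullet>\<^sub>v integral {0..r} h) \<bullet> k r)) integrable_on {0..1}"
proof -
  have "continuous_on {0..1} (\<lambda>r. A \<bullet>\<^sub>v integral {0..r} h)"
    by (intro app.continuous_on continuous_on_const continuous_on_primitive[OF assms(1)])
  from absolutely_integrable_inner_continuous[OF this assms(2)] show ?thesis
    by (simp add: absolutely_integrable_on_def integrable_on_mult_right)
qed

lemma abs_swept_le:
  fixes h k :: "real \<Rightarrow> 'a::euclidean_space"
  assumes h: "h absolutely_integrable_on {0..1}" and k: "k absolutely_integrable_on {0..1}"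
  shows "\<bar>swept A h k\<bar> \<le> 2 * norm A * arc_length h * arc_length k"
proof -
  have "norm (swept A h k) \<le> integral {0..1} (\<lambda>r. 2 * norm A * arc_length h * norm (k r))"
    unfolding swept_def
  proof (rule integral_norm_bound_integral[OF swept_integrable[OF h k]])
    show "(\<lambda>r. 2 * norm A * arc_length h * norm (k r)) integrable_on {0..1}"
      using k by (intro integrable_on_mult_right) (simp add: absolutely_integrable_on_def)
    fix r :: real assume r: "r \<in> {0..1}"
    have "\<bar>(A \<bullet>\<^sub>v integral {0..r} h) \<bullet> k r\<bar> \<le> norm (A \<bullet>\<^sub>v integral {0..r} h) * norm (k r)"
      by (rule Cauchy_Schwarz_ineq2)
    also have "\<dots> \<le> norm A * arc_length h * norm (k r)"
      using r h by (intro mult_right_mono order_trans[OF norm_app_le] mult_left_mono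
          norm_primitive_le_arc_length) auto
    finally show "norm (2 * ((A \<bullet>\<^sub>v integral {0..r} h) \<bullet> k r))
        \<le> 2 * norm A * arc_length h * norm (k r)"
      by (simp add: abs_mult)
  qed
  then show ?thesis by (simp add: arc_length_def)
qed

lemma swept_diff:
  fixes h k :: "real \<Rightarrow> 'a::euclidean_space"
  assumes h: "h absolutely_integrable_on {0..1}" and k: "k absolutely_integrable_on {0..1}"
  shows "swept A h h - swept A k k = swept A h (\<lambda>r. h r - k r) + swept A (\<lambda>r. h r - k r) k"
proof -
  note hk = set_integral_diff(1)[OF h k]
  have "swept A h h - swept A k k
      = integral {0..1} (\<lambda>r. 2 * ((A \<bullet>\<^sub>v integral {0..r} h) \<bullet> h r)
          - 2 * ((A \<bullet>\<^sub>v integral {0..r} k) \<bullet> k r))"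
    unfolding swept_def by (intro integral_diff[symmetric] swept_integrable h k)
  also have "\<dots> = integral {0..1} (\<lambda>r. 2 * ((A \<bullet>\<^sub>v integral {0..r} h) \<bullet> (h r - k r))
      + 2 * ((A \<bullet>\<^sub>v integral {0..r} (\<lambda>r. h r - k r)) \<bullet> k r))"
    by (intro integral_cong)
       (simp add: primitive_diff[OF h k] app.diff_right inner_diff_left inner_diff_right
         algebra_simps)
  also have "\<dots> = swept A h (\<lambda>r. h r - k r) + swept A (\<lambda>r. h r - k r) k"
    unfolding swept_def by (intro integral_add swept_integrable h k hk)
  finally show ?thesis .
qed

lemma tendsto_phi_along:
  fixes h :: "real \<Rightarrow> 'a::euclidean_space"
  assumes h: "h absolutely_integrable_on {0..1}" and k: "\<And>n. k n absolutely_integrable_on {0..1}"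
    and lim: "(\<lambda>n. arc_length (\<lambda>r. h r - k n r)) \<longlonglongrightarrow> 0"
  shows "(\<lambda>n. phi_along A (k n)) \<longlonglongrightarrow> phi_along A h"
  unfolding phi_along_def
proof (intro tendsto_intros app.tendsto)
  let ?d = "\<lambda>n. arc_length (\<lambda>r. h r - k n r)"
  note hk = set_integral_diff(1)[OF h k]
  have "norm (integral {0..1} h - integral {0..1} (k n)) \<le> ?d n" for n
    using norm_primitive_le_arc_length[OF hk, of 1] by (simp add: primitive_diff[OF h k])
  then have "(\<lambda>n. integral {0..1} h - integral {0..1} (k n)) \<longlonglongrightarrow> 0"
    by (intro Lim_null_comparison[OF _ lim] always_eventually allI)
  from tendsto_diff[OF tendsto_const[of "integral {0..1} h"] this]
  show "(\<lambda>n. integral {0..1} (k n)) \<longlonglongrightarrow> integral {0..1} h"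
    "(\<lambda>n. integral {0..1} (k n)) \<longlonglongrightarrow> integral {0..1} h" by simp_all
  have norm_le: "norm (swept A h h - swept A (k n) (k n))
      \<le> 2 * norm A * arc_length h * ?d n + 2 * norm A * ?d n * (arc_length h + ?d n)" for n
  proof -
    have "\<bar>swept A (\<lambda>r. h r - k n r) (k n)\<bar> \<le> 2 * norm A * ?d n * (arc_length h + ?d n)"
      using arc_length_triangle[OF h k, of n] arc_length_nonneg[OF hk, of n]
      by (intro order_trans[OF abs_swept_le[OF hk k]] mult_left_mono) auto
    then show ?thesis
      using abs_swept_le[OF h hk, of A n] unfolding swept_diff[OF h k] by simp
  qed
  have "(\<lambda>n. 2 * norm A * arc_length h * ?d n + 2 * norm A * ?d n * (arc_length h + ?d n))
      \<longlonglongrightarrow> 2 * norm A * arc_length h * 0 + 2 * norm A * 0 * (arc_length h + 0)"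
    by (intro tendsto_intros lim)
  then have "(\<lambda>n. swept A h h - swept A (k n) (k n)) \<longlonglongrightarrow> 0"
    by (intro Lim_null_comparison[OF always_eventually[OF allI[OF norm_le]]]) simp
  from tendsto_diff[OF tendsto_const[of "swept A h h"] this]
  show "(\<lambda>n. swept A (k n) (k n)) \<longlonglongrightarrow> swept A h h"
    by simp
qed

lemma phi_along_le_length_sq:
  fixes h :: "real \<Rightarrow> 'a::euclidean_space"
  assumes skew: "is_adjoint A (- A)" and A: "norm A < pi" and h: "h absolutely_integrable_on {0..1}"
  shows "phi_along A h \<le> (arc_length h)\<^sup>2"
proof -
  have "\<exists>k. continuous_on {0..1} k \<and> arc_length (\<lambda>r. h r - k r) < inverse (real (Suc n))" for n
    using continuous_dense_L1[OF h, of "inverse (real (Suc n))"] unfolding arc_length_def by auto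
  then obtain k where k: "\<And>n. continuous_on {0..1} (k n)"
    and k_near: "\<And>n. arc_length (\<lambda>r. h r - k n r) < inverse (real (Suc n))" by metis
  note k_integrable = absolutely_integrable_continuous_real[OF k]
  have d_nonneg: "0 \<le> arc_length (\<lambda>r. h r - k n r)" for n
    by (rule arc_length_nonneg[OF set_integral_diff(1)[OF h k_integrable]])
  have lim: "(\<lambda>n. arc_length (\<lambda>r. h r - k n r)) \<longlonglongrightarrow> 0"
    by (rule Lim_null_comparison[OF _ LIMSEQ_inverse_real_of_nat])
       (use k_near d_nonneg in \<open>auto intro!: always_eventually simp: less_imp_le\<close>)
  have "phi_along A (k n) \<le> (arc_length h + arc_length (\<lambda>r. h r - k n r))\<^sup>2" for n
    using phi_along_le_length_sq_continuous[OF skew A k, of n]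
      power_mono[OF arc_length_triangle[OF h k_integrable] arc_length_nonneg[OF k_integrable],
        of n 2]
    by simp
  moreover have "(\<lambda>n. (arc_length h + arc_length (\<lambda>r. h r - k n r))\<^sup>2) \<longlonglongrightarrow> (arc_length h + 0)\<^sup>2"
    by (intro tendsto_intros lim)
  ultimately show ?thesis
    using LIMSEQ_le[OF tendsto_phi_along[OF h k_integrable lim]] by simp
qed

subsection \<open>Smooth inverse and implicit functions\<close>

lemma Ck_on_endo_of:
  fixes f' :: "'a::euclidean_space \<Rightarrow> 'b::euclidean_space \<Rightarrow> 'b"
  assumes "open S" and linear: "\<And>x. x \<in> S \<Longrightarrow> linear (f' x)" and f': "\<And>v. Ck_on k S (\<lambda>x. f' x v)"
  shows "Ck_on k S (\<lambda>x. endo_of (f' x))"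
proof -
  define E where "E b c = endo_of (\<lambda>v::'b. (v \<bullet> b) *\<^sub>R c)" for b c :: 'b
  have app_E: "E b c \<bullet>\<^sub>v v = (v \<bullet> b) *\<^sub>R c" for b c v
    unfolding E_def
    by (rule app_endo_of) (auto intro!: linearI simp: inner_add_left scaleR_add_left)
  have "Ck_on k S (\<lambda>x. \<Sum>b\<in>Basis. \<Sum>c\<in>Basis. (f' x b \<bullet> c) *\<^sub>R E b c)"
    by (intro Ck_on_sum finite_Basis Ck_on_bounded_linear_compose[OF bounded_linear_scaleR_left]
        Ck_on_bounded_linear_compose[OF bounded_linear_inner_left] f')
  moreover have "(\<Sum>b\<in>Basis. \<Sum>c\<in>Basis. (f' x b \<bullet> c) *\<^sub>R E b c) = endo_of (f' x)" if "x \<in> S" for x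
  proof (rule endo_eqI)
    fix v
    have "(\<Sum>b\<in>Basis. \<Sum>c\<in>Basis. (f' x b \<bullet> c) *\<^sub>R E b c) \<bullet>\<^sub>v v
        = (\<Sum>b\<in>Basis. (v \<bullet> b) *\<^sub>R (\<Sum>c\<in>Basis. (f' x b \<bullet> c) *\<^sub>R c))"
      by (simp add: app.sum_left app.scaleR_left app_E scaleR_sum_right mult.commute
          del: euclidean_representation)
    also have "\<dots> = f' x v"
      unfolding euclidean_representation
      by (rule linear_eq_sum_Basis[OF linear[OF that], symmetric])
    finally show "(\<Sum>b\<in>Basis. \<Sum>c\<in>Basis. (f' x b \<bullet> c) *\<^sub>R E b c) \<bullet>\<^sub>v v = endo_of (f' x) \<bullet>\<^sub>v v"
      by (simp add: app_endo_of[OF linear[OF that]])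
  qed
  ultimately show ?thesis by (rule Ck_on_cong[OF assms(1)])
qed

lemma Ck_on_inv_linear:
  fixes f' :: "'a::euclidean_space \<Rightarrow> 'b::euclidean_space \<Rightarrow> 'b"
  assumes S: "open S" and linear: "\<And>x. x \<in> S \<Longrightarrow> linear (f' x)" and bij: "\<And>x. x \<in> S \<Longrightarrow> bij (f' x)"
    and f': "\<And>k v. Ck_on k S (\<lambda>x. f' x v)"
  shows "Ck_on k S (\<lambda>x. inv (f' x) v)"
proof -
  have linear_inv: "linear (inv (f' x))" if "x \<in> S" for x
    using inj_linear_imp_inv_linear linear bij that by (blast dest: bij_is_inj)
  have "inverse_functions (\<lambda>x. endo_of (f' x)) (\<lambda>x. endo_of (inv (f' x))) S"
  proof (unfold_locales, rule S)
    fix x assume x: "x \<in> S"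
    show "endo_of (f' x) * endo_of (inv (f' x)) = 1" "endo_of (inv (f' x)) * endo_of (f' x) = 1"
      using bij[OF x]
      by (auto intro!: endo_eqI simp: app_endo_of[OF linear[OF x]] app_endo_of[OF linear_inv[OF x]]
          bij_is_surj surj_f_inv_f bij_is_inj inv_f_f)
  qed
  then have "Ck_on k S (\<lambda>x. endo_of (inv (f' x)))"
    by (rule Ck_on_algebra_inverse) (intro Ck_on_endo_of S linear f')
  then have "Ck_on k S (\<lambda>x. endo_of (inv (f' x)) \<bullet>\<^sub>v v)"
    by (rule Ck_on_bounded_linear_compose[OF app.bounded_linear_left])
  then show ?thesis
    by (rule Ck_on_cong[OF S]) (simp add: app_endo_of[OF linear_inv])
qed

lemma Ck_on_inverse_function:
  fixes g :: "'a::euclidean_space \<Rightarrow> 'a"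
  assumes "continuous_on V g"
    and g: "g ` V \<subseteq> U" "\<And>y. y \<in> V \<Longrightarrow> (g has_derivative inv (f' (g y))) (at y)"
    and inv_f': "\<And>k v. Ck_on k U (\<lambda>x. inv (f' x) v)"
  shows "Ck_on k V g"
proof (induction k)
  case 0
  show ?case using assms(1) by simp
next
  case (Suc k)
  show ?case
    by (intro Ck_on_SucI[OF g(2)] Ck_on_compose[OF inv_f' Suc g(1)])
qed

lemma C1_local_inverse:
  fixes f :: "'a::euclidean_space \<Rightarrow> 'a"
  assumes W: "open W" "x0 \<in> W" and f': "\<And>x. x \<in> W \<Longrightarrow> (f has_derivative f' x) (at x)"
    and continuous: "\<And>v. continuous_on W (\<lambda>x. f' x v)" and inj: "inj (f' x0)"
  obtains U V g where "open U" "U \<subseteq> W" "open V" "f x0 \<in> V" "homeomorphism U V f g"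
    "\<And>y. y \<in> V \<Longrightarrow> (g has_derivative inv (f' (g y))) (at y)" "\<And>x. x \<in> U \<Longrightarrow> bij (f' x)"
proof -
  have linear: "linear (f' x)" if "x \<in> W" for x
    using f'[OF that] by (rule has_derivative_linear)
  define F' where "F' x = endo_blinfun (endo_of (f' x))" for x
  have F': "blinfun_apply (F' x) = f' x" if "x \<in> W" for x
    using app_endo_of[OF linear[OF that]] by (auto simp: F'_def app.rep_eq)
  have "Ck_on 0 W (\<lambda>x. endo_of (f' x))"
    by (rule Ck_on_endo_of[OF W(1) linear]) (simp_all add: continuous)
  then have cont_F': "continuous_on W F'"
    by (simp add: F'_def continuous_on_iff dist_endo_blinfun)
  obtain l where l: "linear l" "l \<circ> f' x0 = id"
    using linear_injective_left_inverse[OF linear[OF W(2)] inj] by blast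
  then have "Blinfun l o\<^sub>L F' x0 = id_blinfun"
    by (intro blinfun_eqI)
       (simp add: bounded_linear_Blinfun_apply linear_conv_bounded_linear F'[OF W(2)] o_def
         fun_eq_iff)
  moreover have "(f has_derivative blinfun_apply (F' x)) (at x)" if "x \<in> W" for x
    using f'[OF that] F'[OF that] by simp
  ultimately
  obtain U V g g' where inverse: "open U" "U \<subseteq> W" "open V" "f x0 \<in> V" "homeomorphism U V f g"
    "\<And>y. y \<in> V \<Longrightarrow> (g has_derivative (g' y)) (at y)"
    "\<And>y. y \<in> V \<Longrightarrow> g' y = inv (blinfun_apply (F' (g y)))"
    "\<And>y. y \<in> V \<Longrightarrow> bij (blinfun_apply (F' (g y)))"
    using inverse_function_theorem[OF W(1) _ cont_F' W(2)] by metis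
  have UV: "x \<in> U \<Longrightarrow> f x \<in> V \<and> g (f x) = x" "y \<in> V \<Longrightarrow> g y \<in> U" for x y
    using inverse(5) by (auto simp: homeomorphism_def)
  show ?thesis
  proof (rule that[OF inverse(1-5)])
    show "(g has_derivative inv (f' (g y))) (at y)" if "y \<in> V" for y
      using inverse(6,7)[OF that] UV(2)[OF that] inverse(2) F' by auto
    show "bij (f' x)" if "x \<in> U" for x
      using inverse(8)[of "f x"] UV(1)[OF that] inverse(2) F' that by auto
  qed
qed

lemma smooth_local_inverse:
  fixes f :: "'a::euclidean_space \<Rightarrow> 'a"
  assumes W: "open W" "x0 \<in> W" and f: "\<And>k. Ck_on k W f"
    and derivative: "(f has_derivative f0') (at x0)" "inj f0'"
  obtains V g where "open V" "f x0 \<in> V" "\<And>y. y \<in> V \<Longrightarrow> g y \<in> W \<and> f (g y) = y" "\<And>k. Ck_on k V g"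
proof -
  define f' where "f' x = frechet_derivative f (at x)" for x
  have f': "(f has_derivative f' x) (at x)" if "x \<in> W" for x
    unfolding f'_def by (rule Ck_on_frechet_derivative(1)[OF W(1) f that])
  have Ck_f': "Ck_on k W (\<lambda>x. f' x v)" for k v
    unfolding f'_def by (rule Ck_on_frechet_derivative(2)[OF W(1) f])
  have "inj (f' x0)"
    using has_derivative_unique[OF derivative(1) f'[OF W(2)]] derivative(2) by simp
  from C1_local_inverse[OF W f' Ck_on_imp_continuous_on[OF Ck_f'] this]
  obtain U V g where UV: "open U" "U \<subseteq> W" "open V" "f x0 \<in> V" "homeomorphism U V f g"
    and g': "\<And>y. y \<in> V \<Longrightarrow> (g has_derivative inv (f' (g y))) (at y)" and bij: "\<And>x. x \<in> U \<Longrightarrow> bij (f' x)"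
    by metis
  have g: "continuous_on V g" "g ` V \<subseteq> U" "\<And>y. y \<in> V \<Longrightarrow> f (g y) = y"
    using UV(5) by (auto simp: homeomorphism_def)
  have inv_f': "Ck_on k U (\<lambda>x. inv (f' x) v)" for k v
  proof (rule Ck_on_inv_linear[OF UV(1) _ bij Ck_on_subset[OF Ck_f' UV(2)]])
    show "linear (f' x)" if "x \<in> U" for x
      using f' that UV(2) has_derivative_linear by blast
  qed
  have "Ck_on k V g" for k
    by (rule Ck_on_inverse_function[OF g(1,2) g' inv_f'])
  then show ?thesis
    using that[OF UV(3,4)] g(2,3) UV(2) by blast
qed

lemma has_derivative_compose_Pair:
  assumes "(F has_derivative D) (at (x, y))"
  shows "((\<lambda>y. F (x, y)) has_derivative (\<lambda>h. D (0, h))) (at y)"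
  by (rule has_derivative_compose[of "Pair x" "Pair 0", OF _ assms])
     (auto intro!: derivative_eq_intros)

lemma inj_Pair_fst:
  fixes D :: "'a::real_vector \<times> 'b::real_vector \<Rightarrow> 'c::real_vector"
  assumes "linear D" and inj: "inj (\<lambda>h. D (0, h))"
  shows "inj (\<lambda>v. (fst v, D v))"
proof (rule injI)
  fix v w assume eq: "(fst v, D v) = (fst w, D w)"
  then have "(0, snd (v - w)) = v - w" by (simp add: prod_eq_iff)
  then have "D (0, snd (v - w)) = D (0, 0)"
    using eq linear_0[OF \<open>linear D\<close>] by (simp add: linear_diff[OF \<open>linear D\<close>] flip: zero_prod_def)
  then have "snd (v - w) = 0" using injD[OF inj] by blast
  then show "v = w" using eq by (simp add: prod_eq_iff)
qed

lemma smooth_implicit_function: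
  fixes F :: "'a::euclidean_space \<times> 'b::euclidean_space \<Rightarrow> 'b"
  assumes W: "open W" "(x0, y0) \<in> W" and F: "\<And>k. Ck_on k W F"
    and H: "((\<lambda>y. F (x0, y)) has_derivative H) (at y0)" "inj H"
  obtains V \<theta> where "open V" "(x0, F (x0, y0)) \<in> V" "\<And>k. Ck_on k V \<theta>"
    "\<And>p. p \<in> V \<Longrightarrow> (fst p, \<theta> p) \<in> W \<and> F (fst p, \<theta> p) = snd p"
proof -
  define \<Psi> where "\<Psi> p = (fst p, F p)" for p
  have \<Psi>: "Ck_on k W \<Psi>" for k
    unfolding \<Psi>_def[abs_def] by (intro Ck_on_Pair Ck_on_bounded_linear[OF bounded_linear_fst] F)
  define D where "D = frechet_derivative F (at (x0, y0))"
  have D: "(F has_derivative D) (at (x0, y0))"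
    unfolding D_def by (rule Ck_on_frechet_derivative(1)[OF W(1) F W(2)])
  then have H_eq: "H = (\<lambda>h. D (0, h))"
    by (intro has_derivative_unique[OF H(1)] has_derivative_compose_Pair)
  have \<Psi>': "(\<Psi> has_derivative (\<lambda>v. (fst v, D v))) (at (x0, y0))"
    unfolding \<Psi>_def[abs_def]
    by (intro has_derivative_Pair has_derivative_fst has_derivative_ident D)
  have "inj (\<lambda>v. (fst v, D v))"
    using inj_Pair_fst[OF has_derivative_linear[OF D]] H(2) by (simp add: H_eq)
  from smooth_local_inverse[OF W \<Psi> \<Psi>' this]
  obtain V G where V: "open V" "\<Psi> (x0, y0) \<in> V"
    and G: "\<And>p. p \<in> V \<Longrightarrow> G p \<in> W \<and> \<Psi> (G p) = p" "\<And>k. Ck_on k V G"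
    by metis
  show ?thesis
  proof (rule that[OF V(1), of "\<lambda>p. snd (G p)"])
    show "(x0, F (x0, y0)) \<in> V" using V(2) by (simp add: \<Psi>_def)
    show "Ck_on k V (\<lambda>p. snd (G p))" for k
      by (rule Ck_on_bounded_linear_compose[OF bounded_linear_snd G(2)])
    fix p assume "p \<in> V"
    then have "G p = (fst p, snd (G p))" "F (G p) = snd p" "G p \<in> W"
      using G(1)[of p] by (auto simp: \<Psi>_def prod_eq_iff)
    then show "(fst p, snd (G p)) \<in> W \<and> F (fst p, snd (G p)) = snd p" by metis
  qed
qed

subsection \<open>Geodesics and the distance\<close>

locale skew_family =
  fixes U :: "'m::finite \<Rightarrow> real^'q::finite^'q"
  assumes skew: "\<And>j. transpose (U j) = - U j"
begin

abbreviation J :: "real^'m \<Rightarrow> (real^'q) endo" where "J \<equiv> pencil U"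

abbreviation \<Omega> :: "(real^'m) set" where "\<Omega> \<equiv> Omega_star U"

lemma is_adjoint_J: "is_adjoint (J \<tau>) (- J \<tau>)"
  unfolding is_adjoint_def by (simp add: pencil_skew[OF skew] app.minus_left)

lemma continuous_on_J: "continuous_on S J"
  by (rule linear_continuous_on[OF bounded_linear_pencil])

lemma open_Omega: "open \<Omega>"
proof -
  have "\<Omega> = {\<tau>. norm (J \<tau>) < pi}" by (auto simp: mem_Omega_star_iff)
  then show ?thesis
    by (simp add: open_Collect_less continuous_on_norm continuous_on_J)
qed

definition geod_vel :: "real^'q \<Rightarrow> real^'m \<Rightarrow> real \<Rightarrow> real^'q" where
  "geod_vel \<zeta> \<tau> r = exp ((2 * r) *\<^sub>R J \<tau>) \<bullet>\<^sub>v \<zeta>"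

definition geod_end :: "real^'q \<Rightarrow> real^'m \<Rightarrow> (real^'q) \<times> (real^'m)" where
  "geod_end \<zeta> \<tau> = (exp_mean (J \<tau>) \<bullet>\<^sub>v \<zeta>, ht U (geod_vel \<zeta> \<tau>) 1)"

lemma continuous_on_exp_J:
  assumes "continuous_on S f" "continuous_on S g"
  shows "continuous_on S (\<lambda>x. exp ((2 * f x) *\<^sub>R J (g x)))"
proof -
  have "continuous_on UNIV (\<lambda>\<tau>. exp (2 *\<^sub>R J \<tau>))"
    using Ck_on_fps_calc[OF bounded_linear_pencil, of "fps_exp 2" 0 U] by simp
  then have "continuous_on S (\<lambda>x. exp (2 *\<^sub>R J (f x *\<^sub>R g x)))"
    by (rule continuous_on_compose2) (auto intro!: continuous_intros assms)
  then show ?thesis by (simp add: pencil_scaleR)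
qed

lemma Ck_on_exp_mean_J: "Ck_on k UNIV (\<lambda>\<tau>. exp_mean (J \<tau>))"
  unfolding exp_mean_def by (rule Ck_on_fps_calc[OF bounded_linear_pencil]) simp

lemma continuous_on_exp_mean_J: "continuous_on S g \<Longrightarrow> continuous_on S (\<lambda>x. exp_mean (J (g x)))"
  by (rule continuous_on_compose2[OF Ck_on_imp_continuous_on[OF Ck_on_exp_mean_J]]) auto

lemma continuous_on_geod_vel:
  assumes "continuous_on S f" "continuous_on S g" "continuous_on S r"
  shows "continuous_on S (\<lambda>x. geod_vel (f x) (g x) (r x))"
  unfolding geod_vel_def by (intro app.continuous_on continuous_on_exp_J assms)

lemma geod_vel_integrable: "geod_vel \<zeta> \<tau> absolutely_integrable_on {0..1}"
  by (intro absolutely_integrable_continuous_real continuous_on_geod_vel continuous_intros)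

lemma hx_geod_vel:
  assumes "0 \<le> s" shows "hx (geod_vel \<zeta> \<tau>) s = (s *\<^sub>R exp_mean (s *\<^sub>R J \<tau>)) \<bullet>\<^sub>v \<zeta>"
proof -
  have "((\<lambda>s. (s *\<^sub>R exp_mean (s *\<^sub>R J \<tau>)) \<bullet>\<^sub>v \<zeta>) has_vector_derivative
      geod_vel \<zeta> \<tau> r) (at r within {0..s})" for r
    unfolding geod_vel_def
    by (rule bounded_linear.has_vector_derivative[OF app.bounded_linear_left
          has_vector_derivative_at_within[OF scaleR_exp_mean_has_derivative]])
  then have "(geod_vel \<zeta> \<tau> has_integral
      (s *\<^sub>R exp_mean (s *\<^sub>R J \<tau>)) \<bullet>\<^sub>v \<zeta> - (0 *\<^sub>R exp_mean (0 *\<^sub>R J \<tau>)) \<bullet>\<^sub>v \<zeta>) {0..s}"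
    by (intro fundamental_theorem_of_calculus[OF assms])
  then show ?thesis unfolding hx_def by (simp add: integral_unique app.zero_left)
qed

lemma geod_end_eq: "(hx (geod_vel \<zeta> \<tau>) 1, ht U (geod_vel \<zeta> \<tau>) 1) = geod_end \<zeta> \<tau>"
  by (simp add: geod_end_def hx_geod_vel)

lemma arc_length_geod_vel: "arc_length (geod_vel \<zeta> \<tau>) = norm \<zeta>"
  unfolding arc_length_def geod_vel_def by (simp add: norm_exp_skew[OF is_adjoint_J])

lemma inner_ht_eq_swept:
  assumes h: "h absolutely_integrable_on {0..1}"
  shows "4 * (ht U h 1 \<bullet> \<tau>) = swept (J \<tau>) h h"
proof -
  define f where "f r = (1/2) *\<^sub>R (\<chi> j. (U j *v hx h r) \<bullet> h r)" for r
  have "continuous_on {0..1} (\<lambda>r. U j *v hx h r)" for j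
    unfolding hx_def
    by (rule bounded_linear.continuous_on[OF matrix_vector_mul_bounded_linear
        continuous_on_primitive[OF h]])
  then have "(\<lambda>r. (U j *v hx h r) \<bullet> h r) integrable_on {0..1}" for j
    using absolutely_integrable_inner_continuous[OF _ h] absolutely_integrable_on_def by blast
  then have "f integrable_on {0..1}"
    unfolding f_def
    by (intro integrable_cmul, subst integrable_componentwise_iff)
       (auto simp: Basis_vec_def inner_axis)
  then have "integral {0..1} (\<lambda>r. f r \<bullet> (4 *\<^sub>R \<tau>)) = integral {0..1} f \<bullet> (4 *\<^sub>R \<tau>)"
    using integral_linear[OF _ bounded_linear_inner_left[of "4 *\<^sub>R \<tau>"], of f "{0..1}"]
    by (simp add: o_def)
  moreover have "f r \<bullet> (4 *\<^sub>R \<tau>) = 2 * ((J \<tau> \<bullet>\<^sub>v integral {0..r} h) \<bullet> h r)" for r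
    unfolding f_def hx_def app_pencil
    by (simp add: inner_vec_def[of _ \<tau>] inner_sum_left sum_distrib_left mult.commute)
  then have "swept (J \<tau>) h h = integral {0..1} (\<lambda>r. f r \<bullet> (4 *\<^sub>R \<tau>))"
    by (simp only: swept_def)
  moreover have "ht U h 1 = integral {0..1} f" by (simp only: ht_def f_def[abs_def])
  ultimately show ?thesis by simp
qed

lemma phi_eq_phi_along:
  assumes "\<tau> \<in> \<Omega>" "h absolutely_integrable_on {0..1}"
  shows "phi U (hx h 1, ht U h 1) \<tau> = phi_along (J \<tau>) h"
  by (simp add: phi_eq[OF skew assms(1)] phi_along_def inner_ht_eq_swept[OF assms(2)] hx_def)

lemma phi_le_arc_length_sq:
  assumes "\<tau> \<in> \<Omega>" "h absolutely_integrable_on {0..1}"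
  shows "phi U (hx h 1, ht U h 1) \<tau> \<le> (arc_length h)\<^sup>2"
  using phi_along_le_length_sq[OF is_adjoint_J _ assms(2)] assms(1)
  by (simp add: phi_eq_phi_along[OF assms] mem_Omega_star_iff)

lemma swept_geod_vel:
  "swept (J \<tau>) (geod_vel \<zeta> \<tau>) (geod_vel \<zeta> \<tau>) = (norm \<zeta>)\<^sup>2 - \<zeta> \<bullet> (exp_mean (J \<tau>) \<bullet>\<^sub>v \<zeta>)"
proof -
  define h where "h = geod_vel \<zeta> \<tau>"
  have "2 * ((J \<tau> \<bullet>\<^sub>v hx h r) \<bullet> h r) = (norm \<zeta>)\<^sup>2 - \<zeta> \<bullet> h r" if "r \<in> {0..1}" for r
  proof -
    have "2 *\<^sub>R (J \<tau> \<bullet>\<^sub>v hx h r) = (2 *\<^sub>R ((r *\<^sub>R J \<tau>) * exp_mean (r *\<^sub>R J \<tau>))) \<bullet>\<^sub>v \<zeta>"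
      using that by (simp add: h_def hx_geod_vel app.scaleR_left app.scaleR_right)
    also have "\<dots> = h r - \<zeta>"
      unfolding mult_exp_mean by (simp add: app.diff_left h_def geod_vel_def)
    finally have "2 * ((J \<tau> \<bullet>\<^sub>v hx h r) \<bullet> h r) = (h r - \<zeta>) \<bullet> h r"
      by (metis inner_scaleR_left)
    then show ?thesis
      using norm_exp_skew[OF is_adjoint_J, of "2 * r" \<tau> \<zeta>]
      by (simp add: inner_diff_left h_def geod_vel_def flip: power2_norm_eq_inner)
  qed
  then have "swept (J \<tau>) h h = integral {0..1} (\<lambda>r. (norm \<zeta>)\<^sup>2 - \<zeta> \<bullet> h r)"
    unfolding swept_def hx_def by (intro integral_cong) auto
  also have "\<dots> = (norm \<zeta>)\<^sup>2 - integral {0..1} (\<lambda>r. \<zeta> \<bullet> h r)"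
    unfolding h_def
    by (subst integral_diff)
       (auto intro!: integrable_continuous_real continuous_intros continuous_on_geod_vel)
  also have "integral {0..1} (\<lambda>r. \<zeta> \<bullet> h r) = \<zeta> \<bullet> hx h 1"
    using integral_linear[OF _ bounded_linear_inner_right[of \<zeta>], of h "{0..1}"]
        geod_vel_integrable[of \<zeta> \<tau>]
    by (simp add: hx_def h_def o_def absolutely_integrable_on_def)
  finally show ?thesis by (simp add: h_def hx_geod_vel)
qed

lemma phi_geod_end:
  assumes "\<tau> \<in> \<Omega>" shows "phi U (geod_end \<zeta> \<tau>) \<tau> = (norm \<zeta>)\<^sup>2"
proof -
  have "exp_mean_inv (J \<tau>) \<bullet>\<^sub>v exp_mean (J \<tau>) \<bullet>\<^sub>v \<zeta> = \<zeta>"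
    by (metis app_mult app_one exp_mean_left_inverse assms mem_Omega_star_iff)
  moreover have "integral {0..1} (geod_vel \<zeta> \<tau>) = exp_mean (J \<tau>) \<bullet>\<^sub>v \<zeta>"
    using hx_geod_vel[of 1] by (simp add: hx_def)
  ultimately show ?thesis
    unfolding geod_end_eq[symmetric] phi_eq_phi_along[OF assms geod_vel_integrable]
    by (simp add: phi_along_def swept_geod_vel)
qed

lemma phi_geod_end_le: "\<sigma> \<in> \<Omega> \<Longrightarrow> phi U (geod_end \<zeta> \<tau>) \<sigma> \<le> (norm \<zeta>)\<^sup>2"
  using phi_le_arc_length_sq[OF _ geod_vel_integrable, of \<sigma> \<zeta> \<tau>]
  by (simp add: geod_end_eq arc_length_geod_vel)

lemma cc_dist_geod_end:
  assumes "\<tau> \<in> \<Omega>" shows "cc_dist U (geod_end \<zeta> \<tau>) = norm \<zeta>"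
  unfolding cc_dist_def arc_length_def[symmetric]
proof (rule cInf_eq_minimum)
  show "norm \<zeta> \<in> {arc_length h |h. h absolutely_integrable_on {0..1} \<and>
      (hx h 1, ht U h 1) = geod_end \<zeta> \<tau>}"
    using geod_vel_integrable arc_length_geod_vel geod_end_eq
    by (intro CollectI exI[of _ "geod_vel \<zeta> \<tau>"]) simp
  fix l assume "l \<in> {arc_length h |h. h absolutely_integrable_on {0..1} \<and>
      (hx h 1, ht U h 1) = geod_end \<zeta> \<tau>}"
  then obtain h where h: "l = arc_length h" "h absolutely_integrable_on {0..1}"
    "(hx h 1, ht U h 1) = geod_end \<zeta> \<tau>" by blast
  have "(norm \<zeta>)\<^sup>2 \<le> l\<^sup>2"
    using phi_le_arc_length_sq[OF assms h(2)] unfolding h(3) phi_geod_end[OF assms] h(1) .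
  then show "norm \<zeta> \<le> l"
    by (rule power2_le_imp_le) (simp add: h(1) arc_length_nonneg[OF h(2)])
qed

lemma continuous_on_geod_end:
  assumes "continuous_on S f" "continuous_on S g"
  shows "continuous_on S (\<lambda>x. geod_end (f x) (g x))"
proof -
  define F where "F p r = (1/2) *\<^sub>R
      (\<chi> j. (U j *v ((r *\<^sub>R exp_mean (J (r *\<^sub>R snd p))) \<bullet>\<^sub>v fst p)) \<bullet> geod_vel (fst p) (snd p) r)"
    for p :: "(real^'q) \<times> (real^'m)" and r
  have "continuous_on (UNIV \<times> cbox 0 1) (\<lambda>(p, r). F p r)"
    unfolding F_def case_prod_beta
    by (intro continuous_on_scaleR continuous_on_vec_lambda continuous_on_inner continuous_on_const
        bounded_linear.continuous_on[OF matrix_vector_mul_bounded_linear] app.continuous_on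
        continuous_on_exp_mean_J continuous_on_geod_vel continuous_on_fst continuous_on_snd
        continuous_on_id)
  then have "continuous_on UNIV (\<lambda>p. integral (cbox 0 1) (F p))"
    by (rule integral_continuous_on_param)
  moreover have "integral (cbox 0 1) (F p) = ht U (geod_vel (fst p) (snd p)) 1" for p
    unfolding ht_def F_def by (auto intro!: integral_cong simp: hx_geod_vel pencil_scaleR)
  ultimately have "continuous_on UNIV (\<lambda>p. ht U (geod_vel (fst p) (snd p)) 1)" by simp
  from continuous_on_compose2[OF this continuous_on_Pair[OF assms]]
  have ht: "continuous_on S (\<lambda>x. ht U (geod_vel (f x) (g x)) 1)" by simp
  show ?thesis
    unfolding geod_end_def
    by (rule continuous_on_Pair[OF app.continuous_on[OF continuous_on_exp_mean_J] ht]) (rule assms)+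
qed

subsection \<open>Critical points of \<open>\<phi>\<close>\<close>

definition coth_form :: "(real^'q) \<times> (real^'m) \<Rightarrow> real" where
  "coth_form p = (exp_mean_inv (J (snd p)) \<bullet>\<^sub>v fst p) \<bullet> fst p"

lemma phi_eq_coth_form: "\<tau> \<in> \<Omega> \<Longrightarrow> phi U g \<tau> = coth_form (fst g, \<tau>) + 4 * (snd g \<bullet> \<tau>)"
  by (simp add: phi_eq[OF skew] coth_form_def)

lemma open_UNIV_Times_Omega: "open (UNIV \<times> \<Omega>)"
  by (intro open_Times open_UNIV open_Omega)

lemma Ck_on_exp_mean_inv_J: "Ck_on k \<Omega> (\<lambda>\<tau>. exp_mean_inv (J \<tau>))"
proof (rule Ck_on_algebra_inverse)
  show "inverse_functions (\<lambda>\<tau>. exp_mean (J \<tau>)) (\<lambda>\<tau>. exp_mean_inv (J \<tau>)) \<Omega>"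
    by unfold_locales
       (auto simp: open_Omega mem_Omega_star_iff exp_mean_right_inverse exp_mean_left_inverse)
  show "Ck_on k \<Omega> (\<lambda>\<tau>. exp_mean (J \<tau>))" for k
    by (rule Ck_on_subset[OF Ck_on_exp_mean_J subset_UNIV])
qed

lemma Ck_on_coth_form: "Ck_on k (UNIV \<times> \<Omega>) coth_form"
proof -
  have "Ck_on k (UNIV \<times> \<Omega>) (\<lambda>p. exp_mean_inv (J (snd p)))"
    by (rule Ck_on_compose[OF Ck_on_exp_mean_inv_J Ck_on_bounded_linear[OF bounded_linear_snd]])
       auto
  then show ?thesis
    unfolding coth_form_def[abs_def]
    by (intro Ck_on_bounded_bilinear[OF bounded_bilinear_inner]
        Ck_on_bounded_bilinear[OF bounded_bilinear_app] Ck_on_bounded_linear[OF bounded_linear_fst])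
qed

lemma coth_form_has_derivative:
  "\<tau> \<in> \<Omega> \<Longrightarrow> (coth_form has_derivative (\<lambda>v. grad coth_form (x, \<tau>) \<bullet> v)) (at (x, \<tau>))"
  by (intro Ck_on_has_derivative_grad[OF open_UNIV_Times_Omega Ck_on_coth_form]) simp

text \<open>The value of \<open>t\<close> for which \<open>\<tau>\<close> is a critical point of \<open>\<phi>((x, t); \<cdot>)\<close>.\<close>
definition crit_height :: "(real^'q) \<times> (real^'m) \<Rightarrow> real^'m" where
  "crit_height p = - (1/4) *\<^sub>R snd (grad coth_form p)"

definition critical :: "(real^'q) \<times> (real^'m) \<Rightarrow> real^'m \<Rightarrow> bool" where
  "critical g \<tau> \<longleftrightarrow> \<tau> \<in> \<Omega> \<and> crit_height (fst g, \<tau>) = snd g"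

lemma Ck_on_crit_height: "Ck_on k (UNIV \<times> \<Omega>) crit_height"
  unfolding crit_height_def[abs_def]
  by (intro Ck_on_bounded_linear_compose[OF bounded_linear_scaleR_right]
      Ck_on_bounded_linear_compose[OF bounded_linear_snd] Ck_on_grad open_UNIV_Times_Omega
      Ck_on_coth_form)

lemma phi_has_derivative:
  assumes "\<tau> \<in> \<Omega>"
  shows "(phi U g has_derivative (\<lambda>h. (4 *\<^sub>R (snd g - crit_height (fst g, \<tau>))) \<bullet> h)) (at \<tau>)"
proof -
  have "((\<lambda>\<sigma>. coth_form (fst g, \<sigma>) + 4 * (snd g \<bullet> \<sigma>)) has_derivative
      (\<lambda>h. grad coth_form (fst g, \<tau>) \<bullet> (0, h) + 4 * (snd g \<bullet> h))) (at \<tau>)"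
    by (intro has_derivative_add has_derivative_compose_Pair[OF coth_form_has_derivative[OF assms]]
        has_derivative_mult_right has_derivative_inner_right has_derivative_ident)
  moreover have "grad coth_form (fst g, \<tau>) \<bullet> (0, h) + 4 * (snd g \<bullet> h)
      = (4 *\<^sub>R (snd g - crit_height (fst g, \<tau>))) \<bullet> h" for h
    by (simp add: crit_height_def inner_prod_def inner_diff_left inner_add_left)
  ultimately have "((\<lambda>\<sigma>. coth_form (fst g, \<sigma>) + 4 * (snd g \<bullet> \<sigma>)) has_derivative
      (\<lambda>h. (4 *\<^sub>R (snd g - crit_height (fst g, \<tau>))) \<bullet> h)) (at \<tau>)"
    by (simp only:)
  then show ?thesis
    by (rule has_derivative_transform_within_open[OF _ open_Omega assms])
       (simp add: phi_eq_coth_form)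
qed

text \<open>On the endpoint of the geodesic, \<open>\<phi>\<close> attains its upper bound at \<open>\<tau>\<close>, which is therefore a
  critical point.\<close>
lemma geod_end_exp_mean_inv:
  assumes "\<tau> \<in> \<Omega>"
  shows "geod_end (exp_mean_inv (J \<tau>) \<bullet>\<^sub>v x) \<tau> = (x, crit_height (x, \<tau>))"
proof -
  define \<zeta> g where "\<zeta> = exp_mean_inv (J \<tau>) \<bullet>\<^sub>v x" and "g = geod_end \<zeta> \<tau>"
  have fst_g: "fst g = x"
    unfolding g_def geod_end_def \<zeta>_def fst_conv
    by (metis app_mult app_one exp_mean_right_inverse assms mem_Omega_star_iff)
  have "(\<lambda>h. (4 *\<^sub>R (snd g - crit_height (fst g, \<tau>))) \<bullet> h) = (\<lambda>h. 0)"
    using phi_geod_end_le[of _ \<zeta> \<tau>] phi_geod_end[OF assms, of \<zeta>]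
    by (intro differential_zero_maxmin[OF assms open_Omega phi_has_derivative[OF assms]])
       (simp add: g_def)
  then have "snd g = crit_height (x, \<tau>)"
    unfolding fst_g by (metis inner_eq_zero_iff scaleR_eq_0_iff right_minus_eq zero_neq_numeral)
  then show ?thesis
    unfolding g_def[unfolded \<zeta>_def, symmetric] using fst_g by (simp add: prod_eq_iff)
qed

lemma critical_geod_end: "critical g \<tau> \<Longrightarrow> geod_end (exp_mean_inv (J \<tau>) \<bullet>\<^sub>v fst g) \<tau> = g"
  by (simp add: critical_def geod_end_exp_mean_inv prod_eq_iff)

definition sq_dist :: "(real^'q) \<times> (real^'m) \<Rightarrow> real" where
  "sq_dist g = (cc_dist U g)\<^sup>2"

lemma
  assumes "critical g \<tau>"
  shows critical_sq_dist: "sq_dist g = phi U g \<tau>"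
    and critical_phi_le: "\<sigma> \<in> \<Omega> \<Longrightarrow> phi U g \<sigma> \<le> sq_dist g"
proof -
  define \<zeta> where "\<zeta> = exp_mean_inv (J \<tau>) \<bullet>\<^sub>v fst g"
  have \<tau>: "\<tau> \<in> \<Omega>" and g: "geod_end \<zeta> \<tau> = g"
    using assms critical_geod_end by (simp_all add: critical_def \<zeta>_def)
  show "sq_dist g = phi U g \<tau>"
    unfolding g[symmetric] by (simp add: sq_dist_def cc_dist_geod_end[OF \<tau>] phi_geod_end[OF \<tau>])
  show "phi U g \<sigma> \<le> sq_dist g" if "\<sigma> \<in> \<Omega>"
    unfolding g[symmetric] using phi_geod_end_le[OF that]
    by (simp add: sq_dist_def cc_dist_geod_end[OF \<tau>])
qed

lemma inj_scaleR_iff: "c \<noteq> 0 \<Longrightarrow> inj (\<lambda>h. c *\<^sub>R H h) \<longleftrightarrow> inj (H :: 'v::real_vector \<Rightarrow> 'w::real_vector)"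
  by (simp add: inj_def)

lemma nondeg_crit_phiE:
  assumes \<tau>: "\<tau> \<in> \<Omega>" and "nondeg_crit (phi U g) \<tau>"
  obtains H where "crit_height (fst g, \<tau>) = snd g"
    "((\<lambda>\<sigma>. crit_height (fst g, \<sigma>)) has_derivative H) (at \<tau>)" "inj H"
proof -
  obtain G H where gradient: "\<forall>\<^sub>F \<sigma> in nhds \<tau>. (phi U g has_derivative (\<lambda>h. G \<sigma> \<bullet> h)) (at \<sigma>)"
    and G: "G \<tau> = 0" "(G has_derivative H) (at \<tau>)" "inj H"
    using assms(2) unfolding nondeg_crit_def by blast
  have "\<forall>\<^sub>F \<sigma> in nhds \<tau>. G \<sigma> = 4 *\<^sub>R (snd g - crit_height (fst g, \<sigma>))"
    using gradient eventually_nhds_in_open[OF open_Omega \<tau>]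
  proof eventually_elim
    case (elim \<sigma>)
    have "(\<lambda>h. G \<sigma> \<bullet> h) = (\<lambda>h. (4 *\<^sub>R (snd g - crit_height (fst g, \<sigma>))) \<bullet> h)"
      by (rule has_derivative_unique[OF elim(1) phi_has_derivative[OF elim(2)]])
    then show ?case by (metis vector_eq_rdot)
  qed
  then obtain S where S: "open S" "\<tau> \<in> S" "\<And>\<sigma>. \<sigma> \<in> S \<Longrightarrow> G \<sigma> = 4 *\<^sub>R (snd g - crit_height (fst g, \<sigma>))"
    unfolding eventually_nhds by blast
  have "((\<lambda>\<sigma>. snd g - (1/4) *\<^sub>R G \<sigma>) has_derivative (\<lambda>h. (- 1/4) *\<^sub>R H h)) (at \<tau>)"
    using has_derivative_diff[OF has_derivative_const has_derivative_scaleR_right[OF G(2)]]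
    by (rule has_derivative_eq_rhs) simp
  then have "((\<lambda>\<sigma>. crit_height (fst g, \<sigma>)) has_derivative (\<lambda>h. (- 1/4) *\<^sub>R H h)) (at \<tau>)"
    by (rule has_derivative_transform_within_open[OF _ S(1,2)]) (simp add: S(3))
  moreover have "inj (\<lambda>h. (- 1/4) *\<^sub>R H h)"
    using inj_scaleR_iff[of "- 1/4" H] G(3) by simp
  moreover have "crit_height (fst g, \<tau>) = snd g"
    using S(3)[OF S(2)] G(1) by simp
  ultimately show ?thesis using that by blast
qed

lemma nondeg_crit_phiI:
  assumes \<tau>: "\<tau> \<in> \<Omega>" and "crit_height (fst g, \<tau>) = snd g"
    and H: "((\<lambda>\<sigma>. crit_height (fst g, \<sigma>)) has_derivative H) (at \<tau>)" "inj H"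
  shows "nondeg_crit (phi U g) \<tau>"
proof -
  have hessian: "((\<lambda>\<sigma>. 4 *\<^sub>R (snd g - crit_height (fst g, \<sigma>))) has_derivative
      (\<lambda>h. (- 4) *\<^sub>R H h)) (at \<tau>)"
    using has_derivative_scaleR_right[OF has_derivative_diff[OF has_derivative_const H(1)]]
    by (rule has_derivative_eq_rhs) simp
  have inj: "inj (\<lambda>h. (- 4) *\<^sub>R H h)"
    using inj_scaleR_iff[of "- 4" H] H(2) by simp
  have gradient: "\<forall>\<^sub>F \<sigma> in nhds \<tau>.
      (phi U g has_derivative (\<lambda>h. (4 *\<^sub>R (snd g - crit_height (fst g, \<sigma>))) \<bullet> h)) (at \<sigma>)"
    using eventually_nhds_in_open[OF open_Omega \<tau>] by eventually_elim (rule phi_has_derivative)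
  show ?thesis
    unfolding nondeg_crit_def
    by (rule exI, rule exI, intro conjI, rule gradient, simp add: assms(2), rule hessian, rule inj)
qed

lemma mem_MM_iff:
  "g \<in> MM U \<longleftrightarrow>
    (\<exists>\<tau>. critical g \<tau> \<and> (\<exists>H. ((\<lambda>\<sigma>. crit_height (fst g, \<sigma>)) has_derivative H) (at \<tau>) \<and> inj H))"
  unfolding MM_def critical_def by (blast intro: nondeg_crit_phiI elim: nondeg_crit_phiE)

lemma MM_smooth_critical:
  assumes "g0 \<in> MM U"
  obtains V \<theta> where "open V" "g0 \<in> V" "\<And>k. Ck_on k V \<theta>" "\<And>g. g \<in> V \<Longrightarrow> critical g (\<theta> g)"
proof -
  obtain \<tau>0 H where \<tau>0: "\<tau>0 \<in> \<Omega>" "crit_height (fst g0, \<tau>0) = snd g0"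
    and H: "((\<lambda>\<sigma>. crit_height (fst g0, \<sigma>)) has_derivative H) (at \<tau>0)" "inj H"
    using assms unfolding mem_MM_iff critical_def by blast
  have "(fst g0, \<tau>0) \<in> UNIV \<times> \<Omega>" using \<tau>0 by simp
  from smooth_implicit_function[OF open_UNIV_Times_Omega this Ck_on_crit_height H]
  obtain V \<theta> where V: "open V" "(fst g0, crit_height (fst g0, \<tau>0)) \<in> V" "\<And>k. Ck_on k V \<theta>"
    "\<And>g. g \<in> V \<Longrightarrow> (fst g, \<theta> g) \<in> UNIV \<times> \<Omega> \<and> crit_height (fst g, \<theta> g) = snd g"
    by metis
  show ?thesis
    by (rule that[OF V(1) _ V(3)]) (use V(2,4) \<tau>0(2) in \<open>auto simp: critical_def\<close>)
qed

lemma not_mem_cut_locus_iff: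
  "g \<notin> cut_locus U \<longleftrightarrow> (\<exists>S. open S \<and> g \<in> S \<and> (\<forall>k. Ck_on k S sq_dist))"
  unfolding cut_locus_def sq_dist_def[abs_def]
  using Ck_on_imp_Cinf_on Cinf_on_imp_Ck_on by (simp, blast)

lemma MM_not_cut_locus:
  assumes "g \<in> MM U" shows "g \<notin> cut_locus U"
proof -
  obtain V \<theta> where V: "open V" "g \<in> V" "\<And>k. Ck_on k V \<theta>" and \<theta>: "\<And>p. p \<in> V \<Longrightarrow> critical p (\<theta> p)"
    using MM_smooth_critical[OF assms] by blast
  have "Ck_on k V sq_dist" for k
  proof (rule Ck_on_cong[OF V(1)])
    show "Ck_on k V (\<lambda>p. coth_form (fst p, \<theta> p) + 4 * (snd p \<bullet> \<theta> p))"
      by (intro Ck_on_add Ck_on_compose[OF Ck_on_coth_form] Ck_on_Pair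
          Ck_on_bounded_linear[OF bounded_linear_fst] V(3)
          Ck_on_bounded_linear_compose[OF bounded_linear_mult_right]
          Ck_on_bounded_bilinear[OF bounded_bilinear_inner]
          Ck_on_bounded_linear[OF bounded_linear_snd]) (use \<theta> in \<open>auto simp: critical_def\<close>)
    show "coth_form (fst p, \<theta> p) + 4 * (snd p \<bullet> \<theta> p) = sq_dist p" if "p \<in> V" for p
      using critical_sq_dist[OF \<theta>[OF that]] \<theta>[OF that] phi_eq_coth_form[of "\<theta> p" p]
      by (simp add: critical_def)
  qed
  then show ?thesis using V(1,2) not_mem_cut_locus_iff by blast
qed

end

subsection \<open>Points where the squared distance is smooth\<close>

lemma dense_open_sequence:
  fixes g :: "'a::metric_space"
  assumes "closure D = UNIV" "open S" "g \<in> S"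
  obtains u where "\<And>n. u n \<in> D \<inter> S" "u \<longlonglongrightarrow> g"
proof -
  have "g \<in> closure (D \<inter> S)"
    using assms open_Int_closure_subset[OF assms(2), of D] by (auto simp: Int_commute)
  then obtain u where "\<forall>n. u n \<in> D \<inter> S" "u \<longlonglongrightarrow> g"
    unfolding closure_sequential by blast
  then show ?thesis using that[of u] by blast
qed

lemma continuous_eq_on_dense:
  fixes f g :: "'a::metric_space \<Rightarrow> 'b::t2_space"
  assumes D: "closure D = UNIV" "open S" and f: "continuous_on S f" "continuous_on S g"
    and eq: "\<And>x. x \<in> D \<inter> S \<Longrightarrow> f x = g x" and x: "x \<in> S"
  shows "f x = g x"
proof -
  obtain u where u: "\<And>n. u n \<in> D \<inter> S" "u \<longlonglongrightarrow> x"
    using dense_open_sequence[OF D x] by blast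
  then have "(\<lambda>n. f (u n)) \<longlonglongrightarrow> f x" "(\<lambda>n. g (u n)) \<longlonglongrightarrow> g x"
    using continuous_on_tendsto_compose[OF f(1) u(2) x]
        continuous_on_tendsto_compose[OF f(2) u(2) x] by auto
  then show ?thesis using eq[OF u(1)] LIMSEQ_unique by simp
qed

lemma open_subset_norm_less:
  fixes L :: "'a::real_normed_vector \<Rightarrow> 'b::real_normed_vector"
  assumes "linear L" "0 < r" "open T" and T: "\<And>x. x \<in> T \<Longrightarrow> norm (L x) \<le> r" and "x \<in> T"
  shows "norm (L x) < r"
proof (rule ccontr)
  assume "\<not> norm (L x) < r"
  then have "norm (L x) = r" using T[OF \<open>x \<in> T\<close>] by simp
  have "((\<lambda>c::real. (1 + c) *\<^sub>R x) \<longlongrightarrow> (1 + 0) *\<^sub>R x) (at_right 0)"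
    by (intro tendsto_intros)
  then have "\<forall>\<^sub>F c in at_right 0. (1 + c) *\<^sub>R x \<in> T"
    using topological_tendstoD[OF _ \<open>open T\<close>] \<open>x \<in> T\<close> by fastforce
  moreover have "\<forall>\<^sub>F c::real in at_right 0. 0 < c" by (simp add: eventually_at_right_less)
  ultimately have "\<forall>\<^sub>F c in at_right 0. (1 + c) *\<^sub>R x \<in> T \<and> 0 < (c::real)"
    by (rule eventually_conj)
  then obtain c :: real where c: "(1 + c) *\<^sub>R x \<in> T" "0 < c"
    using eventually_happens' trivial_limit_at_right_real by blast
  have "norm (L ((1 + c) *\<^sub>R x)) = (1 + c) * r"
    using \<open>norm (L x) = r\<close> c(2) by (simp add: linear_cmul[OF \<open>linear L\<close>])
  then show False
    using T[OF c(1)] mult_pos_pos[OF c(2) \<open>0 < r\<close>] by (simp add: distrib_right)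
qed

context skew_family
begin

lemma coth_form_has_derivative_fst:
  assumes "\<tau> \<in> \<Omega>"
  shows "((\<lambda>y. coth_form (y, \<tau>)) has_derivative
    (\<lambda>\<xi>. (2 *\<^sub>R ((exp_mean_inv (J \<tau>) + J \<tau>) \<bullet>\<^sub>v x)) \<bullet> \<xi>)) (at x)"
proof -
  let ?I = "exp_mean_inv (J \<tau>)"
  have "((\<lambda>y. (?I \<bullet>\<^sub>v y) \<bullet> y) has_derivative (\<lambda>\<xi>. (?I \<bullet>\<^sub>v x) \<bullet> \<xi> + (?I \<bullet>\<^sub>v \<xi>) \<bullet> x)) (at x)"
    by (intro has_derivative_inner has_derivative_ident bounded_linear_imp_has_derivative
        app.bounded_linear_right)
  moreover have "(?I \<bullet>\<^sub>v x) \<bullet> \<xi> + (?I \<bullet>\<^sub>v \<xi>) \<bullet> x = (2 *\<^sub>R ((?I + J \<tau>) \<bullet>\<^sub>v x)) \<bullet> \<xi>" for \<xi>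
    using is_adjointD[OF is_adjoint_exp_mean_inv[OF is_adjoint_J], of \<tau> \<xi> x] assms
    by (simp add: mem_Omega_star_iff app.add_left app.scaleR_left inner_add_left inner_add_right
        inner_commute)
  ultimately show ?thesis by (simp add: coth_form_def)
qed

text \<open>Near a point of \<open>MM\<close> the squared distance dominates \<open>\<phi>(\<cdot>; \<tau>)\<close>, with equality at the
  point, so both have the same derivative there.\<close>
lemma grad_sq_dist_MM:
  assumes g: "g \<in> MM U" and differentiable: "(sq_dist has_derivative D) (at g)"
  obtains \<tau> where "critical g \<tau>"
    "grad sq_dist g = (2 *\<^sub>R ((exp_mean_inv (J \<tau>) + J \<tau>) \<bullet>\<^sub>v fst g), 4 *\<^sub>R \<tau>)"
proof -
  obtain V \<theta> where V: "open V" "g \<in> V" and \<theta>: "\<And>p. p \<in> V \<Longrightarrow> critical p (\<theta> p)"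
    using MM_smooth_critical[OF g] by metis
  define \<tau> where "\<tau> = \<theta> g"
  have critical: "critical g \<tau>" using \<theta>[OF V(2)] by (simp add: \<tau>_def)
  then have \<tau>: "\<tau> \<in> \<Omega>" by (simp add: critical_def)
  define a where "a = (2 *\<^sub>R ((exp_mean_inv (J \<tau>) + J \<tau>) \<bullet>\<^sub>v fst g), 4 *\<^sub>R \<tau>)"
  have "((\<lambda>p. coth_form (fst p, \<tau>) + 4 * (snd p \<bullet> \<tau>)) has_derivative
      (\<lambda>v. (2 *\<^sub>R ((exp_mean_inv (J \<tau>) + J \<tau>) \<bullet>\<^sub>v fst g)) \<bullet> fst v + 4 * (snd v \<bullet> \<tau>))) (at g)"
    by (intro has_derivative_add
        has_derivative_compose[OF has_derivative_fst[OF has_derivative_ident]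
          coth_form_has_derivative_fst[OF \<tau>]]
        has_derivative_mult_right has_derivative_inner_left has_derivative_snd has_derivative_ident)
  then have "((\<lambda>p. sq_dist p - (coth_form (fst p, \<tau>) + 4 * (snd p \<bullet> \<tau>)))
      has_derivative (\<lambda>v. D v - a \<bullet> v)) (at g)"
    by (rule has_derivative_eq_rhs[OF has_derivative_diff[OF differentiable]])
       (simp add: a_def inner_prod_def inner_commute)
  then have "(\<lambda>v. D v - a \<bullet> v) = (\<lambda>v. 0)"
  proof (rule differential_zero_maxmin[OF V(2,1)])
    have "sq_dist g - (coth_form (fst g, \<tau>) + 4 * (snd g \<bullet> \<tau>)) = 0"
      using critical_sq_dist[OF critical] by (simp add: phi_eq_coth_form[OF \<tau>])
    moreover have "0 \<le> sq_dist p - (coth_form (fst p, \<tau>) + 4 * (snd p \<bullet> \<tau>))" if "p \<in> V" for p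
      using critical_phi_le[OF \<theta>[OF that] \<tau>] by (simp add: phi_eq_coth_form[OF \<tau>])
    ultimately show "(\<forall>p\<in>V. sq_dist p - (coth_form (fst p, \<tau>) + 4 * (snd p \<bullet> \<tau>))
          \<le> sq_dist g - (coth_form (fst g, \<tau>) + 4 * (snd g \<bullet> \<tau>))) \<or>
        (\<forall>p\<in>V. sq_dist g - (coth_form (fst g, \<tau>) + 4 * (snd g \<bullet> \<tau>))
          \<le> sq_dist p - (coth_form (fst p, \<tau>) + 4 * (snd p \<bullet> \<tau>)))" by simp
  qed
  then have "D = (\<lambda>v. a \<bullet> v)" by (auto simp: fun_eq_iff)
  then have "grad sq_dist g = a" using grad_eqI differentiable by blast
  then show ?thesis using that[OF critical] by (simp add: a_def)
qed

text \<open>Inverts the formula of \<open>grad_sq_dist_MM\<close>: the parameters of the minimising geodesic to \<open>g\<close>.\<close>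
definition covector :: "(real^'q) \<times> (real^'m) \<Rightarrow> real^'m" where
  "covector g = (1/4) *\<^sub>R snd (grad sq_dist g)"

definition init_vel :: "(real^'q) \<times> (real^'m) \<Rightarrow> real^'q" where
  "init_vel g = (1/2) *\<^sub>R fst (grad sq_dist g) - J (covector g) \<bullet>\<^sub>v fst g"

lemma MM_geodesic_parameters:
  assumes "g \<in> MM U" "(sq_dist has_derivative D) (at g)"
  shows "critical g (covector g)" "geod_end (init_vel g) (covector g) = g"
proof -
  obtain \<tau> where \<tau>: "critical g \<tau>"
    "grad sq_dist g = (2 *\<^sub>R ((exp_mean_inv (J \<tau>) + J \<tau>) \<bullet>\<^sub>v fst g), 4 *\<^sub>R \<tau>)"
    using grad_sq_dist_MM[OF assms] .
  then have "covector g = \<tau>" "init_vel g = exp_mean_inv (J \<tau>) \<bullet>\<^sub>v fst g"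
    by (simp_all add: covector_def init_vel_def app.add_left)
  then show "critical g (covector g)" "geod_end (init_vel g) (covector g) = g"
    using \<tau>(1) critical_geod_end by simp_all
qed

end

locale smooth_sq_dist = skew_family U for U :: "'m::finite \<Rightarrow> real^'q::finite^'q" +
  fixes S :: "((real^'q) \<times> (real^'m)) set"
  assumes dense: "closure (MM U) = UNIV" and open_S: "open S" and smooth: "\<And>k. Ck_on k S sq_dist"
begin

lemma Ck_on_grad_sq_dist: "Ck_on k S (grad sq_dist)"
  by (rule Ck_on_grad[OF open_S smooth])

lemma Ck_on_covector: "Ck_on k S covector"
  unfolding covector_def[abs_def]
  by (intro Ck_on_bounded_linear_compose[OF bounded_linear_scaleR_right]
      Ck_on_bounded_linear_compose[OF bounded_linear_snd] Ck_on_grad_sq_dist)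

lemma continuous_on_covector: "continuous_on S covector"
  by (rule Ck_on_imp_continuous_on[OF Ck_on_covector])

lemma continuous_on_init_vel: "continuous_on S init_vel"
  unfolding init_vel_def[abs_def]
  by (intro continuous_intros app.continuous_on Ck_on_imp_continuous_on[OF Ck_on_grad_sq_dist]
      continuous_on_compose2[OF continuous_on_J continuous_on_covector]) auto

lemma geodesic_parameters_dense:
  assumes "g \<in> MM U \<inter> S"
  shows "critical g (covector g)" "geod_end (init_vel g) (covector g) = g"
  using MM_geodesic_parameters[OF _ Ck_on_has_derivative_grad[OF open_S smooth]] assms by blast+

lemma geod_end_parameters:
  assumes "g \<in> S" shows "geod_end (init_vel g) (covector g) = g"
  using continuous_on_geod_end[OF continuous_on_init_vel continuous_on_covector] continuous_on_id
    geodesic_parameters_dense(2) assms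
  by (rule continuous_eq_on_dense[OF dense open_S])

lemma norm_J_covector_le: "g \<in> S \<Longrightarrow> norm (J (covector g)) \<le> pi"
proof -
  assume "g \<in> S"
  then obtain u where u: "\<And>n. u n \<in> MM U \<inter> S" "u \<longlonglongrightarrow> g"
    using dense_open_sequence[OF dense open_S] by blast
  have "continuous_on S (\<lambda>g. norm (J (covector g)))"
    by (intro continuous_on_norm
        continuous_on_compose2[OF continuous_on_J continuous_on_covector]) auto
  then have "(\<lambda>n. norm (J (covector (u n)))) \<longlonglongrightarrow> norm (J (covector g))"
    using continuous_on_tendsto_compose[OF _ u(2) \<open>g \<in> S\<close>] u(1) by auto
  moreover have "norm (J (covector (u n))) \<le> pi" for n
    using geodesic_parameters_dense(1)[OF u(1)]
    by (simp add: critical_def mem_Omega_star_iff less_imp_le)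
  ultimately show ?thesis by (intro LIMSEQ_le_const2) auto
qed

lemma open_covector_image: "open (covector ` S)"
proof -
  have "inj_on (\<lambda>g. (init_vel g, covector g)) S"
    by (rule inj_on_inverseI[of _ "\<lambda>(\<zeta>, \<tau>). geod_end \<zeta> \<tau>"]) (simp add: geod_end_parameters)
  then have "open ((\<lambda>g. (init_vel g, covector g)) ` S)"
    by (intro invariance_of_domain open_S continuous_on_Pair continuous_on_init_vel
        continuous_on_covector)
  then have "open (snd ` (\<lambda>g. (init_vel g, covector g)) ` S)" by (rule open_image_snd)
  then show ?thesis by (simp add: image_image)
qed

lemma covector_in_Omega: "g \<in> S \<Longrightarrow> covector g \<in> \<Omega>"
  unfolding mem_Omega_star_iff
  by (rule open_subset_norm_less[OF _ pi_gt_zero open_covector_image])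
     (auto simp: norm_J_covector_le bounded_linear.linear[OF bounded_linear_pencil])

lemma crit_height_covector:
  assumes "g \<in> S" shows "crit_height (fst g, covector g) = snd g"
proof (rule continuous_eq_on_dense[OF dense open_S _ _ _ assms])
  show "continuous_on S (\<lambda>g. crit_height (fst g, covector g))"
    by (rule continuous_on_compose2[OF Ck_on_imp_continuous_on[OF Ck_on_crit_height]])
       (auto simp: covector_in_Omega intro!: continuous_intros continuous_on_covector)
  show "continuous_on S (snd :: (real^'q) \<times> (real^'m) \<Rightarrow> _)" by (intro continuous_intros)
qed (use geodesic_parameters_dense(1) in \<open>simp add: critical_def\<close>)

lemma subset_MM: "S \<subseteq> MM U"
proof
  fix g assume g: "g \<in> S"
  obtain x t where g_eq: "g = (x, t)" by fastforce
  define H where "H h = frechet_derivative crit_height (at (x, covector g)) (0, h)" for h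
  define C where "C h = frechet_derivative covector (at (x, t)) (0, h)" for h
  have H: "((\<lambda>\<sigma>. crit_height (x, \<sigma>)) has_derivative H) (at (covector g))"
    unfolding H_def[abs_def]
    by (intro has_derivative_compose_Pair
        Ck_on_frechet_derivative(1)[OF open_UNIV_Times_Omega Ck_on_crit_height])
       (simp add: covector_in_Omega[OF g])
  have C: "((\<lambda>t. covector (x, t)) has_derivative C) (at t)"
    unfolding C_def[abs_def]
    by (intro has_derivative_compose_Pair Ck_on_frechet_derivative(1)[OF open_S Ck_on_covector])
       (use g g_eq in simp)
  have "((\<lambda>t. crit_height (x, covector (x, t))) has_derivative (\<lambda>h. H (C h))) (at t)"
    using has_derivative_compose[OF C] H by (simp add: g_eq)
  moreover have "((\<lambda>t. crit_height (x, covector (x, t))) has_derivative (\<lambda>h. h)) (at t)"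
  proof (rule has_derivative_transform_within_open[OF has_derivative_ident])
    show "open (Pair x -` S)" by (intro open_vimage open_S continuous_intros)
    show "t \<in> Pair x -` S" using g g_eq by simp
    show "s = crit_height (x, covector (x, s))" if "s \<in> Pair x -` S" for s
      using crit_height_covector[of "(x, s)"] that by simp
  qed
  ultimately have "(\<lambda>h. H (C h)) = (\<lambda>h. h)"
    by (rule has_derivative_unique)
  then have "surj H" by (metis surjI)
  then have "inj H"
    using has_derivative_linear[OF H] linear_surjective_imp_injective by blast
  then show "g \<in> MM U"
    unfolding mem_MM_iff critical_def
    by (intro exI[of _ "covector g"] exI[of _ H] conjI covector_in_Omega crit_height_covector g)
       (use H in \<open>simp_all add: g_eq\<close>)
qed

end

theorem theorem2p12:
  fixes U :: "'m::finite \<Rightarrow> real^'q::finite^'q"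
  assumes skew: "\<And>j. transpose (U j) = - U j"
    and indep: "\<And>c. (\<Sum>j\<in>UNIV. c j *\<^sub>R U j) = 0 \<Longrightarrow> (\<forall>j. c j = 0)"
    and dense: "closure (MM U) = UNIV"
  shows "cut_locus U = UNIV - MM U"
proof -
  interpret skew_family U by (rule skew_family.intro) (rule skew)
  have "g \<in> MM U" if smooth: "g \<notin> cut_locus U" for g
  proof -
    obtain S where S: "open S" "g \<in> S" "\<And>k. Ck_on k S sq_dist"
      using smooth not_mem_cut_locus_iff by blast
    then have "smooth_sq_dist U S"
      using dense by unfold_locales
    then show ?thesis using S(2) smooth_sq_dist.subset_MM by blast
  qed
  then show ?thesis using MM_not_cut_locus by blast
qed

end
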